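(* Let $G\le\mathrm{Sym}(n)$ be a Frobenius group with Frobenius complement $H$ and Frobenius kernel $K$ (so $G=KH$). Then the derangement graph $\Gamma_G$ is the disjoint union of $|H|$ copies of the complete graph $K_n$ on $n$ vertices.
   Context: A transitive permutation group $G\le\mathrm{Sym}(n)$ is a Frobenius group if no non-identity element fixes more than one point of $[n]$ and some non-identity element fixes a point. A Frobenius complement is a non-trivial proper subgroup $H$ with $H\cap g^{-1}Hg=\{\mathrm{id}\}$ for all $g\in G\setminus H$ (e.g. a point-stabilizer); the Frobenius kernel is $K=\big(G\setminus\bigcup_{g\in G}g^{-1}Hg\big)\cup\{\mathrm{id}\}$. The derangement graph $\Gamma_G$ of a permutation group $G$ is the Cayley graph with vertex set $G$ in which $g$ and $h$ are adjacent iff $gh^{-1}$ has no fixed point in $[n]$. *)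

theory Defs
  imports
    "HOL-Algebra.Sym_Groups"
    "Graph_Theory.Kuratowski"
    "Graph_Theory.Digraph_Isomorphism"
begin

text \<open>A permutation group of degree \<open>n\<close> is a set \<open>G\<close> of permutations of \<open>{1..n}\<close> with
  \<^term>\<open>subgroup G (sym_group n)\<close>; the following is \<open>G\<close> as a group in its own right.\<close>

abbreviation perm_group :: "nat \<Rightarrow> (nat \<Rightarrow> nat) set \<Rightarrow> (nat \<Rightarrow> nat) monoid" where
  "perm_group n G \<equiv> (sym_group n)\<lparr>carrier := G\<rparr>"

definition fixed_points :: "nat \<Rightarrow> (nat \<Rightarrow> nat) \<Rightarrow> nat set" where
  "fixed_points n g = {x \<in> {1..n}. g x = x}"

definition transitive_perm_group :: "nat \<Rightarrow> (nat \<Rightarrow> nat) set \<Rightarrow> bool" where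
  "transitive_perm_group n G \<longleftrightarrow>
     subgroup G (sym_group n) \<and> (\<forall>x\<in>{1..n}. \<forall>y\<in>{1..n}. \<exists>g\<in>G. g x = y)"

definition frobenius_group :: "nat \<Rightarrow> (nat \<Rightarrow> nat) set \<Rightarrow> bool" where
  "frobenius_group n G \<longleftrightarrow>
     transitive_perm_group n G \<and>
     (\<forall>g\<in>G. g \<noteq> id \<longrightarrow> card (fixed_points n g) \<le> 1) \<and>
     (\<exists>g\<in>G. g \<noteq> id \<and> fixed_points n g \<noteq> {})"

definition conjugate_set :: "('a, 'b) monoid_scheme \<Rightarrow> 'a \<Rightarrow> 'a set \<Rightarrow> 'a set" where
  "conjugate_set G g H = (\<lambda>h. inv\<^bsub>G\<^esub> g \<otimes>\<^bsub>G\<^esub> h \<otimes>\<^bsub>G\<^esub> g) ` H"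

definition frobenius_complement :: "('a, 'b) monoid_scheme \<Rightarrow> 'a set \<Rightarrow> bool" where
  "frobenius_complement G H \<longleftrightarrow>
     subgroup H G \<and> H \<noteq> {\<one>\<^bsub>G\<^esub>} \<and> H \<noteq> carrier G \<and>
     (\<forall>g\<in>carrier G - H. H \<inter> conjugate_set G g H = {\<one>\<^bsub>G\<^esub>})"

definition frobenius_kernel :: "('a, 'b) monoid_scheme \<Rightarrow> 'a set \<Rightarrow> 'a set" where
  "frobenius_kernel G H = (carrier G - (\<Union>g\<in>carrier G. conjugate_set G g H)) \<union> {\<one>\<^bsub>G\<^esub>}"

text \<open>Undirected graphs are symmetric digraphs: an edge is a pair of opposite arcs.\<close>

definition derangement_graph :: "nat \<Rightarrow> (nat \<Rightarrow> nat) set \<Rightarrow> (nat \<Rightarrow> nat) pair_pre_digraph" where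
  "derangement_graph n G =
     \<lparr>pverts = G,
      parcs = {(g, h). g \<in> G \<and> h \<in> G \<and>
        fixed_points n (g \<otimes>\<^bsub>perm_group n G\<^esub> inv\<^bsub>perm_group n G\<^esub> h) = {}}\<rparr>"

definition complete_graph :: "nat \<Rightarrow> nat pair_pre_digraph" where
  "complete_graph n = \<lparr>pverts = {..<n}, parcs = {(u, v). u < n \<and> v < n \<and> u \<noteq> v}\<rparr>"

lemma complete_digraph_complete_graph: "complete_digraph n (with_proj (complete_graph n))"
  by (auto simp: complete_digraph_pair_def complete_graph_def)

text \<open>The disjoint union of \<open>m\<close> copies of \<open>X\<close>; the first component tags the copy.\<close>

definition disjoint_copies :: "nat \<Rightarrow> 'a pair_pre_digraph \<Rightarrow> (nat \<times> 'a) pair_pre_digraph" where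
  "disjoint_copies m X =
     \<lparr>pverts = {..<m} \<times> pverts X,
      parcs = {((i, u), (j, v)). i < m \<and> i = j \<and> (u, v) \<in> parcs X}\<rparr>"

end

theory Submission
  imports
    Defs
    "Jordan_Normal_Form.Schur_Decomposition"
    "HOL-Algebra.Multiplicative_Group"
    "HOL-Algebra.Sylow"
    "HOL-Number_Theory.Cong"
begin

text \<open>Let \<open>S\<close> be a point stabilizer.  By Frobenius' theorem the identity and the derangements form a
  normal subgroup \<open>K\<close> with \<open>G = K S\<close>, so two elements are adjacent iff they are distinct and lie in
  the same coset of \<open>K\<close>; as \<open>K\<close> acts regularly on the \<open>n\<close> points, each coset is a clique \<open>K\<^sub>n\<close>.

  Frobenius' theorem is proved with characters: a character \<open>\<phi>\<close> of \<open>H\<close>, extended to \<open>G\<close> by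
  \<open>\<phi>(1)\<close> on the kernel, has integral inner products with the irreducible characters of \<open>G\<close> and keeps
  its norm, so irreducible characters extend to irreducible characters.  The indicator function of
  the kernel is a combination of these extensions and therefore proportional to a convolution
  idempotent, which makes the kernel closed under multiplication.

  The complement \<open>H\<close> need not be a point stabilizer, so \<open>|H| = |S|\<close> also has to be shown.  Kernels
  being normal, two of them are comparable; a proper inclusion \<open>K\<^sub>1 < K\<^sub>2\<close> would make a complement
  \<open>H\<^sub>1\<close> of \<open>K\<^sub>1\<close> a Frobenius group acting without fixed points on the center of a Sylow subgroup of
  \<open>K\<^sub>1\<close>, which is impossible.\<close>

section \<open>Complex matrices\<close>

text \<open>An irreducible character \<chi> convolved with itself is |G|/\<chi>(1) times itself, and
  different ones convolve to 0. Extension keeps the degree, so in f = \<Sum> \<phi>(1) ext \<phi>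
  the weights \<phi>(1) cancel the denominators and f * f = |G| f. Since f is |H| times the
  indicator function of the kernel, it is nonnegative: a product of two kernel elements lying
  outside the kernel would be a point where f * f is positive and f is 0.

  The obstacle in comparing complements is that two of them are not known to be conjugate. Their
  orders are linked through |H| |K| = |G|, so equal kernels are enough. Against a proper inclusion
  of kernels, an abelian subgroup Z is used because the product of a family of its elements does not
  depend on an order of the factors. A Frattini argument finds a conjugate of the first complement
  that normalizes Z. This conjugate also supplements the larger kernel, and a count then places a
  conjugate of the second complement inside it, which yields the partition over which the products
  are compared.\<close>

lemma index_mult_mat_sum:
  assumes "A \<in> carrier_mat n m" "B \<in> carrier_mat m k" "i < n" "j < k"
  shows "(A * B) $$ (i,j) = (\<Sum>l<m. A $$ (i,l) * B $$ (l,j))"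
  using assms by (auto simp: scalar_prod_def lessThan_atLeast0)

definition mat_trace :: "'a::comm_monoid_add mat \<Rightarrow> 'a" where
  "mat_trace A = (\<Sum>i<dim_row A. A $$ (i,i))"

lemma mat_trace_comm:
  fixes A :: "'a::comm_semiring_0 mat"
  assumes "A \<in> carrier_mat n m" "B \<in> carrier_mat m n"
  shows "mat_trace (A * B) = mat_trace (B * A)"
proof -
  have "mat_trace (A * B) = (\<Sum>i<n. \<Sum>j<m. A $$ (i,j) * B $$ (j,i))"
    using assms by (auto simp: mat_trace_def scalar_prod_def lessThan_atLeast0)
  also have "\<dots> = (\<Sum>j<m. \<Sum>i<n. A $$ (i,j) * B $$ (j,i))"
    by (rule sum.swap)
  also have "\<dots> = mat_trace (B * A)"
    using assms by (auto simp: mat_trace_def scalar_prod_def lessThan_atLeast0 mult.commute)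
  finally show ?thesis .
qed

lemma mat_trace_conj:
  fixes A :: "'a::comm_semiring_1 mat"
  assumes "A \<in> carrier_mat n n" "P \<in> carrier_mat n n" "Q \<in> carrier_mat n n" "Q * P = 1\<^sub>m n"
  shows "mat_trace (P * A * Q) = mat_trace A"
proof -
  have "mat_trace (P * A * Q) = mat_trace (Q * (P * A))"
    using assms by (intro mat_trace_comm[of _ n n]) auto
  also have "Q * (P * A) = A"
    using assms by (simp flip: assoc_mult_mat[of Q n n P n A n])
  finally show ?thesis .
qed

lemma upper_triangular_mult_diag:
  fixes A B :: "'a::semiring_0 mat"
  assumes "A \<in> carrier_mat n n" "B \<in> carrier_mat n n" "upper_triangular A" "upper_triangular B" "i < n"
  shows "(A * B) $$ (i,i) = A $$ (i,i) * B $$ (i,i)"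
proof -
  have "(A * B) $$ (i,i) = (\<Sum>j\<in>{..<n}. A $$ (i,j) * B $$ (j,i))"
    using assms by (auto simp: scalar_prod_def lessThan_atLeast0)
  also have "\<dots> = (\<Sum>j\<in>{i}. A $$ (i,j) * B $$ (j,i))"
    using assms upper_triangularD[OF assms(3)] upper_triangularD[OF assms(4)]
    by (intro sum.mono_neutral_right) (auto, metis carrier_matD(1) linorder_neqE_nat mult_zero_left mult_zero_right)
  finally show ?thesis by simp
qed

lemma upper_triangular_mult:
  fixes A B :: "'a::semiring_0 mat"
  assumes "A \<in> carrier_mat n n" "B \<in> carrier_mat n n" "upper_triangular A" "upper_triangular B"
  shows "upper_triangular (A * B)"
proof (rule upper_triangularI)
  fix i j assume ij: "j < i" "i < dim_row (A * B)"
  have "A $$ (i,k) * B $$ (k,j) = 0" if "k < n" for k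
    using upper_triangularD[OF assms(3), of k i] upper_triangularD[OF assms(4), of j k] ij that assms
    by (cases "k < i") auto
  then show "(A * B) $$ (i,j) = 0"
    using ij assms by (auto simp: scalar_prod_def intro!: sum.neutral)
qed

lemma upper_triangular_pow:
  fixes A :: "'a::semiring_1 mat"
  assumes "A \<in> carrier_mat n n" "upper_triangular A"
  shows "upper_triangular (A ^\<^sub>m k) \<and> (\<forall>i<n. (A ^\<^sub>m k) $$ (i,i) = A $$ (i,i) ^ k)"
proof (induction k)
  case 0
  then show ?case using assms by auto
next
  case (Suc k)
  then show ?case
    using assms upper_triangular_mult[of "A ^\<^sub>m k" n A] upper_triangular_mult_diag[of "A ^\<^sub>m k" n A]
    by (auto simp: power_commutes)
qed

lemma complex_mat_triangularization:
  fixes A :: "complex mat"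
  assumes "A \<in> carrier_mat n n"
  obtains B P Q where "B \<in> carrier_mat n n" "P \<in> carrier_mat n n" "Q \<in> carrier_mat n n"
    "upper_triangular B" "P * Q = 1\<^sub>m n" "Q * P = 1\<^sub>m n" "A = P * B * Q" "B = Q * A * P"
proof -
  obtain as where "char_poly A = (\<Prod>a\<leftarrow>as. [:- a, 1:])"
    using char_poly_factorized[OF assms] by blast
  then obtain B where B: "B \<in> carrier_mat n n" "upper_triangular B" "similar_mat A B"
    using schur_decomposition_exists[OF assms] by blast
  then obtain P Q where "similar_mat_wit A B P Q" by (auto simp: similar_mat_def)
  note w = similar_mat_witD2[OF assms this] similar_mat_witD2[OF B(1) similar_mat_wit_sym[OF this]]
  show ?thesis by (rule that[of B P Q]) (use w B in auto)
qed

lemma sum_in_Nats: "(\<And>x. x \<in> A \<Longrightarrow> f x \<in> \<nat>) \<Longrightarrow> sum f A \<in> (\<nat> :: 'a::semiring_1 set)"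
  by (induction A rule: infinite_finite_induct) auto

text \<open>A triangular form of an idempotent is idempotent, so each diagonal entry satisfies b * b
  = b and is 0 or 1. All integrality of inner products of characters goes back to this.\<close>

lemma trace_idempotent_in_Nats:
  fixes A :: "complex mat"
  assumes A: "A \<in> carrier_mat n n" and "A * A = A"
  shows "mat_trace A \<in> \<nat>"
proof -
  obtain B P Q where B: "B \<in> carrier_mat n n" "P \<in> carrier_mat n n" "Q \<in> carrier_mat n n"
    "upper_triangular B" "P * Q = 1\<^sub>m n" "Q * P = 1\<^sub>m n" "A = P * B * Q" "B = Q * A * P"
    using complex_mat_triangularization[OF A] .
  have "B * B = Q * A * (P * Q) * A * P"
    unfolding B(8) using A B(1-3) by (simp add: assoc_mult_mat[of _ n n _ n _ n])
  also have "\<dots> = Q * (A * A) * P"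
    unfolding B(5) using A B(1-3) by (simp add: assoc_mult_mat[of _ n n _ n _ n])
  finally have BB: "B * B = B" by (simp only: assms(2) B(8)[symmetric])
  have "B $$ (i,i) \<in> \<nat>" if "i < n" for i
  proof -
    have "B $$ (i,i) = B $$ (i,i) * B $$ (i,i)"
      using upper_triangular_mult_diag[of B n B i] that B(1,4) BB by simp
    then have "B $$ (i,i) = 0 \<or> B $$ (i,i) = 1" by simp
    then show ?thesis by (metis Nats_0 Nats_1)
  qed
  then have "mat_trace B \<in> \<nat>"
    using B(1) by (auto simp: mat_trace_def intro: sum_in_Nats)
  moreover have "mat_trace A = mat_trace B"
    using mat_trace_conj[OF B(1-3,6)] B(7) by simp
  ultimately show ?thesis by simp
qed

text \<open>The eigenvalues of \<open>A\<close> are roots of unity, whose inverses are their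
  conjugates, and \<open>A ^\<^sub>m m\<close> is the inverse of \<open>A\<close>. The inverse is
  written as a power because triangular forms are compatible with powers.\<close>

lemma trace_power_inverse:
  fixes A :: "complex mat"
  assumes A: "A \<in> carrier_mat n n" and m: "A ^\<^sub>m Suc m = 1\<^sub>m n"
  shows "mat_trace (A ^\<^sub>m m) = cnj (mat_trace A)"
proof -
  obtain B P Q where B: "B \<in> carrier_mat n n" "P \<in> carrier_mat n n" "Q \<in> carrier_mat n n"
    "upper_triangular B" "P * Q = 1\<^sub>m n" "Q * P = 1\<^sub>m n" "A = P * B * Q" "B = Q * A * P"
    using complex_mat_triangularization[OF A] .
  have sim: "similar_mat_wit A B P Q"
    by (rule similar_mat_witI[OF B(5,6,7) A B(1-3)])
  have pow: "A ^\<^sub>m k = P * B ^\<^sub>m k * Q" for k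
    using similar_mat_wit_pow[OF sim, of k] by (auto simp: similar_mat_wit_def Let_def)
  have tr: "mat_trace (A ^\<^sub>m k) = (\<Sum>i<n. B $$ (i,i) ^ k)" for k
  proof -
    have "mat_trace (A ^\<^sub>m k) = mat_trace (B ^\<^sub>m k)"
      unfolding pow using B(1-6) by (intro mat_trace_conj) auto
    then show ?thesis
      using upper_triangular_pow[OF B(1,4), of k] B(1) by (simp add: mat_trace_def)
  qed
  have "B ^\<^sub>m Suc m = Q * A ^\<^sub>m Suc m * P"
    using similar_mat_wit_pow[OF similar_mat_wit_sym[OF sim], of "Suc m"]
    by (auto simp: similar_mat_wit_def Let_def)
  then have Bm: "B ^\<^sub>m Suc m = 1\<^sub>m n"
    unfolding m using B(1-6) by simp
  have "B $$ (i,i) ^ m = cnj (B $$ (i,i))" if "i < n" for i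
  proof -
    let ?z = "B $$ (i,i)"
    have z: "?z ^ Suc m = 1"
      using upper_triangular_pow[OF B(1,4), of "Suc m"] that by (auto simp only: Bm) (simp add: that)
    then have "cmod ?z ^ Suc m = 1" by (metis norm_one norm_power)
    then have "cmod ?z = 1" using power_eq_imp_eq_base[of "cmod ?z" "Suc m" 1] by simp
    then have "?z * cnj ?z = 1" by (simp add: complex_norm_square [symmetric])
    moreover have "?z * ?z ^ m = 1" using z by simp
    ultimately show ?thesis
      by (metis mult_cancel_left zero_neq_one mult_zero_left)
  qed
  then show ?thesis
    using tr[of m] tr[of 1] A by simp
qed

text \<open>The column space of \<open>X\<close> is invariant under every \<open>M\<close> that
  commutes with \<open>X\<close>; it is a proper subspace because \<open>X\<close> is singular and
  not 0 because \<open>X\<close> is not. The base change \<open>P\<close> that brings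
  \<open>X\<close> into row echelon form sends it to the span of the first \<open>r\<close> unit
  vectors, where \<open>r\<close> is the rank.\<close>

lemma block_triangular_of_commuting_singular:
  fixes X :: "'a::field mat"
  assumes X: "X \<in> carrier_mat d d" "X \<noteq> 0\<^sub>m d d"
    and v: "v \<in> carrier_vec d" "v \<noteq> 0\<^sub>v d" "X *\<^sub>v v = 0\<^sub>v d"
  obtains r P Q where "0 < r" "r < d" "P \<in> carrier_mat d d" "Q \<in> carrier_mat d d"
    "P * Q = 1\<^sub>m d" "Q * P = 1\<^sub>m d"
    "\<And>M i k. M \<in> carrier_mat d d \<Longrightarrow> M * X = X * M \<Longrightarrow> r \<le> i \<Longrightarrow> i < d \<Longrightarrow> k < r \<Longrightarrow>
       (P * M * Q) $$ (i,k) = 0"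
proof -
  define C where "C = gauss_jordan_single X"
  note gj = gauss_jordan_single[OF X(1) C_def[symmetric]]
  obtain P Q where PQ: "C = P * X" "P \<in> carrier_mat d d" "Q \<in> carrier_mat d d"
    "P * Q = 1\<^sub>m d" "Q * P = 1\<^sub>m d"
    using gj(4) by blast
  have C: "C \<in> carrier_mat d d" by (rule gj(2))
  obtain f where f: "pivot_fun C f d"
    using gj(3) C by (auto simp: row_echelon_form_def)
  note fD = pivot_funD[OF carrier_matD(1)[OF C] f]
  have d: "d > 0" using v by (cases d) auto
  have XC: "X = Q * C"
    unfolding PQ(1) using PQ X by (simp flip: assoc_mult_mat[of Q d d P d X d])
  \<comment> \<open>\<open>f i = d\<close> marks a zero row of the echelon form, so \<open>r\<close>
    is the number of nonzero rows.\<close>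
  define r where "r = (LEAST i. i = d \<or> f i = d)"
  have r: "r = d \<or> f r = d" unfolding r_def by (rule LeastI[of _ d]) simp
  have r_le: "r \<le> d" unfolding r_def by (rule Least_le) simp
  have below: "f i < d" if "i < r" for i
    using not_less_Least[of i "\<lambda>i. i = d \<or> f i = d"] that r_le fD(1)[of i] by (force simp: r_def)
  have above: "f i = d" if "r \<le> i" "i < d" for i
    using that
  proof (induction i rule: dec_induct)
    case base then show ?case using r by auto
  next
    case (step i) then show ?case using fD(1)[of "Suc i"] fD(3)[of i] by force
  qed
  have zero: "C $$ (i,j) = 0" if "r \<le> i" "i < d" "j < d" for i j
    using fD(2)[of i j] above[of i] that by simp
  have "r \<noteq> 0"
  proof
    assume "r = 0"
    then have "C = 0\<^sub>m d d" using zero C by (intro eq_matI) auto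
    then show False using XC PQ(3) X(2) by simp
  qed
  moreover have "r \<noteq> d"
  proof
    assume rd: "r = d"
    have "C *\<^sub>v v = 0\<^sub>v d" using gj(1)[OF v(1)] v by simp
    moreover have "C = 1\<^sub>m d \<or> row C (d - 1) = 0\<^sub>v d"
      using row_echelon_form_imp_1_or_0_row[OF C gj(3)] d by auto
    moreover have "row C (d - 1) \<noteq> 0\<^sub>v d"
      using pivot_fun_zero_row_iff[OF f C, of "d - 1"] below[of "d - 1"] rd d by auto
    ultimately show False using v by auto
  qed
  moreover have "(P * M * Q) $$ (i,k) = 0"
    if M: "M \<in> carrier_mat d d" "M * X = X * M" and ik: "r \<le> i" "i < d" "k < r" for M i k
  proof -
    let ?N = "P * M * Q"
    have N: "?N \<in> carrier_mat d d" using PQ M by auto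
    have "?N * C = P * M * (Q * P) * X"
      unfolding PQ(1) using PQ(2,3) M X by (simp add: assoc_mult_mat[of _ d d _ d _ d])
    also have "\<dots> = P * (M * X)"
      unfolding PQ(5) using PQ(2,3) M(1) X by (simp add: assoc_mult_mat[of _ d d _ d _ d])
    also have "\<dots> = C * M"
      unfolding M(2) PQ(1) using PQ(2,3) M(1) X by (simp add: assoc_mult_mat[of _ d d _ d _ d])
    finally have eq: "?N * C = C * M" .
    have fk: "f k < d" and kd: "k < d" using below ik r_le by auto
    \<comment> \<open>Column \<open>f k\<close> of \<open>C\<close> is the pivot column of row
      \<open>k\<close>, hence the \<open>k\<close>-th unit vector: multiplying by it reads off the
      entry \<open>(i,k)\<close> of \<open>?N\<close>.\<close>
    have "0 = (C * M) $$ (i, f k)"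
      using ik fk C M(1) zero[of i] by (auto simp: scalar_prod_def)
    also have "\<dots> = (\<Sum>l<d. ?N $$ (i,l) * C $$ (l, f k))"
      unfolding eq[symmetric] using ik fk by (intro index_mult_mat_sum[OF N C])
    also have "\<dots> = (\<Sum>l\<in>{k}. ?N $$ (i,l) * C $$ (l, f k))"
      using fD(5)[OF kd fk] kd by (intro sum.mono_neutral_right) auto
    also have "\<dots> = ?N $$ (i,k)" using fD(4)[OF kd fk] by simp
    finally show ?thesis by simp
  qed
  ultimately show ?thesis using that[of r P Q] PQ(2-5) r_le by auto
qed

section \<open>Kronecker products, for tensor products of representations\<close>

definition kron_mat :: "'a::times mat \<Rightarrow> 'a mat \<Rightarrow> 'a mat" where
  "kron_mat A B = mat (dim_row A * dim_row B) (dim_col A * dim_col B)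
     (\<lambda>(i,j). A $$ (i div dim_row B, j div dim_col B) * B $$ (i mod dim_row B, j mod dim_col B))"

lemma sum_div_mod:
  fixes f :: "nat \<Rightarrow> nat \<Rightarrow> 'a::comm_monoid_add"
  shows "(\<Sum>i<n * m. f (i div m) (i mod m)) = (\<Sum>i<n. \<Sum>j<m. f i j)"
proof (cases "m = 0")
  case False
  have "(\<Sum>i<n. \<Sum>j<m. f i j) = (\<Sum>(i,j)\<in>{..<n} \<times> {..<m}. f i j)"
    by (rule sum.cartesian_product)
  also have "\<dots> = (\<Sum>i<n * m. f (i div m) (i mod m))"
  proof (rule sum.reindex_bij_witness[of _ "\<lambda>k. (k div m, k mod m)" "\<lambda>(i,j). i * m + j"])
    fix a assume a: "a \<in> {..<n} \<times> {..<m}"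
    obtain i j where [simp]: "a = (i,j)" by (cases a)
    have ij: "i < n" "j < m" using a by auto
    have "i * m + j < Suc i * m" using ij by simp
    also have "\<dots> \<le> n * m" using ij by (intro mult_right_mono) auto
    finally show "(case a of (i,j) \<Rightarrow> i * m + j) \<in> {..<n * m}" by simp
  qed (use False in \<open>auto simp: less_mult_imp_div_less\<close>)
  finally show ?thesis by simp
qed simp

lemma kron_mat_carrier:
  "A \<in> carrier_mat a b \<Longrightarrow> B \<in> carrier_mat c d \<Longrightarrow> kron_mat A B \<in> carrier_mat (a * c) (b * d)"
  by (auto simp: kron_mat_def)

lemma kron_mat_mult:
  fixes A1 :: "'a::comm_semiring_0 mat"
  assumes "A1 \<in> carrier_mat a b" "A2 \<in> carrier_mat b c" "B1 \<in> carrier_mat a' b'" "B2 \<in> carrier_mat b' c'"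
  shows "kron_mat A1 B1 * kron_mat A2 B2 = kron_mat (A1 * A2) (B1 * B2)"
proof (rule eq_matI)
  fix i j assume "i < dim_row (kron_mat (A1 * A2) (B1 * B2))" "j < dim_col (kron_mat (A1 * A2) (B1 * B2))"
  then have ij: "i < a * a'" "j < c * c'" using assms by (auto simp: kron_mat_def)
  then have pos: "0 < a'" "0 < c'" by (auto intro: gr0I)
  have b: "i div a' < a" "j div c' < c" "i mod a' < a'" "j mod c' < c'"
    using ij pos by (auto simp: less_mult_imp_div_less)
  have "(kron_mat A1 B1 * kron_mat A2 B2) $$ (i,j) =
    (\<Sum>k<b * b'. (A1 $$ (i div a', k div b') * A2 $$ (k div b', j div c')) *
        (B1 $$ (i mod a', k mod b') * B2 $$ (k mod b', j mod c')))"
    using assms ij by (auto simp: kron_mat_def scalar_prod_def lessThan_atLeast0 ac_simps intro!: sum.cong)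
  also have "\<dots> = (\<Sum>k<b. \<Sum>l<b'. (A1 $$ (i div a', k) * A2 $$ (k, j div c')) *
        (B1 $$ (i mod a', l) * B2 $$ (l, j mod c')))"
    by (rule sum_div_mod)
  also have "\<dots> = kron_mat (A1 * A2) (B1 * B2) $$ (i,j)"
    using assms ij b
    by (simp add: kron_mat_def scalar_prod_def lessThan_atLeast0 sum_product)
  finally show "(kron_mat A1 B1 * kron_mat A2 B2) $$ (i,j) = kron_mat (A1 * A2) (B1 * B2) $$ (i,j)" .
qed (use assms in \<open>auto simp: kron_mat_def\<close>)

lemma kron_mat_one: "kron_mat (1\<^sub>m n) (1\<^sub>m m :: 'a::semiring_1 mat) = 1\<^sub>m (n * m)"
proof (rule eq_matI)
  fix i j assume ij: "i < dim_row (1\<^sub>m (n * m) :: 'a mat)" "j < dim_col (1\<^sub>m (n * m) :: 'a mat)"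
  then have m: "0 < m" by (auto intro: gr0I)
  have "i = j \<longleftrightarrow> i div m = j div m \<and> i mod m = j mod m"
    by (metis div_mult_mod_eq)
  then show "kron_mat (1\<^sub>m n) (1\<^sub>m m) $$ (i,j) = (1\<^sub>m (n * m) :: 'a mat) $$ (i,j)"
    using ij m by (auto simp: kron_mat_def less_mult_imp_div_less)
qed (auto simp: kron_mat_def)

lemma mat_trace_kron:
  fixes A B :: "'a::comm_semiring_0 mat"
  assumes "A \<in> carrier_mat n n" "B \<in> carrier_mat m m"
  shows "mat_trace (kron_mat A B) = mat_trace A * mat_trace B"
proof -
  have "mat_trace (kron_mat A B) = (\<Sum>i<n * m. A $$ (i div m, i div m) * B $$ (i mod m, i mod m))"
    using assms by (auto simp: mat_trace_def kron_mat_def intro!: sum.cong)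
  also have "\<dots> = (\<Sum>i<n. \<Sum>j<m. A $$ (i,i) * B $$ (j,j))" by (rule sum_div_mod)
  also have "\<dots> = mat_trace A * mat_trace B"
    using assms by (simp add: mat_trace_def sum_product)
  finally show ?thesis .
qed

section \<open>Characters of finite groups\<close>

locale finite_group = group +
  assumes finite_carrier [simp]: "finite (carrier G)"
begin

lemma carrier_not_empty [simp]: "carrier G \<noteq> {}"
  using one_closed by blast

lemma sum_translate_left:
  assumes "x \<in> carrier G"
  shows "(\<Sum>g\<in>carrier G. F (x \<otimes> g)) = (\<Sum>g\<in>carrier G. F g)"
  by (rule sum.reindex_bij_witness[of _ "\<lambda>g. inv x \<otimes> g" "\<lambda>g. x \<otimes> g"])
    (use assms in \<open>auto simp flip: m_assoc\<close>)

lemma sum_conjugate: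
  assumes "x \<in> carrier G"
  shows "(\<Sum>g\<in>carrier G. F (x \<otimes> g \<otimes> inv x)) = (\<Sum>g\<in>carrier G. F g)"
  by (rule sum.reindex_bij_witness[of _ "\<lambda>g. inv x \<otimes> g \<otimes> x" "\<lambda>g. x \<otimes> g \<otimes> inv x"])
    (use assms in \<open>auto simp: m_assoc, auto simp flip: m_assoc\<close>)

lemma sum_inverse: "(\<Sum>g\<in>carrier G. F (inv g)) = (\<Sum>g\<in>carrier G. F g)"
  by (rule sum.reindex_bij_witness[of _ "\<lambda>g. inv g" "\<lambda>g. inv g"]) auto

end

section \<open>Matrix representations and their characters\<close>

definition is_rep :: "('a, 'b) monoid_scheme \<Rightarrow> nat \<Rightarrow> ('a \<Rightarrow> complex mat) \<Rightarrow> bool" where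
  "is_rep G d \<rho> \<longleftrightarrow>
     (\<forall>g\<in>carrier G. \<rho> g \<in> carrier_mat d d) \<and> \<rho> \<one>\<^bsub>G\<^esub> = 1\<^sub>m d \<and>
     (\<forall>g\<in>carrier G. \<forall>h\<in>carrier G. \<rho> (g \<otimes>\<^bsub>G\<^esub> h) = \<rho> g * \<rho> h)"

text \<open>The value 0 outside the carrier makes two characters equal as functions as soon as they
  agree on the group, so \<open>Irr\<close> can be a plain set of functions.\<close>

definition rep_char :: "('a, 'b) monoid_scheme \<Rightarrow> ('a \<Rightarrow> complex mat) \<Rightarrow> 'a \<Rightarrow> complex" where
  "rep_char G \<rho> = (\<lambda>g. if g \<in> carrier G then mat_trace (\<rho> g) else 0)"

text \<open>Irreducibility is encoded by the conclusion of Schur's lemma.\<close>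

definition is_irr :: "('a, 'b) monoid_scheme \<Rightarrow> nat \<Rightarrow> ('a \<Rightarrow> complex mat) \<Rightarrow> bool" where
  "is_irr G d \<rho> \<longleftrightarrow> is_rep G d \<rho> \<and> d > 0 \<and>
     (\<forall>X\<in>carrier_mat d d. (\<forall>g\<in>carrier G. \<rho> g * X = X * \<rho> g) \<longrightarrow> (\<exists>c. X = c \<cdot>\<^sub>m 1\<^sub>m d))"

definition Irr :: "('a, 'b) monoid_scheme \<Rightarrow> ('a \<Rightarrow> complex) set" where
  "Irr G = {rep_char G \<rho> | \<rho> d. is_irr G d \<rho>}"

definition cinner :: "('a, 'b) monoid_scheme \<Rightarrow> ('a \<Rightarrow> complex) \<Rightarrow> ('a \<Rightarrow> complex) \<Rightarrow> complex" where
  "cinner G f h = (\<Sum>g\<in>carrier G. f g * cnj (h g)) / of_nat (card (carrier G))"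

definition class_function :: "('a, 'b) monoid_scheme \<Rightarrow> ('a \<Rightarrow> complex) \<Rightarrow> bool" where
  "class_function G f \<longleftrightarrow>
     (\<forall>x\<in>carrier G. \<forall>g\<in>carrier G. f (x \<otimes>\<^bsub>G\<^esub> g \<otimes>\<^bsub>G\<^esub> inv\<^bsub>G\<^esub> x) = f g)"

lemma cinner_diff_left: "cinner G (\<lambda>g. f g - h g) k = cinner G f k - cinner G h k"
  by (simp add: cinner_def sum_subtractf diff_divide_distrib algebra_simps)

lemma cinner_sum_left: "cinner G (\<lambda>g. \<Sum>i\<in>I. f i g) k = (\<Sum>i\<in>I. cinner G (f i) k)"
proof -
  have "(\<Sum>g\<in>carrier G. (\<Sum>i\<in>I. f i g) * cnj (k g)) = (\<Sum>i\<in>I. \<Sum>g\<in>carrier G. f i g * cnj (k g))"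
    by (simp add: sum_distrib_right sum.swap[of _ "carrier G" I])
  then show ?thesis by (simp add: cinner_def sum_divide_distrib)
qed

lemma cinner_smult_left: "cinner G (\<lambda>g. c * f g) k = c * cinner G f k"
  by (simp add: cinner_def sum_distrib_left algebra_simps)

lemma cinner_commute: "cinner G f h = cnj (cinner G h f)"
  by (simp add: cinner_def mult.commute)

lemma rep_carrier: "is_rep G d \<rho> \<Longrightarrow> g \<in> carrier G \<Longrightarrow> \<rho> g \<in> carrier_mat d d"
  and rep_one: "is_rep G d \<rho> \<Longrightarrow> \<rho> \<one>\<^bsub>G\<^esub> = 1\<^sub>m d"
  and rep_mult: "is_rep G d \<rho> \<Longrightarrow> g \<in> carrier G \<Longrightarrow> h \<in> carrier G \<Longrightarrow>
    \<rho> (g \<otimes>\<^bsub>G\<^esub> h) = \<rho> g * \<rho> h"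
  by (auto simp: is_rep_def)

lemma rep_mult_index:
  assumes "is_rep G d \<rho>" "g \<in> carrier G" "h \<in> carrier G" "i < d" "j < d"
  shows "\<rho> (g \<otimes>\<^bsub>G\<^esub> h) $$ (i,j) = (\<Sum>k<d. \<rho> g $$ (i,k) * \<rho> h $$ (k,j))"
  using assms by (simp add: rep_mult index_mult_mat_sum[OF rep_carrier rep_carrier])

lemma rep_char_eq_sum: "is_rep G d \<rho> \<Longrightarrow> g \<in> carrier G \<Longrightarrow> rep_char G \<rho> g = (\<Sum>i<d. \<rho> g $$ (i,i))"
  using rep_carrier[of G d \<rho> g] by (simp add: rep_char_def mat_trace_def)

context finite_group
begin

lemma card_carrier_pos: "0 < card (carrier G)"
  by (metis card_gt_0_iff empty_iff finite_carrier one_closed)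

lemma rep_char_one: "is_rep G d \<rho> \<Longrightarrow> rep_char G \<rho> \<one> = of_nat d"
  by (simp add: rep_char_eq_sum rep_one)

lemma rep_pow: "is_rep G d \<rho> \<Longrightarrow> g \<in> carrier G \<Longrightarrow> \<rho> (g [^] (k::nat)) = \<rho> g ^\<^sub>m k"
  by (induction k) (auto simp: rep_one rep_mult dest: rep_carrier)

lemma rep_char_inv:
  assumes "is_rep G d \<rho>" "g \<in> carrier G"
  shows "rep_char G \<rho> (inv g) = cnj (rep_char G \<rho> g)"
proof -
  obtain m where m: "Coset.order G = Suc m"
    using card_carrier_pos by (cases "Coset.order G") (auto simp: Coset.order_def)
  have 1: "g [^] Suc m = \<one>" using pow_order_eq_1[OF assms(2)] m by simp
  then have "inv g = g [^] m"
    using assms(2) by (metis inv_comm inv_equality nat_pow_Suc nat_pow_closed)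
  then have "rep_char G \<rho> (inv g) = mat_trace (\<rho> g ^\<^sub>m m)"
    using assms by (simp add: rep_char_def rep_pow)
  also have "\<dots> = cnj (mat_trace (\<rho> g))"
    using assms 1 rep_pow[OF assms, of "Suc m"]
    by (intro trace_power_inverse[of _ d]) (auto simp: rep_one dest: rep_carrier)
  finally show ?thesis using assms by (simp add: rep_char_def)
qed

lemma rep_char_class: "is_rep G d \<rho> \<Longrightarrow> class_function G (rep_char G \<rho>)"
  unfolding class_function_def
proof (intro ballI)
  fix x g assume \<rho>: "is_rep G d \<rho>" and x: "x \<in> carrier G" and g: "g \<in> carrier G"
  have "\<rho> (inv x) * \<rho> x = 1\<^sub>m d" using \<rho> x by (simp flip: rep_mult add: rep_one)
  then have "mat_trace (\<rho> x * \<rho> g * \<rho> (inv x)) = mat_trace (\<rho> g)"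
    using rep_carrier[OF \<rho>] x g by (intro mat_trace_conj) auto
  then show "rep_char G \<rho> (x \<otimes> g \<otimes> inv x) = rep_char G \<rho> g"
    using \<rho> x g by (simp add: rep_char_def rep_mult)
qed

text \<open>The average \<open>A\<close> of all \<rho> g is the projection onto the fixed vectors:
  \<rho> x * A = A by translating the sum, hence A * A = A. Its trace is the average of the
  character.\<close>

lemma rep_char_average_in_Nats:
  assumes \<rho>: "is_rep G d \<rho>"
  shows "(\<Sum>g\<in>carrier G. rep_char G \<rho> g) / of_nat (card (carrier G)) \<in> \<nat>"
proof -
  define n where "n = (of_nat (card (carrier G)) :: complex)"
  have n: "n \<noteq> 0" using card_carrier_pos by (simp add: n_def)
  define A where "A = mat d d (\<lambda>(i,j). (\<Sum>g\<in>carrier G. \<rho> g $$ (i,j)) / n)"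
  have A: "A \<in> carrier_mat d d" by (simp add: A_def)
  have fixed: "(\<Sum>k<d. \<rho> x $$ (i,k) * A $$ (k,j)) = A $$ (i,j)"
    if "x \<in> carrier G" "i < d" "j < d" for x i j
  proof -
    have "(\<Sum>k<d. \<rho> x $$ (i,k) * A $$ (k,j)) =
      (\<Sum>k<d. \<Sum>g\<in>carrier G. \<rho> x $$ (i,k) * \<rho> g $$ (k,j)) / n"
      using that by (simp add: A_def sum_distrib_left sum_divide_distrib)
    also have "\<dots> = (\<Sum>g\<in>carrier G. \<rho> (x \<otimes> g) $$ (i,j)) / n"
      using that \<rho> by (subst sum.swap) (simp add: rep_mult_index)
    also have "\<dots> = A $$ (i,j)"
      using that by (simp add: A_def sum_translate_left[of x "\<lambda>g. \<rho> g $$ (i,j)"])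
    finally show ?thesis .
  qed
  have "A * A = A"
  proof (rule eq_matI)
    fix i j assume "i < dim_row A" "j < dim_col A"
    then have ij: "i < d" "j < d" using A by auto
    have "(A * A) $$ (i,j) = (\<Sum>k<d. \<Sum>g\<in>carrier G. \<rho> g $$ (i,k) * A $$ (k,j)) / n"
      using ij by (subst index_mult_mat_sum[OF A A])
        (auto simp: A_def sum_distrib_right sum_divide_distrib intro!: sum.cong)
    also have "\<dots> = (\<Sum>g\<in>carrier G. \<Sum>k<d. \<rho> g $$ (i,k) * A $$ (k,j)) / n"
      by (subst sum.swap) simp
    also have "\<dots> = A $$ (i,j)"
      using ij n by (simp add: fixed n_def)
    finally show "(A * A) $$ (i,j) = A $$ (i,j)" .
  qed (use A in auto)
  then have "mat_trace A \<in> \<nat>" by (rule trace_idempotent_in_Nats[OF A])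
  moreover have "mat_trace A = (\<Sum>g\<in>carrier G. rep_char G \<rho> g) / n"
  proof -
    have "mat_trace A = (\<Sum>i<d. \<Sum>g\<in>carrier G. \<rho> g $$ (i,i)) / n"
      by (simp add: A_def mat_trace_def sum_divide_distrib)
    also have "\<dots> = (\<Sum>g\<in>carrier G. rep_char G \<rho> g) / n"
      by (subst sum.swap) (simp add: rep_char_eq_sum[OF \<rho>])
    finally show ?thesis .
  qed
  ultimately show ?thesis by (simp add: n_def)
qed

text \<open>The tensor product of \<rho> with the dual of \<sigma> has the summand of the inner
  product as its character, so the inner product is an average as in
  \<open>rep_char_average_in_Nats\<close>.\<close>

lemma cinner_rep_char_in_Nats:
  assumes \<rho>: "is_rep G d \<rho>" and \<sigma>: "is_rep G e \<sigma>"
  shows "cinner G (rep_char G \<rho>) (rep_char G \<sigma>) \<in> \<nat>"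
proof -
  \<comment> \<open>Inversion and transposition both reverse products, so together they turn
    \<sigma> into a representation again, the dual of \<sigma>.\<close>
  define \<tau> where "\<tau> g = kron_mat (\<rho> g) (transpose_mat (\<sigma> (inv g)))" for g
  have \<sigma>t: "transpose_mat (\<sigma> (inv g)) \<in> carrier_mat e e" if "g \<in> carrier G" for g
    using rep_carrier[OF \<sigma>, of "inv g"] that by simp
  have "is_rep G (d * e) \<tau>"
    unfolding is_rep_def
  proof (intro conjI ballI)
    fix g h assume g: "g \<in> carrier G" and h: "h \<in> carrier G"
    have "transpose_mat (\<sigma> (inv (g \<otimes> h))) = transpose_mat (\<sigma> (inv g)) * transpose_mat (\<sigma> (inv h))"
      using g h rep_carrier[OF \<sigma>, of "inv g"] rep_carrier[OF \<sigma>, of "inv h"]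
      by (simp add: inv_mult_group rep_mult[OF \<sigma>] transpose_mult[of _ e e _ e])
    then show "\<tau> (g \<otimes> h) = \<tau> g * \<tau> h"
      using g h rep_carrier[OF \<rho>] \<sigma>t
      by (simp add: \<tau>_def rep_mult[OF \<rho>] kron_mat_mult[of _ d d _ d _ e e _ e])
  qed (auto simp: \<tau>_def rep_one[OF \<rho>] rep_one[OF \<sigma>] kron_mat_one intro!: kron_mat_carrier
        rep_carrier[OF \<rho>] \<sigma>t)
  moreover have "rep_char G \<tau> g = rep_char G \<rho> g * cnj (rep_char G \<sigma> g)" if g: "g \<in> carrier G" for g
  proof -
    have "rep_char G \<tau> g = mat_trace (\<rho> g) * mat_trace (transpose_mat (\<sigma> (inv g)))"
      using g mat_trace_kron[OF rep_carrier[OF \<rho> g] \<sigma>t[OF g]] by (simp add: rep_char_def \<tau>_def)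
    also have "mat_trace (transpose_mat (\<sigma> (inv g))) = rep_char G \<sigma> (inv g)"
      using g rep_carrier[OF \<sigma>, of "inv g"] by (simp add: rep_char_def mat_trace_def)
    finally show ?thesis using g rep_char_inv[OF \<sigma> g] by (simp add: rep_char_def)
  qed
  ultimately show ?thesis
    using rep_char_average_in_Nats[of "d * e" \<tau>] by (simp add: cinner_def)
qed

text \<open>If Schur's conclusion fails, some matrix \<open>Y\<close> that is not scalar commutes
  with the representation. Subtracting an eigenvalue makes it singular but not 0, so all \<rho> g
  become block triangular simultaneously. The two diagonal blocks are representations, and the trace
  sees only them.\<close>

lemma rep_char_split:
  assumes \<rho>: "is_rep G d \<rho>" and d: "d > 0" and "\<not> is_irr G d \<rho>"
  obtains r \<alpha> \<delta> where "0 < r" "r < d" "is_rep G r \<alpha>" "is_rep G (d - r) \<delta>"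
    "\<And>g. rep_char G \<rho> g = rep_char G \<alpha> g + rep_char G \<delta> g"
proof -
  obtain Y where Y: "Y \<in> carrier_mat d d" "\<And>g. g \<in> carrier G \<Longrightarrow> \<rho> g * Y = Y * \<rho> g"
    "\<And>c. Y \<noteq> c \<cdot>\<^sub>m 1\<^sub>m d"
    using assms unfolding is_irr_def by blast
  obtain c v where ev: "eigenvector Y v c"
  proof -
    obtain as where as: "char_poly Y = (\<Prod>a\<leftarrow>as. [:- a, 1:])" "length as = d"
      using char_poly_factorized[OF Y(1)] by blast
    then obtain a as' where "as = a # as'" using d by (cases as) auto
    then have "poly (char_poly Y) a = 0" by (simp add: as(1))
    then have "eigenvalue Y a" using eigenvalue_root_char_poly[OF Y(1)] by simp
    then show ?thesis using that by (auto simp: eigenvalue_def)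
  qed
  define X where "X = char_matrix Y c"
  have X: "X \<in> carrier_mat d d" and X_eq: "X = Y + (- c) \<cdot>\<^sub>m 1\<^sub>m d"
    using Y(1) by (auto simp: X_def char_matrix_def)
  have v: "v \<in> carrier_vec d" "v \<noteq> 0\<^sub>v d" "X *\<^sub>v v = 0\<^sub>v d"
    using ev eigenvector_char_matrix[OF Y(1)] by (auto simp: X_def)
  have "X \<noteq> 0\<^sub>m d d"
  proof
    assume "X = 0\<^sub>m d d"
    then have "Y = c \<cdot>\<^sub>m 1\<^sub>m d"
    proof (intro eq_matI)
      fix i j assume "i < dim_row (c \<cdot>\<^sub>m 1\<^sub>m d)" "j < dim_col (c \<cdot>\<^sub>m 1\<^sub>m d)"
      then show "Y $$ (i,j) = (c \<cdot>\<^sub>m 1\<^sub>m d) $$ (i,j)"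
        using arg_cong[OF \<open>X = 0\<^sub>m d d\<close>, of "\<lambda>A. A $$ (i,j)"] Y(1) by (simp add: X_eq)
    qed (use Y(1) in auto)
    then show False using Y(3) by blast
  qed
  then obtain r P Q where r: "0 < r" "r < d" and PQ: "P \<in> carrier_mat d d" "Q \<in> carrier_mat d d"
    "P * Q = 1\<^sub>m d" "Q * P = 1\<^sub>m d"
    and zero: "\<And>M i k. M \<in> carrier_mat d d \<Longrightarrow> M * X = X * M \<Longrightarrow> r \<le> i \<Longrightarrow> i < d \<Longrightarrow> k < r \<Longrightarrow>
       (P * M * Q) $$ (i,k) = 0"
    using block_triangular_of_commuting_singular[OF X _ v] by metis
  define M where "M g = P * \<rho> g * Q" for g
  have M: "M g \<in> carrier_mat d d" if "g \<in> carrier G" for g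
    using PQ rep_carrier[OF \<rho> that] by (auto simp: M_def)
  have Mmult: "M (g \<otimes> h) = M g * M h" if g: "g \<in> carrier G" and h: "h \<in> carrier G" for g h
  proof -
    note cs = PQ(1,2) rep_carrier[OF \<rho> g] rep_carrier[OF \<rho> h]
    have "M g * M h = P * \<rho> g * (Q * P) * \<rho> h * Q"
      unfolding M_def using cs by (simp add: assoc_mult_mat[of _ d d _ d _ d])
    also have "\<dots> = M (g \<otimes> h)"
      unfolding M_def PQ(4) rep_mult[OF \<rho> g h] using cs by (simp add: assoc_mult_mat[of _ d d _ d _ d])
    finally show ?thesis by simp
  qed
  have Mone: "M \<one> = 1\<^sub>m d" using PQ by (simp add: M_def rep_one[OF \<rho>])
  have Mzero: "M g $$ (i,k) = 0" if g: "g \<in> carrier G" and "r \<le> i" "i < d" "k < r" for g i k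
    unfolding M_def
  proof (rule zero)
    note cs = rep_carrier[OF \<rho> g]
    show "\<rho> g * X = X * \<rho> g"
      unfolding X_eq using cs Y(1) Y(2)[OF g]
      by (simp add: mult_add_distrib_mat[of _ d d _ d] add_mult_distrib_mat[of _ d d _ _ d]
          mult_smult_distrib[OF cs one_carrier_mat] mult_smult_assoc_mat[of _ d d])
  qed (use that rep_carrier[OF \<rho> g] in auto)
  have Mindex: "M (g \<otimes> h) $$ (i,j) = (\<Sum>k<d. M g $$ (i,k) * M h $$ (k,j))"
    if "g \<in> carrier G" "h \<in> carrier G" "i < d" "j < d" for g h i j
    using that by (simp add: Mmult index_mult_mat_sum[OF M M])
  define \<alpha> where "\<alpha> g = mat r r (\<lambda>(i,j). M g $$ (i,j))" for g
  define \<delta> where "\<delta> g = mat (d - r) (d - r) (\<lambda>(i,j). M g $$ (i + r,j + r))" for g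
  have shift: "(\<Sum>k<d - r. F (k + r)) = (\<Sum>k=r..<d. F k)" for F :: "nat \<Rightarrow> complex"
    by (rule sum.reindex_bij_witness[of _ "\<lambda>i. i - r" "\<lambda>i. i + r"]) auto
  have split: "(\<Sum>k<d. F k) = (\<Sum>k<r. F k) + (\<Sum>k=r..<d. F k)" for F :: "nat \<Rightarrow> complex"
    using r by (subst sum.union_disjoint[symmetric]) (auto intro!: sum.cong)
  have "is_rep G r \<alpha>"
    unfolding is_rep_def
  proof (intro conjI ballI)
    fix g h assume g: "g \<in> carrier G" and h: "h \<in> carrier G"
    show "\<alpha> (g \<otimes> h) = \<alpha> g * \<alpha> h"
    proof (rule eq_matI)
      fix i j assume "i < dim_row (\<alpha> g * \<alpha> h)" "j < dim_col (\<alpha> g * \<alpha> h)"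
      then have ij: "i < r" "j < r" by (auto simp: \<alpha>_def)
      have "\<alpha> (g \<otimes> h) $$ (i,j) = (\<Sum>k<r. M g $$ (i,k) * M h $$ (k,j))"
        using ij r Mindex[OF g h, of i j] Mzero[OF h] by (simp add: \<alpha>_def split)
      then show "\<alpha> (g \<otimes> h) $$ (i,j) = (\<alpha> g * \<alpha> h) $$ (i,j)"
        using ij by (subst index_mult_mat_sum[of _ r r _ r]) (auto simp: \<alpha>_def)
    qed (auto simp: \<alpha>_def)
  qed (use r in \<open>auto simp: \<alpha>_def Mone intro!: eq_matI\<close>)
  moreover have "is_rep G (d - r) \<delta>"
    unfolding is_rep_def
  proof (intro conjI ballI)
    fix g h assume g: "g \<in> carrier G" and h: "h \<in> carrier G"
    show "\<delta> (g \<otimes> h) = \<delta> g * \<delta> h"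
    proof (rule eq_matI)
      fix i j assume "i < dim_row (\<delta> g * \<delta> h)" "j < dim_col (\<delta> g * \<delta> h)"
      then have ij: "i < d - r" "j < d - r" by (auto simp: \<delta>_def)
      have "\<delta> (g \<otimes> h) $$ (i,j) = (\<Sum>k=r..<d. M g $$ (i + r,k) * M h $$ (k,j + r))"
        using ij r Mindex[OF g h, of "i + r" "j + r"] Mzero[OF g] by (simp add: \<delta>_def split)
      also have "\<dots> = (\<Sum>k<d - r. M g $$ (i + r,k + r) * M h $$ (k + r,j + r))"
        by (rule shift[symmetric])
      finally show "\<delta> (g \<otimes> h) $$ (i,j) = (\<delta> g * \<delta> h) $$ (i,j)"
        using ij by (subst index_mult_mat_sum[of _ "d - r" "d - r" _ "d - r"]) (auto simp: \<delta>_def)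
    qed (auto simp: \<delta>_def)
  qed (use r in \<open>auto simp: \<delta>_def Mone intro!: eq_matI\<close>)
  moreover have "rep_char G \<rho> g = rep_char G \<alpha> g + rep_char G \<delta> g" for g
  proof (cases "g \<in> carrier G")
    case g: True
    have "mat_trace (\<rho> g) = mat_trace (M g)"
      unfolding M_def using PQ rep_carrier[OF \<rho> g] by (intro mat_trace_conj[symmetric]) auto
    also have "\<dots> = (\<Sum>k<r. M g $$ (k,k)) + (\<Sum>k=r..<d. M g $$ (k,k))"
      using M[OF g] by (simp add: mat_trace_def split)
    also have "\<dots> = mat_trace (\<alpha> g) + mat_trace (\<delta> g)"
      by (simp add: mat_trace_def \<alpha>_def \<delta>_def shift[of "\<lambda>k. M g $$ (k,k)"])
    finally show ?thesis using g by (simp add: rep_char_def)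
  qed (simp add: rep_char_def)
  ultimately show ?thesis using that r by blast
qed

text \<open>A list keeps the multiplicities of the constituents; in dimension 0 it is empty.\<close>

lemma rep_char_decompose:
  "is_rep G d \<rho> \<Longrightarrow> \<exists>L. set L \<subseteq> Irr G \<and> (\<forall>g. rep_char G \<rho> g = (\<Sum>\<psi>\<leftarrow>L. \<psi> g))"
proof (induction d arbitrary: \<rho> rule: less_induct)
  case (less d)
  consider "d = 0" | "is_irr G d \<rho>" | "d > 0" "\<not> is_irr G d \<rho>" by blast
  then show ?case
  proof cases
    case 1
    then have "rep_char G \<rho> g = 0" for g
      using rep_char_eq_sum[OF less.prems, of g] by (simp add: rep_char_def)
    then show ?thesis by (intro exI[of _ "[]"]) simp
  next
    case 2
    then have "rep_char G \<rho> \<in> Irr G" by (auto simp: Irr_def)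
    then show ?thesis by (intro exI[of _ "[rep_char G \<rho>]"]) simp
  next
    case 3
    then obtain r \<alpha> \<delta> where r: "0 < r" "r < d" "is_rep G r \<alpha>" "is_rep G (d - r) \<delta>"
      "\<And>g. rep_char G \<rho> g = rep_char G \<alpha> g + rep_char G \<delta> g"
      using rep_char_split[OF less.prems] by metis
    obtain L1 where L1: "set L1 \<subseteq> Irr G" "\<And>g. rep_char G \<alpha> g = (\<Sum>\<psi>\<leftarrow>L1. \<psi> g)"
      using less.IH[OF r(2,3)] by blast
    have "d - r < d" using r by simp
    then obtain L2 where "set L2 \<subseteq> Irr G" "\<And>g. rep_char G \<delta> g = (\<Sum>\<psi>\<leftarrow>L2. \<psi> g)"
      using less.IH[OF _ r(4)] by blast
    with L1 show ?thesis by (intro exI[of _ "L1 @ L2"]) (auto simp: r(5))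
  qed
qed

text \<open>Schur orthogonality within one representation: conjugating a matrix unit by all \<rho> g
  and summing gives a scalar matrix, whose trace determines the scalar. Pairs of different
  characters are settled in \<open>Irr_orthonormal\<close> from this norm and integrality.\<close>

lemma irr_norm:
  assumes irr: "is_irr G d \<rho>"
  shows "cinner G (rep_char G \<rho>) (rep_char G \<rho>) = 1"
proof -
  have \<rho>: "is_rep G d \<rho>" and d: "d > 0" using irr by (auto simp: is_irr_def)
  let ?n = "of_nat (card (carrier G)) :: complex"
  define S where "S i j k l = (\<Sum>g\<in>carrier G. \<rho> g $$ (i,j) * \<rho> (inv g) $$ (k,l))" for i j k l
  have S: "S i j k l = (if i = l \<and> j = k then ?n / of_nat d else 0)"
    if "i < d" "j < d" "k < d" "l < d" for i j k l
  proof -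
    \<comment> \<open>\<open>X\<close> is the sum of all \<rho> g * E * \<rho> (inv g), where E is
      the matrix unit at position (j,k).\<close>
    define X where "X = mat d d (\<lambda>(i,l). S i j k l)"
    have X: "X \<in> carrier_mat d d" by (simp add: X_def)
    have "\<rho> x * X = X * \<rho> x" if x: "x \<in> carrier G" for x
    proof (rule eq_matI)
      note cs = rep_carrier[OF \<rho> x]
      fix i l assume "i < dim_row (X * \<rho> x)" "l < dim_col (X * \<rho> x)"
      then have il: "i < d" "l < d" using X cs by auto
      have "(\<rho> x * X) $$ (i,l) = (\<Sum>m<d. \<Sum>g\<in>carrier G. \<rho> x $$ (i,m) * \<rho> g $$ (m,j) * \<rho> (inv g) $$ (k,l))"
        using il by (subst index_mult_mat_sum[OF cs X])
          (auto simp: X_def S_def sum_distrib_left mult.assoc intro!: sum.cong)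
      also have "\<dots> = (\<Sum>g\<in>carrier G. \<rho> (x \<otimes> g) $$ (i,j) * \<rho> (inv g) $$ (k,l))"
        using il \<open>j < d\<close> x by (subst sum.swap) (simp add: rep_mult_index[OF \<rho>] sum_distrib_right)
      also have "\<dots> = (\<Sum>g\<in>carrier G. \<rho> (x \<otimes> g) $$ (i,j) * \<rho> (inv (x \<otimes> g) \<otimes> x) $$ (k,l))"
        using x by (intro sum.cong) (auto simp: inv_mult_group m_assoc)
      also have "\<dots> = (\<Sum>g\<in>carrier G. \<rho> g $$ (i,j) * \<rho> (inv g \<otimes> x) $$ (k,l))"
        by (rule sum_translate_left[OF x])
      also have "\<dots> = (\<Sum>g\<in>carrier G. \<Sum>m<d. \<rho> g $$ (i,j) * \<rho> (inv g) $$ (k,m) * \<rho> x $$ (m,l))"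
        using il \<open>k < d\<close> x by (simp add: rep_mult_index[OF \<rho>] sum_distrib_left mult.assoc)
      also have "\<dots> = (X * \<rho> x) $$ (i,l)"
        using il by (subst index_mult_mat_sum[OF X cs], simp, simp, subst sum.swap)
          (auto simp: X_def S_def sum_distrib_right intro!: sum.cong)
      finally show "(\<rho> x * X) $$ (i,l) = (X * \<rho> x) $$ (i,l)" .
    qed (use X rep_carrier[OF \<rho> x] in auto)
    then obtain c where c: "X = c \<cdot>\<^sub>m 1\<^sub>m d" using irr X by (auto simp: is_irr_def)
    have entry: "S i j k l = (if i = l then c else 0)" if "i < d" "l < d" for i l
      using arg_cong[OF c, of "\<lambda>A. A $$ (i,l)"] that by (auto simp: X_def)
    \<comment> \<open>The trace of \<open>X\<close>, computed twice: from the scalar matrix, and by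
      collapsing each summand to an entry of \<rho> (inv g \<otimes> g), the identity
      matrix.\<close>
    have "of_nat d * c = (\<Sum>m<d. S m j k m)" using entry by simp
    also have "\<dots> = (\<Sum>g\<in>carrier G. \<Sum>m<d. \<rho> (inv g) $$ (k,m) * \<rho> g $$ (m,j))"
      unfolding S_def by (subst sum.swap) (simp add: mult.commute)
    also have "\<dots> = (\<Sum>g\<in>carrier G. \<rho> (inv g \<otimes> g) $$ (k,j))"
      using \<open>j < d\<close> \<open>k < d\<close> by (intro sum.cong refl rep_mult_index[OF \<rho>, symmetric]) auto
    also have "\<dots> = (if j = k then ?n else 0)"
      using \<open>j < d\<close> \<open>k < d\<close> by (simp add: rep_one[OF \<rho>])
    finally have "c = (if j = k then ?n / of_nat d else 0)"
      using d by (auto simp: field_simps split: if_splits)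
    then show ?thesis using entry that by auto
  qed
  have "(\<Sum>g\<in>carrier G. rep_char G \<rho> g * cnj (rep_char G \<rho> g)) =
    (\<Sum>g\<in>carrier G. (\<Sum>i<d. \<rho> g $$ (i,i)) * (\<Sum>k<d. \<rho> (inv g) $$ (k,k)))"
    using rep_char_inv[OF \<rho>] by (intro sum.cong refl) (metis inv_closed rep_char_eq_sum[OF \<rho>])
  also have "\<dots> = (\<Sum>g\<in>carrier G. \<Sum>i<d. \<Sum>k<d. \<rho> g $$ (i,i) * \<rho> (inv g) $$ (k,k))"
    by (simp add: sum_product)
  also have "\<dots> = (\<Sum>i<d. \<Sum>k<d. S i i k k)"
    unfolding S_def by (subst sum.swap, rule sum.cong[OF refl], rule sum.swap)
  also have "\<dots> = (\<Sum>i<d. \<Sum>k<d. if i = k then ?n / of_nat d else 0)"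
    by (intro sum.cong refl) (simp add: S)
  also have "\<dots> = ?n" using d by (simp add: sum.delta)
  finally show ?thesis using card_carrier_pos by (simp add: cinner_def)
qed

section \<open>Orthonormality and completeness of the irreducible characters\<close>

lemma IrrE:
  assumes "\<psi> \<in> Irr G"
  obtains d \<rho> where "is_irr G d \<rho>" "is_rep G d \<rho>" "d > 0" "\<psi> = rep_char G \<rho>"
  using assms by (auto simp: Irr_def is_irr_def)

lemma Irr_class: "\<psi> \<in> Irr G \<Longrightarrow> class_function G \<psi>"
  by (erule IrrE) (simp add: rep_char_class)

lemma Irr_one: "\<psi> \<in> Irr G \<Longrightarrow> \<exists>d>0. \<psi> \<one> = of_nat d"
  by (erule IrrE) (auto simp: rep_char_one)

lemma Irr_outside: "\<psi> \<in> Irr G \<Longrightarrow> g \<notin> carrier G \<Longrightarrow> \<psi> g = 0"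
  by (erule IrrE) (simp add: rep_char_def)

lemma Irr_inv: "\<psi> \<in> Irr G \<Longrightarrow> g \<in> carrier G \<Longrightarrow> \<psi> (inv g) = cnj (\<psi> g)"
  by (erule IrrE) (simp add: rep_char_inv)

lemma cinner_self_eq_0:
  assumes "cinner G f f = 0" "g \<in> carrier G"
  shows "f g = 0"
proof -
  have "(\<Sum>g\<in>carrier G. of_real ((cmod (f g))\<^sup>2) :: complex) = 0"
    using assms(1) card_carrier_pos by (simp add: cinner_def complex_norm_square del: of_real_power)
  then have "complex_of_real (\<Sum>g\<in>carrier G. (cmod (f g))\<^sup>2) = 0" by simp
  then have "(\<Sum>g\<in>carrier G. (cmod (f g))\<^sup>2) = 0" by (simp only: of_real_eq_0_iff)
  then have "(cmod (f g))\<^sup>2 = 0" using assms(2) by (subst (asm) sum_nonneg_eq_0_iff) auto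
  then show ?thesis by simp
qed

lemma cinner_self_nonneg: "0 \<le> Re (cinner G f f)"
proof -
  have "cinner G f f = of_real ((\<Sum>g\<in>carrier G. (cmod (f g))\<^sup>2) / card (carrier G))"
    by (simp add: cinner_def complex_norm_square del: of_real_power)
  then show ?thesis by (simp add: sum_nonneg)
qed

text \<open>Since \<open>\<langle>\<chi>,\<psi>\<rangle>\<close> is a natural number and \<open>\<parallel>\<chi> - \<psi>\<parallel>\<^sup>2 = 2 - 2\<langle>\<chi>,\<psi>\<rangle> \<ge> 0\<close>, the value
  \<open>\<langle>\<chi>,\<psi>\<rangle>\<close> is \<open>0\<close>, or it is \<open>1\<close> and \<open>\<chi> = \<psi>\<close>.\<close>

lemma Irr_orthonormal:
  assumes \<chi>: "\<chi> \<in> Irr G" and \<psi>: "\<psi> \<in> Irr G"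
  shows "cinner G \<chi> \<psi> = (if \<chi> = \<psi> then 1 else 0)"
proof -
  obtain d \<rho> e \<sigma> where rep: "is_irr G d \<rho>" "is_rep G d \<rho>" "\<chi> = rep_char G \<rho>"
    "is_irr G e \<sigma>" "is_rep G e \<sigma>" "\<psi> = rep_char G \<sigma>"
    using \<chi> \<psi> by (metis IrrE)
  have norm: "cinner G \<chi> \<chi> = 1" "cinner G \<psi> \<psi> = 1" using irr_norm rep by auto
  obtain n where n: "cinner G \<chi> \<psi> = of_nat n"
    using cinner_rep_char_in_Nats[OF rep(2,5)] rep(3,6) by (auto elim: Nats_cases)
  then have n': "cinner G \<psi> \<chi> = of_nat n" by (subst cinner_commute) simp
  let ?f = "\<lambda>g. \<chi> g - \<psi> g"
  have right: "cinner G k ?f = cinner G k \<chi> - cinner G k \<psi>" for k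
    using cinner_commute[of G k ?f] cinner_diff_left[of G \<chi> \<psi> k] cinner_commute[of G k] by simp
  have eq: "cinner G ?f ?f = 2 - 2 * of_nat n"
    unfolding cinner_diff_left right norm n n' by simp
  then have "0 \<le> 2 - 2 * real n" using cinner_self_nonneg[of ?f] by simp
  then have "n = 0 \<or> n = 1" by auto
  moreover have "\<chi> = \<psi>" if "n = 1"
  proof
    fix g show "\<chi> g = \<psi> g"
      using cinner_self_eq_0[of ?f g] eq that Irr_outside[OF \<chi>, of g] Irr_outside[OF \<psi>, of g]
      by (cases "g \<in> carrier G") auto
  qed
  ultimately show ?thesis using n norm by auto
qed

text \<open>The matrix \<open>T\<close>, the sum of all f g * \<rho> g, commutes with \<rho> because
  \<open>f\<close> is a class function, so it is a scalar c. The trace of T * \<rho> x is then c *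
  \<psi> x, and x = 1 identifies c.\<close>

lemma irr_convolution:
  assumes \<psi>: "\<psi> \<in> Irr G" and f: "class_function G f" and x: "x \<in> carrier G"
  shows "(\<Sum>g\<in>carrier G. f g * \<psi> (g \<otimes> x)) = (\<Sum>g\<in>carrier G. f g * \<psi> g) / \<psi> \<one> * \<psi> x"
proof -
  obtain d \<rho> where irr: "is_irr G d \<rho>" and \<rho>: "is_rep G d \<rho>" and d: "d > 0" and \<psi>_def: "\<psi> = rep_char G \<rho>"
    using IrrE[OF \<psi>] .
  define T where "T = mat d d (\<lambda>(i,j). \<Sum>g\<in>carrier G. f g * \<rho> g $$ (i,j))"
  have T: "T \<in> carrier_mat d d" by (simp add: T_def)
  have T_mult: "(T * \<rho> y) $$ (i,j) = (\<Sum>g\<in>carrier G. f g * \<rho> (g \<otimes> y) $$ (i,j))"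
    if "y \<in> carrier G" "i < d" "j < d" for y i j
  proof -
    have "(T * \<rho> y) $$ (i,j) = (\<Sum>k<d. \<Sum>g\<in>carrier G. f g * (\<rho> g $$ (i,k) * \<rho> y $$ (k,j)))"
      using that by (subst index_mult_mat_sum[OF T rep_carrier[OF \<rho>]])
        (auto simp: T_def sum_distrib_right mult.assoc intro!: sum.cong)
    also have "\<dots> = (\<Sum>g\<in>carrier G. f g * \<rho> (g \<otimes> y) $$ (i,j))"
      using that by (subst sum.swap) (simp add: rep_mult_index[OF \<rho>] sum_distrib_left)
    finally show ?thesis .
  qed
  have "\<rho> y * T = T * \<rho> y" if y: "y \<in> carrier G" for y
  proof (rule eq_matI)
    note cs = rep_carrier[OF \<rho> y]
    fix i j assume "i < dim_row (T * \<rho> y)" "j < dim_col (T * \<rho> y)"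
    then have ij: "i < d" "j < d" using T cs by auto
    have "(\<rho> y * T) $$ (i,j) = (\<Sum>k<d. \<Sum>g\<in>carrier G. f g * (\<rho> y $$ (i,k) * \<rho> g $$ (k,j)))"
      using ij by (subst index_mult_mat_sum[OF cs T])
        (auto simp: T_def sum_distrib_left ac_simps intro!: sum.cong)
    also have "\<dots> = (\<Sum>g\<in>carrier G. f g * \<rho> (y \<otimes> g) $$ (i,j))"
      using ij y by (subst sum.swap) (simp add: rep_mult_index[OF \<rho>] sum_distrib_left)
    also have "\<dots> = (\<Sum>g\<in>carrier G. f (y \<otimes> g \<otimes> inv y) * \<rho> ((y \<otimes> g \<otimes> inv y) \<otimes> y) $$ (i,j))"
      using f y by (intro sum.cong) (auto simp: class_function_def m_assoc)
    also have "\<dots> = (\<Sum>g\<in>carrier G. f g * \<rho> (g \<otimes> y) $$ (i,j))"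
      by (rule sum_conjugate[OF y])
    finally show "(\<rho> y * T) $$ (i,j) = (T * \<rho> y) $$ (i,j)" using T_mult[OF y ij] by simp
  qed (use T rep_carrier[OF \<rho> y] in auto)
  then obtain c where c: "T = c \<cdot>\<^sub>m 1\<^sub>m d" using irr T by (auto simp: is_irr_def)
  have key: "(\<Sum>g\<in>carrier G. f g * \<psi> (g \<otimes> y)) = c * \<psi> y" if y: "y \<in> carrier G" for y
  proof -
    have "(\<Sum>g\<in>carrier G. f g * \<psi> (g \<otimes> y)) = (\<Sum>g\<in>carrier G. \<Sum>i<d. f g * \<rho> (g \<otimes> y) $$ (i,i))"
      using y by (simp add: \<psi>_def rep_char_eq_sum[OF \<rho>] sum_distrib_left)
    also have "\<dots> = (\<Sum>i<d. (T * \<rho> y) $$ (i,i))"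
      using y by (subst sum.swap) (simp add: T_mult)
    also have "T * \<rho> y = c \<cdot>\<^sub>m \<rho> y"
      using rep_carrier[OF \<rho> y] by (simp add: c mult_smult_assoc_mat[of _ d d _ d])
    also have "(\<Sum>i<d. (c \<cdot>\<^sub>m \<rho> y) $$ (i,i)) = c * \<psi> y"
      using rep_carrier[OF \<rho> y] y by (simp add: \<psi>_def rep_char_eq_sum[OF \<rho>] sum_distrib_left)
    finally show ?thesis .
  qed
  have "(\<Sum>g\<in>carrier G. f g * \<psi> g) = c * \<psi> \<one>" using key[of \<one>] by simp
  moreover have "\<psi> \<one> \<noteq> 0" using d by (simp add: \<psi>_def rep_char_one[OF \<rho>])
  ultimately show ?thesis using key[OF x] by simp
qed

text \<open>Permutation matrices of left multiplication: a nonzero diagonal entry of \<rho> g means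
  that g fixes a group element, which forces g = 1. The character is a multiple of the point mass at
  1, so convolving with it evaluates a function.\<close>

lemma regular_rep:
  "\<exists>d \<rho>. is_rep G d \<rho> \<and>
    (\<forall>g\<in>carrier G. rep_char G \<rho> g = (if g = \<one> then of_nat (card (carrier G)) else 0))"
proof -
  define n where "n = card (carrier G)"
  obtain e where e: "bij_betw e {..<n} (carrier G)"
    using ex_bij_betw_nat_finite[OF finite_carrier] by (auto simp: n_def lessThan_atLeast0)
  have e_in: "e i \<in> carrier G" if "i < n" for i using e that by (auto simp: bij_betw_def)
  have e_eq: "e i = e j \<longleftrightarrow> i = j" if "i < n" "j < n" for i j
    using e that by (auto simp: bij_betw_def inj_on_def)
  have e_sum: "(\<Sum>k<n. F (e k)) = (\<Sum>x\<in>carrier G. F x)" for F :: "'a \<Rightarrow> complex"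
    using sum.reindex_bij_betw[OF e] .
  define \<rho> where "\<rho> g = mat n n (\<lambda>(i,j). if e i = g \<otimes> e j then 1 else 0 :: complex)" for g
  have "is_rep G n \<rho>"
    unfolding is_rep_def
  proof (intro conjI ballI)
    show "\<rho> \<one> = 1\<^sub>m n" by (rule eq_matI) (auto simp: \<rho>_def e_in e_eq)
  next
    fix g h assume g: "g \<in> carrier G" and h: "h \<in> carrier G"
    show "\<rho> (g \<otimes> h) = \<rho> g * \<rho> h"
    proof (rule eq_matI)
      fix i j assume "i < dim_row (\<rho> g * \<rho> h)" "j < dim_col (\<rho> g * \<rho> h)"
      then have ij: "i < n" "j < n" by (auto simp: \<rho>_def)
      have "(\<rho> g * \<rho> h) $$ (i,j) =
        (\<Sum>k<n. (if e i = g \<otimes> e k then 1 else 0) * (if e k = h \<otimes> e j then 1 else 0))"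
        using ij by (subst index_mult_mat_sum[of _ n n _ n]) (auto simp: \<rho>_def)
      also have "\<dots> = (\<Sum>x\<in>carrier G. (if e i = g \<otimes> x then 1 else 0) * (if x = h \<otimes> e j then 1 else 0))"
        by (rule e_sum)
      also have "\<dots> = (\<Sum>x\<in>carrier G. if x = h \<otimes> e j then (if e i = g \<otimes> x then 1 else 0) else 0)"
        by (intro sum.cong) auto
      also have "\<dots> = \<rho> (g \<otimes> h) $$ (i,j)"
        using ij g h e_in[OF ij(2)] by (simp add: \<rho>_def m_assoc)
      finally show "\<rho> (g \<otimes> h) $$ (i,j) = (\<rho> g * \<rho> h) $$ (i,j)" by simp
    qed (auto simp: \<rho>_def)
  qed (simp add: \<rho>_def)
  moreover have "rep_char G \<rho> g = (if g = \<one> then of_nat (card (carrier G)) else 0)" if g: "g \<in> carrier G" for g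
  proof -
    have "rep_char G \<rho> g = (\<Sum>k<n. if e k = g \<otimes> e k then 1 else 0)"
      using g by (simp add: rep_char_eq_sum[OF \<open>is_rep G n \<rho>\<close>] \<rho>_def)
    also have "\<dots> = (\<Sum>k<n. if g = \<one> then 1 else 0)"
      using g e_in by (intro sum.cong refl) (auto simp: r_cancel_one')
    finally show ?thesis by (simp add: n_def)
  qed
  ultimately show ?thesis by blast
qed

lemma regular_decompose:
  "\<exists>L. set L \<subseteq> Irr G \<and>
    (\<forall>g\<in>carrier G. (\<Sum>\<psi>\<leftarrow>L. \<psi> g) = (if g = \<one> then of_nat (card (carrier G)) else 0))"
proof -
  obtain d \<rho> where \<rho>: "is_rep G d \<rho>"
    "\<And>g. g \<in> carrier G \<Longrightarrow> rep_char G \<rho> g = (if g = \<one> then of_nat (card (carrier G)) else 0)"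
    using regular_rep by blast
  obtain L where "set L \<subseteq> Irr G" "\<And>g. rep_char G \<rho> g = (\<Sum>\<psi>\<leftarrow>L. \<psi> g)"
    using rep_char_decompose[OF \<rho>(1)] by blast
  with \<rho>(2) show ?thesis by (intro exI[of _ L]) simp
qed

lemma cinner_delta:
  assumes "\<psi> \<in> Irr G" "\<And>g. g \<in> carrier G \<Longrightarrow> f g = (if g = \<one> then of_nat (card (carrier G)) else 0)"
  shows "cinner G f \<psi> = \<psi> \<one>"
proof -
  have "(\<Sum>g\<in>carrier G. f g * cnj (\<psi> g)) =
    (\<Sum>g\<in>carrier G. if g = \<one> then of_nat (card (carrier G)) * cnj (\<psi> g) else 0)"
    using assms(2) by (intro sum.cong) auto
  also have "\<dots> = of_nat (card (carrier G)) * cnj (\<psi> \<one>)" by simp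
  finally show ?thesis
    using Irr_one[OF assms(1)] card_carrier_pos by (auto simp: cinner_def)
qed

text \<open>The inner product of the regular character with \<psi> is \<psi>(1), which is not 0, so
  every \<psi> occurs in the finite list of its constituents.\<close>

lemma finite_Irr: "finite (Irr G)"
proof -
  obtain L where L: "set L \<subseteq> Irr G"
    "\<And>g. g \<in> carrier G \<Longrightarrow> (\<Sum>\<psi>\<leftarrow>L. \<psi> g) = (if g = \<one> then of_nat (card (carrier G)) else 0)"
    using regular_decompose by blast
  have "Irr G \<subseteq> set L"
  proof
    fix \<psi> assume \<psi>: "\<psi> \<in> Irr G"
    have lin: "cinner G (\<lambda>g. \<Sum>\<chi>\<leftarrow>M. \<chi> g) \<psi> = (\<Sum>\<chi>\<leftarrow>M. cinner G \<chi> \<psi>)" for M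
      by (induction M) (simp_all add: cinner_def algebra_simps sum.distrib add_divide_distrib)
    have "(\<Sum>\<chi>\<leftarrow>L. cinner G \<chi> \<psi>) \<noteq> 0"
      unfolding lin[symmetric] using cinner_delta[OF \<psi> L(2)] Irr_one[OF \<psi>] by auto
    then obtain \<chi> where "\<chi> \<in> set L" "cinner G \<chi> \<psi> \<noteq> 0"
      by (metis (no_types, lifting) map_eq_conv sum_list_0)
    then show "\<psi> \<in> set L" using Irr_orthonormal[OF _ \<psi>, of \<chi>] L(1) by (auto split: if_splits)
  qed
  then show ?thesis using finite_subset by blast
qed

text \<open>By \<open>irr_convolution\<close> the convolution with each irreducible character
  vanishes, hence also the one with the regular character, which is |G| times the value at a
  point.\<close>

lemma class_function_eq_0:
  assumes f: "class_function G f" and orth: "\<And>\<psi>. \<psi> \<in> Irr G \<Longrightarrow> cinner G f \<psi> = 0" and x: "x \<in> carrier G"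
  shows "f x = 0"
proof -
  \<comment> \<open>Inverting the argument turns the conjugates in the inner products into the plain
    values of \<psi> that \<open>irr_convolution\<close> works with.\<close>
  define f' where "f' g = f (inv g)" for g
  have f': "class_function G f'"
    unfolding class_function_def f'_def
  proof (intro ballI)
    fix y g assume "y \<in> carrier G" "g \<in> carrier G"
    then show "f (inv (y \<otimes> g \<otimes> inv y)) = f (inv g)"
      using f unfolding class_function_def by (metis inv_closed inv_inv inv_mult_group m_assoc m_closed)
  qed
  have zero: "(\<Sum>g\<in>carrier G. f' g * \<psi> (g \<otimes> x)) = 0" if \<psi>: "\<psi> \<in> Irr G" for \<psi>
  proof -
    have "(\<Sum>g\<in>carrier G. f' g * \<psi> g) = (\<Sum>g\<in>carrier G. f' (inv g) * \<psi> (inv g))"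
      by (rule sum_inverse[symmetric])
    also have "\<dots> = (\<Sum>g\<in>carrier G. f g * cnj (\<psi> g))"
      by (intro sum.cong) (auto simp: f'_def Irr_inv[OF \<psi>])
    also have "\<dots> = 0" using orth[OF \<psi>] card_carrier_pos by (simp add: cinner_def)
    finally show ?thesis by (simp add: irr_convolution[OF \<psi> f' x])
  qed
  obtain L where L: "set L \<subseteq> Irr G"
    "\<And>g. g \<in> carrier G \<Longrightarrow> (\<Sum>\<psi>\<leftarrow>L. \<psi> g) = (if g = \<one> then of_nat (card (carrier G)) else 0)"
    using regular_decompose by blast
  have "(\<Sum>g\<in>carrier G. f' g * (\<Sum>\<psi>\<leftarrow>M. \<psi> (g \<otimes> x))) = 0" if "set M \<subseteq> Irr G" for M
    using that by (induction M) (auto simp: algebra_simps sum.distrib zero)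
  from this[OF L(1)]
  have "0 = (\<Sum>g\<in>carrier G. f' g * (if g \<otimes> x = \<one> then of_nat (card (carrier G)) else 0))"
    using x by (simp add: L(2))
  also have "\<dots> = (\<Sum>g\<in>carrier G. if g = inv x then f' g * of_nat (card (carrier G)) else 0)"
    using x by (intro sum.cong refl) (metis inv_equality inv_inv l_inv inv_closed mult_zero_right)
  also have "\<dots> = f x * of_nat (card (carrier G))" using x by (simp add: f'_def)
  finally show ?thesis using card_carrier_pos by simp
qed

lemma class_function_expand:
  assumes f: "class_function G f" and x: "x \<in> carrier G"
  shows "f x = (\<Sum>\<psi>\<in>Irr G. cinner G f \<psi> * \<psi> x)"
proof -
  let ?h = "\<lambda>g. \<Sum>\<psi>\<in>Irr G. cinner G f \<psi> * \<psi> g"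
  have "class_function G (\<lambda>g. f g - ?h g)"
    using f Irr_class unfolding class_function_def
    by (intro ballI arg_cong2[where f="(-)"] sum.cong) auto
  moreover have "cinner G (\<lambda>g. f g - ?h g) \<psi> = 0" if \<psi>: "\<psi> \<in> Irr G" for \<psi>
  proof -
    have "cinner G ?h \<psi> = (\<Sum>\<chi>\<in>Irr G. if \<chi> = \<psi> then cinner G f \<chi> else 0)"
      unfolding cinner_sum_left cinner_smult_left
      by (intro sum.cong refl) (simp add: Irr_orthonormal[OF _ \<psi>])
    then show ?thesis using \<psi> finite_Irr by (simp add: cinner_diff_left)
  qed
  ultimately have "f x - ?h x = 0" using x by (rule class_function_eq_0)
  then show ?thesis by simp
qed

text \<open>After inverting the summation variable this is the convolution of \<chi> and \<psi> at
  \<open>x\<close>: irreducible characters are orthogonal idempotents up to the factors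
  |G|/\<psi>(1).\<close>

lemma Irr_convolution:
  assumes "\<chi> \<in> Irr G" "\<psi> \<in> Irr G" "x \<in> carrier G"
  shows "(\<Sum>g\<in>carrier G. \<chi> (inv g) * \<psi> (g \<otimes> x)) =
    (if \<chi> = \<psi> then of_nat (card (carrier G)) / \<psi> \<one> * \<psi> x else 0)"
proof -
  have "class_function G (\<lambda>g. \<chi> (inv g))"
    using Irr_class[OF assms(1)] assms(1) unfolding class_function_def
    by (metis Irr_inv inv_closed m_closed)
  then have "(\<Sum>g\<in>carrier G. \<chi> (inv g) * \<psi> (g \<otimes> x)) = (\<Sum>g\<in>carrier G. \<chi> (inv g) * \<psi> g) / \<psi> \<one> * \<psi> x"
    using assms by (intro irr_convolution) auto
  also have "(\<Sum>g\<in>carrier G. \<chi> (inv g) * \<psi> g) = of_nat (card (carrier G)) * cinner G \<psi> \<chi>"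
    using assms card_carrier_pos by (simp add: cinner_def Irr_inv mult.commute)
  finally show ?thesis using assms by (auto simp: Irr_orthonormal)
qed

end

section \<open>Frobenius' theorem\<close>

lemma cinner_cong:
  assumes "\<And>g. g \<in> carrier G \<Longrightarrow> f g = f' g" "\<And>g. g \<in> carrier G \<Longrightarrow> h g = h' g"
  shows "cinner G f h = cinner G f' h'"
  using assms by (simp add: cinner_def)

lemma (in finite_group) cinner_parseval:
  assumes f: "class_function G f"
  shows "cinner G f f = (\<Sum>\<psi>\<in>Irr G. cinner G f \<psi> * cnj (cinner G f \<psi>))"
proof -
  have "cinner G f f = cinner G (\<lambda>g. \<Sum>\<psi>\<in>Irr G. cinner G f \<psi> * \<psi> g) f"
    using class_function_expand[OF f] by (intro cinner_cong) auto
  also have "\<dots> = (\<Sum>\<psi>\<in>Irr G. cinner G f \<psi> * cinner G \<psi> f)"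
    by (simp add: cinner_sum_left cinner_smult_left)
  finally show ?thesis by (simp flip: cinner_commute)
qed

lemma (in finite_group) cinner_one_in_Nats:
  assumes "is_rep G d \<rho>"
  shows "cinner G (\<lambda>_. 1) (rep_char G \<rho>) \<in> \<nat>"
proof -
  have "is_rep G 1 (\<lambda>_. 1\<^sub>m 1)" by (simp add: is_rep_def)
  then have "cinner G (rep_char G (\<lambda>_. 1\<^sub>m 1)) (rep_char G \<rho>) \<in> \<nat>"
    using assms by (rule cinner_rep_char_in_Nats)
  also have "cinner G (rep_char G (\<lambda>_. 1\<^sub>m 1)) (rep_char G \<rho>) = cinner G (\<lambda>_. 1) (rep_char G \<rho>)"
    by (intro cinner_cong) (auto simp: rep_char_def mat_trace_def)
  finally show ?thesis .
qed

lemma sum_squares_eq_1: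
  fixes k :: "'a \<Rightarrow> int"
  assumes "finite I" "(\<Sum>i\<in>I. k i * k i) = 1"
  obtains i where "i \<in> I" "k i = 1 \<or> k i = -1" "\<And>j. j \<in> I \<Longrightarrow> j \<noteq> i \<Longrightarrow> k j = 0"
proof -
  obtain i where i: "i \<in> I" "k i \<noteq> 0"
    using assms(2) by (metis (no_types, lifting) mult_zero_left sum.neutral zero_neq_one)
  have eq: "k i * k i + (\<Sum>j\<in>I - {i}. k j * k j) = 1"
    using assms i by (simp add: sum.remove)
  have nonneg: "0 \<le> (\<Sum>j\<in>I - {i}. k j * k j)" by (intro sum_nonneg) simp
  have "k i * k i \<ge> 1" using i by (metis int_one_le_iff_zero_less not_square_less_zero
      linorder_neqE_linordered_idom mult_eq_0_iff)
  with eq nonneg have "k i * k i = 1" and 0: "(\<Sum>j\<in>I - {i}. k j * k j) = 0" by linarith+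
  then have "k i = 1 \<or> k i = -1" by (metis zmult_eq_1_iff)
  moreover have "k j = 0" if "j \<in> I" "j \<noteq> i" for j
    using 0 assms(1) that by (subst (asm) sum_nonneg_eq_0_iff) auto
  ultimately show ?thesis using that i by blast
qed

text \<open>A Frobenius complement that may also be trivial or the whole group. In this form the
  notion passes to the intersection with a subgroup, and it covers given complements and point
  stabilizers alike.\<close>

locale malnormal_subgroup = finite_group +
  fixes H
  assumes subgroup_H: "subgroup H G"
    and malnormal: "\<lbrakk>x \<in> carrier G; h \<in> H; h \<noteq> \<one>; inv x \<otimes> h \<otimes> x \<in> H\<rbrakk> \<Longrightarrow> x \<in> H"
begin

abbreviation K where "K \<equiv> frobenius_kernel G H"
abbreviation HG where "HG \<equiv> G\<lparr>carrier := H\<rparr>"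

lemma H_subset: "H \<subseteq> carrier G" and H_one: "\<one> \<in> H"
  and H_mult: "a \<in> H \<Longrightarrow> b \<in> H \<Longrightarrow> a \<otimes> b \<in> H" and H_inv: "a \<in> H \<Longrightarrow> inv a \<in> H"
  using subgroup_H by (auto simp: subgroup.subset subgroup.one_closed subgroup.m_closed subgroup.m_inv_closed)

lemma H_carrier: "h \<in> H \<Longrightarrow> h \<in> carrier G"
  using H_subset by blast

lemma finite_H: "finite H"
  using H_subset finite_carrier by (rule finite_subset)

sublocale HG: finite_group HG
  by (intro finite_group.intro finite_group_axioms.intro subgroup_imp_group[OF subgroup_H])
    (simp add: finite_H)

lemma HG_inv: "h \<in> H \<Longrightarrow> inv\<^bsub>HG\<^esub> h = inv h"
  using m_inv_consistent[OF subgroup_H] by simp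

lemma kernel_subset: "K \<subseteq> carrier G" and one_in_kernel: "\<one> \<in> K"
  by (auto simp: frobenius_kernel_def)

section \<open>Conjugation and the Frobenius kernel\<close>

lemma conj_cancel:
  assumes "x \<in> carrier G" "g \<in> carrier G"
  shows "inv x \<otimes> (x \<otimes> g \<otimes> inv x) \<otimes> x = g" "x \<otimes> (inv x \<otimes> g \<otimes> x) \<otimes> inv x = g"
  using assms by (simp_all add: m_assoc) (simp_all flip: m_assoc)

lemma conj_conj:
  assumes "x \<in> carrier G" "y \<in> carrier G" "g \<in> carrier G"
  shows "x \<otimes> (y \<otimes> g \<otimes> inv y) \<otimes> inv x = (x \<otimes> y) \<otimes> g \<otimes> inv (x \<otimes> y)"
  using assms by (simp add: m_assoc inv_mult_group)

lemma in_conjugate_set_iff: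
  assumes x: "x \<in> carrier G" and g: "g \<in> carrier G"
  shows "g \<in> conjugate_set G x H \<longleftrightarrow> x \<otimes> g \<otimes> inv x \<in> H"
proof
  assume "g \<in> conjugate_set G x H"
  then show "x \<otimes> g \<otimes> inv x \<in> H"
    using x conj_cancel(2)[OF x H_carrier] by (auto simp: conjugate_set_def)
next
  assume "x \<otimes> g \<otimes> inv x \<in> H"
  then show "g \<in> conjugate_set G x H"
    using conj_cancel(1)[OF x g] by (force simp: conjugate_set_def)
qed

lemma in_kernel_iff: "g \<in> carrier G \<Longrightarrow> g \<in> K \<longleftrightarrow> (\<forall>x\<in>carrier G. x \<otimes> g \<otimes> inv x \<in> H \<longrightarrow> g = \<one>)"
  using in_conjugate_set_iff by (auto simp: frobenius_kernel_def)

lemma kernel_conj: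
  assumes "g \<in> K" "y \<in> carrier G"
  shows "y \<otimes> g \<otimes> inv y \<in> K"
proof -
  have g: "g \<in> carrier G" using assms kernel_subset by blast
  have "y \<otimes> g \<otimes> inv y = \<one>" if x: "x \<in> carrier G" "x \<otimes> (y \<otimes> g \<otimes> inv y) \<otimes> inv x \<in> H" for x
  proof -
    have "g = \<one>"
      using in_kernel_iff[OF g] assms x g by (metis conj_conj m_closed)
    then show ?thesis using assms by simp
  qed
  then show ?thesis using assms g by (simp add: in_kernel_iff)
qed

lemma kernel_inv: "g \<in> K \<Longrightarrow> inv g \<in> K"
proof -
  assume "g \<in> K"
  then have g: "g \<in> carrier G" using kernel_subset by blast
  have "inv g = \<one>" if x: "x \<in> carrier G" "x \<otimes> inv g \<otimes> inv x \<in> H" for x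
  proof -
    have "inv (x \<otimes> inv g \<otimes> inv x) = x \<otimes> g \<otimes> inv x"
      using x g by (simp add: inv_mult_group m_assoc)
    then have "x \<otimes> g \<otimes> inv x \<in> H" using H_inv[OF x(2)] by simp
    then show ?thesis using in_kernel_iff[OF g] \<open>g \<in> K\<close> x by (metis inv_one)
  qed
  then show ?thesis using g in_kernel_iff[of "inv g"] by blast
qed

lemma H_kernel: "h \<in> H \<Longrightarrow> h \<in> K \<Longrightarrow> h = \<one>"
  using in_kernel_iff[of h] H_carrier[of h] by (metis inv_one one_closed l_one r_one)

lemma not_in_kernelE:
  assumes "g \<in> carrier G" "g \<notin> K"
  obtains x h where "x \<in> carrier G" "h \<in> H" "h \<noteq> \<one>" "h = x \<otimes> g \<otimes> inv x" "g = inv x \<otimes> h \<otimes> x"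
proof -
  obtain x where x: "x \<in> carrier G" "x \<otimes> g \<otimes> inv x \<in> H" "g \<noteq> \<one>"
    using assms in_kernel_iff by blast
  show ?thesis
    by (rule that[of x "x \<otimes> g \<otimes> inv x"]) (use x assms conj_cancel[of x g] in auto)
qed

lemma conj_not_in_kernel:
  assumes "x \<in> carrier G" "h \<in> H" "h \<noteq> \<one>"
  shows "inv x \<otimes> h \<otimes> x \<notin> K"
proof
  assume "inv x \<otimes> h \<otimes> x \<in> K"
  then have "h \<in> K" using kernel_conj[of _ x] conj_cancel(2)[of x h] assms H_carrier by metis
  then show False using H_kernel assms by blast
qed

text \<open>Malnormality makes the elements that conjugate \<open>g\<close> into \<open>H\<close> a
  single coset \<open>H y\<close>. Equivalently, \<open>g\<close> lies in exactly one conjugate of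
  \<open>H\<close>, and that conjugate arises from |H| group elements.\<close>

lemma card_conjugators:
  assumes "g \<in> carrier G" "g \<notin> K"
  shows "card {x\<in>carrier G. x \<otimes> g \<otimes> inv x \<in> H} = card H"
proof -
  obtain y h where y: "y \<in> carrier G" "h \<in> H" "h \<noteq> \<one>" "h = y \<otimes> g \<otimes> inv y" "g = inv y \<otimes> h \<otimes> y"
    using not_in_kernelE[OF assms] .
  have "{x\<in>carrier G. x \<otimes> g \<otimes> inv x \<in> H} = (\<lambda>a. a \<otimes> y) ` H"
  proof (intro equalityI subsetI)
    fix x assume "x \<in> {x\<in>carrier G. x \<otimes> g \<otimes> inv x \<in> H}"
    then have x: "x \<in> carrier G" "x \<otimes> g \<otimes> inv x \<in> H" by auto
    have "inv (y \<otimes> inv x) \<otimes> h \<otimes> (y \<otimes> inv x) = x \<otimes> g \<otimes> inv x"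
      unfolding y(5) using x(1) y(1) H_carrier[OF y(2)] by (simp add: inv_mult_group m_assoc)
    then have "y \<otimes> inv x \<in> H"
      using malnormal[of "y \<otimes> inv x" h] x y(1-3) by auto
    then have "inv (y \<otimes> inv x) \<in> H" by (rule H_inv)
    then have "x \<otimes> inv y \<in> H" using x(1) y(1) by (simp add: inv_mult_group)
    moreover have "x = (x \<otimes> inv y) \<otimes> y" using x(1) y(1) by (simp add: m_assoc)
    ultimately show "x \<in> (\<lambda>a. a \<otimes> y) ` H" by blast
  next
    fix x assume "x \<in> (\<lambda>a. a \<otimes> y) ` H"
    then obtain a where a: "a \<in> H" "x = a \<otimes> y" by blast
    have "x \<otimes> g \<otimes> inv x = a \<otimes> h \<otimes> inv a"
      unfolding a(2) y(4) using y(1) conj_conj[of a y g] H_carrier[OF a(1)] assms by simp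
    then show "x \<in> {x\<in>carrier G. x \<otimes> g \<otimes> inv x \<in> H}"
      using a y(1,2) H_mult H_inv H_carrier by simp
  qed
  moreover have "inj_on (\<lambda>a. a \<otimes> y) H"
    using y(1) H_carrier by (auto simp: inj_on_def)
  ultimately show ?thesis by (simp add: card_image)
qed

text \<open>Double counting of the pairs of \<open>g\<close> outside the kernel and \<open>x\<close>
  conjugating \<open>g\<close> into \<open>H\<close>: each \<open>g\<close> has |H| partners, and
  for each \<open>x\<close> the elements x g inv x run through \<open>H\<close> without the
  identity.\<close>

lemma sum_outside_kernel:
  assumes F: "class_function G F"
  shows "of_nat (card H) * (\<Sum>g\<in>carrier G - K. F g) = of_nat (card (carrier G)) * (\<Sum>h\<in>H - {\<one>}. F h)"
proof -
  have "of_nat (card H) * (\<Sum>g\<in>carrier G - K. F g) =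
    (\<Sum>g\<in>carrier G - K. \<Sum>x\<in>{x\<in>carrier G. x \<otimes> g \<otimes> inv x \<in> H}. F g)"
    by (simp add: card_conjugators sum_distrib_left)
  also have "\<dots> = (\<Sum>g\<in>carrier G - K. \<Sum>x\<in>carrier G. if x \<otimes> g \<otimes> inv x \<in> H then F g else 0)"
    by (intro sum.cong refl sum.inter_filter) simp
  also have "\<dots> = (\<Sum>x\<in>carrier G. \<Sum>g\<in>carrier G - K. if x \<otimes> g \<otimes> inv x \<in> H then F g else 0)"
    by (rule sum.swap)
  also have "\<dots> = (\<Sum>x\<in>carrier G. \<Sum>h\<in>H - {\<one>}. F h)"
  proof (rule sum.cong[OF refl])
    fix x assume x: "x \<in> carrier G"
    have "(\<Sum>g\<in>carrier G - K. if x \<otimes> g \<otimes> inv x \<in> H then F g else 0) =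
      (\<Sum>g\<in>{g\<in>carrier G - K. x \<otimes> g \<otimes> inv x \<in> H}. F g)"
      by (intro sum.inter_filter[symmetric]) simp
    also have "\<dots> = (\<Sum>h\<in>H - {\<one>}. F h)"
    proof (rule sum.reindex_bij_witness[of _ "\<lambda>h. inv x \<otimes> h \<otimes> x" "\<lambda>g. x \<otimes> g \<otimes> inv x"],
        goal_cases)
      case (1 g)
      then show ?case using x by (simp add: conj_cancel)
    next
      case g: (2 g)
      have "x \<otimes> g \<otimes> inv x \<noteq> \<one>"
      proof
        assume "x \<otimes> g \<otimes> inv x = \<one>"
        then have "g = \<one>" using conj_cancel(1)[of x g] g x by simp
        then show False using g one_in_kernel by simp
      qed
      then show ?case using g by simp
    next
      case (3 h)
      then show ?case using x H_carrier by (simp add: conj_cancel)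
    next
      case h: (4 h)
      then have "x \<otimes> (inv x \<otimes> h \<otimes> x) \<otimes> inv x = h" using x H_carrier by (simp add: conj_cancel)
      then show ?case
        using h x conj_not_in_kernel[of x h] H_carrier by simp
    next
      case (5 g)
      then show ?case using F x by (simp add: class_function_def)
    qed
    finally show "(\<Sum>g\<in>carrier G - K. if x \<otimes> g \<otimes> inv x \<in> H then F g else 0) = (\<Sum>h\<in>H - {\<one>}. F h)" .
  qed
  also have "\<dots> = of_nat (card (carrier G)) * (\<Sum>h\<in>H - {\<one>}. F h)" by simp
  finally show ?thesis .
qed

lemma finite_kernel: "finite K"
  using kernel_subset finite_carrier by (rule finite_subset)

lemma card_H_pos: "0 < card H"
  using finite_H H_one by (auto simp: card_gt_0_iff)

lemma card_kernel: "card H * card K = card (carrier G)"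
proof -
  \<comment> \<open>The constant function 1 counts the elements outside the kernel; the product |G|
    |H| then cancels from both sides.\<close>
  have "of_nat (card H) * (of_nat (card (carrier G)) - of_nat (card K) :: complex) =
    of_nat (card (carrier G)) * (of_nat (card H) - 1)"
    using sum_outside_kernel[of "\<lambda>_. 1"] kernel_subset finite_kernel finite_H H_one
      card_mono[OF finite_carrier kernel_subset] card_H_pos
    by (simp add: class_function_def card_Diff_subset of_nat_diff)
  then have "of_nat (card H * card K) = (of_nat (card (carrier G)) :: complex)"
    by (simp add: algebra_simps)
  then show ?thesis by (simp only: of_nat_eq_iff)
qed

lemma sum_class_function:
  assumes F: "class_function G F"
  shows "(\<Sum>g\<in>carrier G. F g) =
    (\<Sum>g\<in>K. F g) + of_nat (card (carrier G)) / of_nat (card H) * (\<Sum>h\<in>H - {\<one>}. F h)"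
proof -
  have "(\<Sum>g\<in>carrier G. F g) = (\<Sum>g\<in>K. F g) + (\<Sum>g\<in>carrier G - K. F g)"
    using sum.subset_diff[OF kernel_subset finite_carrier, of F] by (simp add: add.commute)
  moreover have "(\<Sum>g\<in>carrier G - K. F g) =
      of_nat (card (carrier G)) / of_nat (card H) * (\<Sum>h\<in>H - {\<one>}. F h)"
    using sum_outside_kernel[OF F] card_H_pos by (simp add: field_simps)
  ultimately show ?thesis by simp
qed

text \<open>The choice is immaterial for a class function: by malnormality, elements of \<open>H\<close> that are
  conjugate in \<open>G\<close> are conjugate in \<open>H\<close>.\<close>

definition ext :: "('a \<Rightarrow> complex) \<Rightarrow> 'a \<Rightarrow> complex" where
  "ext \<phi> g =
     (if g \<notin> carrier G then 0 else if g \<in> K then \<phi> \<one>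
      else \<phi> (SOME h. h \<in> H \<and> (\<exists>x\<in>carrier G. h = x \<otimes> g \<otimes> inv x)))"

lemma ext_kernel: "g \<in> K \<Longrightarrow> ext \<phi> g = \<phi> \<one>"
  using kernel_subset by (auto simp: ext_def)

lemma class_HG_conj:
  assumes \<phi>: "class_function HG \<phi>" and h: "h \<in> H" and x: "x \<in> carrier G" "x \<otimes> h \<otimes> inv x \<in> H"
  shows "\<phi> (x \<otimes> h \<otimes> inv x) = \<phi> h"
proof (cases "h = \<one>")
  case False
  have "inv x \<in> H"
    using malnormal[of "inv x" h] x h False by simp
  then have "inv (inv x) \<in> H" by (rule H_inv)
  then have "x \<in> H" using x by simp
  then have "\<phi> (x \<otimes> h \<otimes> inv\<^bsub>HG\<^esub> x) = \<phi> h" using \<phi> h by (simp add: class_function_def)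
  then show ?thesis using HG_inv[OF \<open>x \<in> H\<close>] by simp
qed (use x in simp)

lemma ext_conj:
  assumes \<phi>: "class_function HG \<phi>" and g: "g \<in> carrier G" and x: "x \<in> carrier G" "x \<otimes> g \<otimes> inv x \<in> H"
  shows "ext \<phi> g = \<phi> (x \<otimes> g \<otimes> inv x)"
proof (cases "g \<in> K")
  case True
  then have "g = \<one>" using in_kernel_iff[OF g] x by blast
  then show ?thesis using x one_in_kernel by (simp add: ext_kernel)
next
  case False
  let ?h = "SOME h. h \<in> H \<and> (\<exists>x\<in>carrier G. h = x \<otimes> g \<otimes> inv x)"
  have "?h \<in> H \<and> (\<exists>x\<in>carrier G. ?h = x \<otimes> g \<otimes> inv x)"
    by (rule someI[of _ "x \<otimes> g \<otimes> inv x"]) (use x in blast)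
  then obtain y where y: "y \<in> carrier G" "?h = y \<otimes> g \<otimes> inv y" "?h \<in> H" by blast
  have "x \<otimes> g \<otimes> inv x = (x \<otimes> inv y) \<otimes> ?h \<otimes> inv (x \<otimes> inv y)"
    unfolding y(2) using x y g by (simp add: inv_mult_group m_assoc) (simp flip: m_assoc)
  then have "\<phi> (x \<otimes> g \<otimes> inv x) = \<phi> ?h"
    using class_HG_conj[OF \<phi> y(3), of "x \<otimes> inv y"] x y(1) by simp
  then show ?thesis using False g by (simp add: ext_def)
qed

lemma ext_H: "class_function HG \<phi> \<Longrightarrow> h \<in> H \<Longrightarrow> ext \<phi> h = \<phi> h"
  using ext_conj[of \<phi> h \<one>] H_carrier[of h] by simp

lemma ext_class:
  assumes \<phi>: "class_function HG \<phi>"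
  shows "class_function G (ext \<phi>)"
  unfolding class_function_def
proof (intro ballI)
  fix y g assume y: "y \<in> carrier G" and g: "g \<in> carrier G"
  show "ext \<phi> (y \<otimes> g \<otimes> inv y) = ext \<phi> g"
  proof (cases "g \<in> K")
    case True
    then show ?thesis using kernel_conj[OF True y] by (simp add: ext_kernel)
  next
    case False
    obtain x h where x: "x \<in> carrier G" "h \<in> H" "h = x \<otimes> g \<otimes> inv x"
      using not_in_kernelE[OF g False] .
    have eq: "(x \<otimes> inv y) \<otimes> (y \<otimes> g \<otimes> inv y) \<otimes> inv (x \<otimes> inv y) = x \<otimes> g \<otimes> inv x"
      using x(1) y g by (simp add: inv_mult_group m_assoc) (simp flip: m_assoc)
    have "ext \<phi> (y \<otimes> g \<otimes> inv y) = \<phi> (x \<otimes> g \<otimes> inv x)"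
      using ext_conj[OF \<phi>, of "y \<otimes> g \<otimes> inv y" "x \<otimes> inv y"] x y g unfolding eq by simp
    moreover have "ext \<phi> g = \<phi> (x \<otimes> g \<otimes> inv x)"
      using ext_conj[OF \<phi> g, of x] x by simp
    ultimately show ?thesis by simp
  qed
qed

lemma sum_H_split: "(\<Sum>h\<in>H. F h) = F \<one> + (\<Sum>h\<in>H - {\<one>}. F h)" for F :: "'a \<Rightarrow> complex"
  using finite_H H_one by (rule sum.remove)

text \<open>\<open>ext \<phi>\<close> is \<phi>(1) plus the class function induced from \<phi> -
  \<phi>(1), since the latter vanishes at 1 and induction from \<open>H\<close> gives 0 on the
  kernel. The formula is Frobenius reciprocity for the induced part.\<close>

lemma cinner_ext:
  assumes \<phi>: "class_function HG \<phi>" and f: "class_function G f"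
  shows "cinner G (ext \<phi>) f =
    \<phi> \<one> * cinner G (\<lambda>_. 1) f + cinner HG \<phi> f - \<phi> \<one> * cinner HG (\<lambda>_. 1) f"
proof -
  let ?n = "of_nat (card (carrier G)) :: complex" and ?m = "of_nat (card H) :: complex"
  have nz: "?n \<noteq> 0" "?m \<noteq> 0" using card_carrier_pos card_H_pos by auto
  have "class_function G (\<lambda>g. ext \<phi> g * cnj (f g))"
    using ext_class[OF \<phi>] f by (simp add: class_function_def)
  from sum_class_function[OF this]
  have 1: "(\<Sum>g\<in>carrier G. ext \<phi> g * cnj (f g)) =
    \<phi> \<one> * (\<Sum>g\<in>K. cnj (f g)) + ?n / ?m * (\<Sum>h\<in>H - {\<one>}. \<phi> h * cnj (f h))"
    by (simp add: ext_kernel ext_H[OF \<phi>] sum_distrib_left)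
  have "class_function G (\<lambda>g. cnj (f g))" using f by (simp add: class_function_def)
  from sum_class_function[OF this]
  have 2: "(\<Sum>g\<in>K. cnj (f g)) = (\<Sum>g\<in>carrier G. cnj (f g)) - ?n / ?m * (\<Sum>h\<in>H - {\<one>}. cnj (f h))"
    by simp
  show ?thesis
    unfolding cinner_def 1 2 using nz
    by (simp add: sum_H_split field_simps)
qed

text \<open>A nontrivial element of \<open>H\<close> contributes with weight |G|/|H|. The identity
  gets the same weight, because \<open>ext \<phi>\<close> is constant on the kernel and the kernel
  has |G|/|H| elements. So averaging over \<open>G\<close> equals averaging over
  \<open>H\<close>.\<close>

lemma cinner_ext_ext:
  assumes \<phi>: "class_function HG \<phi>"
  shows "cinner G (ext \<phi>) (ext \<phi>) = cinner HG \<phi> \<phi>"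
proof -
  let ?n = "of_nat (card (carrier G)) :: complex" and ?m = "of_nat (card H) :: complex"
  have nz: "?n \<noteq> 0" "?m \<noteq> 0" using card_carrier_pos card_H_pos by auto
  have k: "of_nat (card K) = ?n / ?m"
    using arg_cong[OF card_kernel, of "of_nat :: nat \<Rightarrow> complex"] nz by (simp add: field_simps)
  have "class_function G (\<lambda>g. ext \<phi> g * cnj (ext \<phi> g))"
    using ext_class[OF \<phi>] by (simp add: class_function_def)
  from sum_class_function[OF this]
  have "(\<Sum>g\<in>carrier G. ext \<phi> g * cnj (ext \<phi> g)) =
    ?n / ?m * (\<phi> \<one> * cnj (\<phi> \<one>)) + ?n / ?m * (\<Sum>h\<in>H - {\<one>}. \<phi> h * cnj (\<phi> h))"
    by (simp add: ext_kernel ext_H[OF \<phi>] k)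
  then show ?thesis
    unfolding cinner_def using nz by (simp add: sum_H_split field_simps)
qed

lemma rep_restrict: "is_rep G d \<rho> \<Longrightarrow> is_rep HG d \<rho>"
  using H_carrier by (simp add: is_rep_def)

text \<open>\<open>ext \<phi>\<close> has norm \<open>1\<close> and integral inner products with all
  irreducible characters of \<open>G\<close>, so it is one of them up to sign.\<close>

lemma ext_Irr:
  assumes \<phi>: "\<phi> \<in> Irr HG"
  shows "ext \<phi> \<in> Irr G"
proof -
  have cl: "class_function HG \<phi>" by (rule HG.Irr_class[OF \<phi>])
  obtain m where m: "m > 0" "\<phi> \<one> = of_nat m" using HG.Irr_one[OF \<phi>] by auto
  obtain d \<rho> where \<rho>: "is_rep HG d \<rho>" "\<phi> = rep_char HG \<rho>" using \<phi> by (rule HG.IrrE)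
  have int: "cinner G (ext \<phi>) \<chi> \<in> \<int>" if \<chi>: "\<chi> \<in> Irr G" for \<chi>
  proof -
    obtain e \<sigma> where \<sigma>: "is_rep G e \<sigma>" "\<chi> = rep_char G \<sigma>" using \<chi> by (rule IrrE)
    have \<chi>H: "cinner HG f \<chi> = cinner HG f (rep_char HG \<sigma>)" for f
      using H_carrier by (intro cinner_cong) (auto simp: \<sigma>(2) rep_char_def)
    have "cinner G (\<lambda>_. 1) \<chi> \<in> \<nat>" unfolding \<sigma>(2) by (rule cinner_one_in_Nats[OF \<sigma>(1)])
    moreover have "cinner HG (\<lambda>_. 1) \<chi> \<in> \<nat>"
      unfolding \<chi>H by (rule HG.cinner_one_in_Nats[OF rep_restrict[OF \<sigma>(1)]])
    moreover have "cinner HG \<phi> \<chi> \<in> \<nat>"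
      unfolding \<chi>H \<rho>(2) by (rule HG.cinner_rep_char_in_Nats[OF \<rho>(1) rep_restrict[OF \<sigma>(1)]])
    ultimately show ?thesis
      unfolding cinner_ext[OF cl Irr_class[OF \<chi>]] m(2)
      using Nats_subset_Ints by (intro Ints_diff Ints_add Ints_mult) auto
  qed
  then have "\<forall>\<chi>\<in>Irr G. \<exists>k. cinner G (ext \<phi>) \<chi> = of_int k"
    by (auto elim: Ints_cases)
  from bchoice[OF this]
  obtain k where k: "\<And>\<chi>. \<chi> \<in> Irr G \<Longrightarrow> cinner G (ext \<phi>) \<chi> = of_int (k \<chi>)"
    by blast
  have "1 = cinner G (ext \<phi>) (ext \<phi>)"
    using HG.Irr_orthonormal[OF \<phi> \<phi>] cinner_ext_ext[OF cl] by simp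
  also have "\<dots> = (\<Sum>\<chi>\<in>Irr G. of_int (k \<chi>) * of_int (k \<chi>))"
    unfolding cinner_parseval[OF ext_class[OF cl]] by (intro sum.cong) (auto simp: k)
  also have "\<dots> = of_int (\<Sum>\<chi>\<in>Irr G. k \<chi> * k \<chi>)" by simp
  finally have "(\<Sum>\<chi>\<in>Irr G. k \<chi> * k \<chi>) = 1" by (metis of_int_eq_1_iff)
  then obtain \<chi> where \<chi>: "\<chi> \<in> Irr G" "k \<chi> = 1 \<or> k \<chi> = -1"
    "\<And>\<psi>. \<psi> \<in> Irr G \<Longrightarrow> \<psi> \<noteq> \<chi> \<Longrightarrow> k \<psi> = 0"
    using sum_squares_eq_1[OF finite_Irr] by blast
  have eq: "ext \<phi> g = of_int (k \<chi>) * \<chi> g" if g: "g \<in> carrier G" for g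
  proof -
    have "ext \<phi> g = (\<Sum>\<psi>\<in>Irr G. of_int (k \<psi>) * \<psi> g)"
      unfolding class_function_expand[OF ext_class[OF cl] g] by (intro sum.cong) (auto simp: k)
    also have "\<dots> = (\<Sum>\<psi>\<in>{\<chi>}. of_int (k \<psi>) * \<psi> g)"
      using \<chi> finite_Irr by (intro sum.mono_neutral_right) auto
    finally show ?thesis by simp
  qed
  obtain e where e: "\<chi> \<one> = of_nat e" using Irr_one[OF \<chi>(1)] by blast
  \<comment> \<open>At the identity both \<open>ext \<phi>\<close> and \<chi> are positive degrees,
    which fixes the sign.\<close>
  have "k \<chi> \<noteq> -1"
  proof
    assume "k \<chi> = -1"
    then have "(of_nat m :: complex) = - of_nat e"
      using eq[of \<one>] m e one_in_kernel by (simp add: ext_kernel)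
    then have "(of_nat (m + e) :: complex) = 0" by simp
    then show False using m(1) by (simp only: of_nat_eq_0_iff)
  qed
  then have "ext \<phi> g = \<chi> g" for g
    using \<chi>(2) eq[of g] Irr_outside[OF \<chi>(1), of g] by (cases "g \<in> carrier G") (auto simp: ext_def)
  then have "ext \<phi> = \<chi>" by blast
  then show ?thesis using \<chi>(1) by simp
qed

text \<open>The expansion of the regular character of \<open>H\<close>, extended term by term: its
  value |H| at the identity spreads over the kernel, and its zeros fill the rest of
  \<open>G\<close>.\<close>

lemma sum_ext:
  assumes g: "g \<in> carrier G"
  shows "(\<Sum>\<phi>\<in>Irr HG. \<phi> \<one> * ext \<phi> g) = (if g \<in> K then of_nat (card H) else 0)"
proof -
  define f where "f h = (if h = \<one> then of_nat (card H) else 0 :: complex)" for h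
  have "class_function HG f"
    unfolding class_function_def
  proof (intro ballI)
    fix x h assume "x \<in> carrier HG" "h \<in> carrier HG"
    then have xh: "x \<in> H" "x \<in> carrier G" "h \<in> carrier G" using H_carrier by auto
    have "x \<otimes> h \<otimes> inv x = \<one> \<longleftrightarrow> h = \<one>"
      using conj_cancel(1)[OF xh(2,3)] xh by auto
    then show "f (x \<otimes>\<^bsub>HG\<^esub> h \<otimes>\<^bsub>HG\<^esub> inv\<^bsub>HG\<^esub> x) = f h"
      by (simp add: f_def HG_inv[OF xh(1)])
  qed
  have f: "(\<Sum>\<phi>\<in>Irr HG. \<phi> \<one> * \<phi> h) = f h" if "h \<in> H" for h
  proof -
    have "f h = (\<Sum>\<phi>\<in>Irr HG. cinner HG f \<phi> * \<phi> h)"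
      using HG.class_function_expand[OF \<open>class_function HG f\<close>, of h] that by simp
    also have "\<dots> = (\<Sum>\<phi>\<in>Irr HG. \<phi> \<one> * \<phi> h)"
      using HG.cinner_delta[of _ f] by (intro sum.cong refl) (simp add: f_def)
    finally show ?thesis by simp
  qed
  show ?thesis
  proof (cases "g \<in> K")
    case True
    then show ?thesis using f[OF H_one] by (simp add: ext_kernel f_def)
  next
    case False
    obtain x h where x: "x \<in> carrier G" "h \<in> H" "h \<noteq> \<one>" "h = x \<otimes> g \<otimes> inv x"
      using not_in_kernelE[OF g False] .
    have "ext \<phi> g = \<phi> h" if "\<phi> \<in> Irr HG" for \<phi>
      using ext_conj[OF HG.Irr_class[OF that] g, of x] x by simp
    then show ?thesis using False f[OF x(2)] x(3) by (simp add: f_def)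
  qed
qed

theorem kernel_mult:
  assumes a: "a \<in> K" and b: "b \<in> K"
  shows "a \<otimes> b \<in> K"
proof (rule ccontr)
  assume not: "a \<otimes> b \<notin> K"
  have ab: "a \<in> carrier G" "b \<in> carrier G" using a b kernel_subset by auto
  define x where "x = a \<otimes> b"
  have x: "x \<in> carrier G" using ab by (simp add: x_def)
  \<comment> \<open>The values are natural numbers, so once the convolution at \<open>x\<close>
    vanishes, every summand of it vanishes.\<close>
  let ?\<kappa> = "\<lambda>g. if g \<in> K then card H else 0"
  have \<kappa>: "of_nat (?\<kappa> g) = (\<Sum>\<phi>\<in>Irr HG. \<phi> \<one> * ext \<phi> g)" if "g \<in> carrier G" for g
    using sum_ext[OF that] by simp
  \<comment> \<open>Restriction to \<open>H\<close> recovers \<phi>; different \<phi> therefore have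
    different extensions, which convolve to 0.\<close>
  have inj: "\<phi> = \<phi>'" if "\<phi> \<in> Irr HG" "\<phi>' \<in> Irr HG" "ext \<phi> = ext \<phi>'" for \<phi> \<phi>'
  proof
    fix h show "\<phi> h = \<phi>' h"
      using ext_H[OF HG.Irr_class[OF that(1)], of h] ext_H[OF HG.Irr_class[OF that(2)], of h]
        HG.Irr_outside[OF that(1), of h] HG.Irr_outside[OF that(2), of h] that(3)
      by (cases "h \<in> H") simp_all
  qed
  have conv: "(\<Sum>g\<in>carrier G. ext \<phi> (inv g) * ext \<phi>' (g \<otimes> x)) =
    (if \<phi> = \<phi>' then of_nat (card (carrier G)) / \<phi>' \<one> * ext \<phi>' x else 0)"
    if "\<phi> \<in> Irr HG" "\<phi>' \<in> Irr HG" for \<phi> \<phi>'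
    using Irr_convolution[OF ext_Irr[OF that(1)] ext_Irr[OF that(2)] x] inj[OF that] one_in_kernel
    by (auto simp: ext_kernel)
  have "of_nat (\<Sum>g\<in>carrier G. ?\<kappa> (inv g) * ?\<kappa> (g \<otimes> x)) =
    (\<Sum>g\<in>carrier G. (\<Sum>\<phi>\<in>Irr HG. \<phi> \<one> * ext \<phi> (inv g)) * (\<Sum>\<phi>'\<in>Irr HG. \<phi>' \<one> * ext \<phi>' (g \<otimes> x)))"
    unfolding of_nat_sum of_nat_mult using x by (intro sum.cong refl arg_cong2[where f="(*)"] \<kappa>) auto
  also have "\<dots> = (\<Sum>g\<in>carrier G. \<Sum>\<phi>\<in>Irr HG. \<Sum>\<phi>'\<in>Irr HG.
      \<phi> \<one> * \<phi>' \<one> * (ext \<phi> (inv g) * ext \<phi>' (g \<otimes> x)))"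
    by (simp add: sum_product ac_simps)
  also have "\<dots> = (\<Sum>\<phi>\<in>Irr HG. \<Sum>\<phi>'\<in>Irr HG. \<Sum>g\<in>carrier G.
      \<phi> \<one> * \<phi>' \<one> * (ext \<phi> (inv g) * ext \<phi>' (g \<otimes> x)))"
    by (subst sum.swap, rule sum.cong[OF refl], rule sum.swap)
  also have "\<dots> = (\<Sum>\<phi>\<in>Irr HG. \<Sum>\<phi>'\<in>Irr HG.
      if \<phi> = \<phi>' then \<phi> \<one> * \<phi>' \<one> * (of_nat (card (carrier G)) / \<phi>' \<one> * ext \<phi>' x) else 0)"
    by (intro sum.cong refl) (simp add: sum_distrib_left[symmetric] conv)
  also have "\<dots> = (\<Sum>\<phi>\<in>Irr HG. of_nat (card (carrier G)) * (\<phi> \<one> * ext \<phi> x))"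
  proof (rule sum.cong[OF refl])
    fix \<phi> assume \<phi>: "\<phi> \<in> Irr HG"
    then have "\<phi> \<one> \<noteq> 0" using HG.Irr_one[OF \<phi>] by auto
    then show "(\<Sum>\<phi>'\<in>Irr HG. if \<phi> = \<phi>' then \<phi> \<one> * \<phi>' \<one> * (of_nat (card (carrier G)) / \<phi>' \<one> * ext \<phi>' x)
      else 0) = of_nat (card (carrier G)) * (\<phi> \<one> * ext \<phi> x)"
      using \<phi> HG.finite_Irr by simp
  qed
  also have "\<dots> = of_nat (card (carrier G)) * of_nat (?\<kappa> x)"
    unfolding \<kappa>[OF x] by (simp add: sum_distrib_left)
  also have "\<dots> = 0" using not by (simp add: x_def)
  finally have "(\<Sum>g\<in>carrier G. ?\<kappa> (inv g) * ?\<kappa> (g \<otimes> x)) = 0"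
    by (simp only: of_nat_eq_0_iff)
  then have "\<forall>g\<in>carrier G. ?\<kappa> (inv g) * ?\<kappa> (g \<otimes> x) = 0"
    by (subst (asm) sum_eq_0_iff) simp_all
  \<comment> \<open>The summand at g = inv a is the product of the values at \<open>a\<close> and at
    \<open>b\<close>, that is |H| squared.\<close>
  from bspec[OF this inv_closed[OF ab(1)]]
  have "?\<kappa> (inv (inv a)) * ?\<kappa> (inv a \<otimes> x) = 0" .
  moreover have "inv a \<otimes> x = b" using ab by (simp add: x_def flip: m_assoc)
  ultimately show False using a b ab card_H_pos by simp
qed

theorem kernel_normal: "K \<lhd> G"
proof -
  have "subgroup K G"
    by (rule subgroupI) (use kernel_subset one_in_kernel kernel_inv kernel_mult in auto)
  then show ?thesis
    unfolding normal_inv_iff using kernel_conj by blast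
qed

end

section \<open>Sylow subgroups and Frobenius kernels\<close>

context finite_group
begin

text \<open>Orbit-stabilizer: all fibres of the orbit map have the size of the stabilizer. The
  action is a plain function whose laws are required only on \<open>Q\<close> and \<open>E\<close>,
  so that conjugation and translation of cosets can be inserted directly.\<close>

lemma card_orbit_dvd:
  assumes Q: "subgroup Q G" and e: "e \<in> E"
    and closed: "\<And>q e. q \<in> Q \<Longrightarrow> e \<in> E \<Longrightarrow> act q e \<in> E"
    and one: "\<And>e. e \<in> E \<Longrightarrow> act \<one> e = e"
    and mult: "\<And>q r e. q \<in> Q \<Longrightarrow> r \<in> Q \<Longrightarrow> e \<in> E \<Longrightarrow> act (q \<otimes> r) e = act q (act r e)"
  shows "card ((\<lambda>q. act q e) ` Q) dvd card Q"
proof -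
  interpret Q: subgroup Q G by fact
  have fin: "finite Q" using Q.subset finite_carrier by (rule finite_subset)
  let ?S = "{q\<in>Q. act q e = e}"
  have "card {r\<in>Q. act r e = act q e} = card ?S" if q: "q \<in> Q" for q
  proof -
    have "bij_betw (\<lambda>s. q \<otimes> s) ?S {r\<in>Q. act r e = act q e}"
    proof (rule bij_betw_byWitness[where f' = "\<lambda>r. inv q \<otimes> r"])
      show "\<forall>s\<in>?S. inv q \<otimes> (q \<otimes> s) = s"
        using q by (auto simp flip: m_assoc)
      show "\<forall>r\<in>{r\<in>Q. act r e = act q e}. q \<otimes> (inv q \<otimes> r) = r"
        using q by (auto simp flip: m_assoc)
      show "(\<lambda>s. q \<otimes> s) ` ?S \<subseteq> {r\<in>Q. act r e = act q e}"
        using q e mult by auto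
      have "act (inv q) (act q e) = e"
        using mult[of "inv q" q e] one[OF e] q e by simp
      then show "(\<lambda>r. inv q \<otimes> r) ` {r\<in>Q. act r e = act q e} \<subseteq> ?S"
        using q e mult by auto
    qed
    then show ?thesis by (rule bij_betw_same_card[symmetric])
  qed
  then have "(\<Sum>f\<in>(\<lambda>q. act q e) ` Q. card {r\<in>Q. act r e = f}) = (\<Sum>f\<in>(\<lambda>q. act q e) ` Q. card ?S)"
    by (intro sum.cong refl) auto
  moreover have "card Q = (\<Sum>f\<in>(\<lambda>q. act q e) ` Q. card {r\<in>Q. act r e = f})"
    using sum.image_gen[OF fin, of "\<lambda>_. 1::nat" "\<lambda>q. act q e"] by simp
  ultimately show ?thesis by simp
qed

text \<open>Induction on |E|: removing an orbit with more than one element, whose size is a positive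
  power of \<open>p\<close>, changes |E| by a multiple of \<open>p\<close> and leaves the fixed
  points alone.\<close>

lemma card_fixed_points_cong:
  assumes Q: "subgroup Q G" "card Q = p ^ a" "prime p" and E: "finite E"
    and closed: "\<And>q e. q \<in> Q \<Longrightarrow> e \<in> E \<Longrightarrow> act q e \<in> E"
    and one: "\<And>e. e \<in> E \<Longrightarrow> act \<one> e = e"
    and mult: "\<And>q r e. q \<in> Q \<Longrightarrow> r \<in> Q \<Longrightarrow> e \<in> E \<Longrightarrow> act (q \<otimes> r) e = act q (act r e)"
  shows "[card {e\<in>E. \<forall>q\<in>Q. act q e = e} = card E] (mod p)"
  using E closed one mult
proof (induction "card E" arbitrary: E rule: less_induct)
  case (less E)
  interpret Q: subgroup Q G by fact
  have finQ: "finite Q" using Q.subset finite_carrier by (rule finite_subset)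
  show ?case
  proof (cases "\<forall>e\<in>E. \<forall>q\<in>Q. act q e = e")
    case True
    then have "{e\<in>E. \<forall>q\<in>Q. act q e = e} = E" by blast
    then show ?thesis by simp
  next
    case False
    then obtain e q where e: "e \<in> E" "q \<in> Q" "act q e \<noteq> e" by blast
    define R where "R = (\<lambda>q. act q e) ` Q"
    have RE: "R \<subseteq> E" using less.prems(2) e by (auto simp: R_def)
    then have finR: "finite R" using less.prems(1) finite_subset by blast
    have "act \<one> e \<in> R" unfolding R_def using Q.one_closed by (rule imageI)
    then have eR: "e \<in> R" using less.prems(3)[OF e(1)] by simp
    have R_closed: "act r f \<in> R" if r: "r \<in> Q" and f: "f \<in> R" for r f
    proof -
      obtain s where s: "s \<in> Q" "f = act s e" using f by (auto simp: R_def)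
      then have "act r f = act (r \<otimes> s) e" using less.prems(4) r e by simp
      then show ?thesis using r s by (auto simp: R_def)
    qed
    have "card R dvd p ^ a"
      unfolding R_def Q(2)[symmetric]
      by (rule card_orbit_dvd[where E=E]) (use Q e less.prems in auto)
    moreover have "card R \<noteq> 1"
    proof
      assume "card R = 1"
      then obtain z where "R = {z}" by (rule card_1_singletonE)
      then show False using eR e(2,3) by (auto simp: R_def)
    qed
    ultimately have "p dvd card R"
      by (metis divides_primepow_nat Q(3) dvd_triv_left power_0 power_Suc not0_implies_Suc)
    have inv: "act r f \<in> E - R" if r: "r \<in> Q" and f: "f \<in> E - R" for r f
    proof -
      have "f = act (inv r) (act r f)"
        using less.prems(4)[of "inv r" r f] less.prems(3)[of f] r f by simp
      then have "act r f \<notin> R" using R_closed[of "inv r" "act r f"] r f by auto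
      then show ?thesis using less.prems(2)[OF r, of f] f by simp
    qed
    have "card (E - R) < card E"
      using less.prems(1) e(1) eR by (intro psubset_card_mono) auto
    then have "[card {e\<in>E - R. \<forall>q\<in>Q. act q e = e} = card (E - R)] (mod p)"
      using less.hyps[of "E - R"] less.prems inv by simp
    moreover have "{f\<in>E - R. \<forall>q\<in>Q. act q f = f} = {f\<in>E. \<forall>q\<in>Q. act q f = f}"
    proof -
      have "\<not> (\<forall>r\<in>Q. act r f = f)" if f: "f \<in> R" for f
      proof
        assume fixed: "\<forall>r\<in>Q. act r f = f"
        obtain s where s: "s \<in> Q" "f = act s e" using f by (auto simp: R_def)
        have "e = act (inv s) f"
          using less.prems(4)[of "inv s" s e] less.prems(3)[OF e(1)] s e(1) by simp
        then have "e = f" using fixed s by simp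
        then show False using fixed e by auto
      qed
      then show ?thesis by auto
    qed
    moreover have "card E = card (E - R) + card R"
      using less.prems(1) RE finR by (simp add: card_Diff_subset card_mono)
    ultimately show ?thesis using \<open>p dvd card R\<close>
      by (simp add: cong_def mod_add_right_eq flip: mod_add_right_eq)
  qed
qed

text \<open>\<open>Q\<close> permutes the cosets \<open>P x\<close> in \<open>L\<close> by right
  translation. Their number \<open>m\<close> is prime to \<open>p\<close>, so one of them is fixed,
  and a fixed coset \<open>P x\<close> means that \<open>x\<close> conjugates \<open>Q\<close> into
  \<open>P\<close>. That \<open>x\<close> lies in \<open>L\<close> is what a Frattini argument asks
  for.\<close>

lemma sylow_conjugate:
  assumes L: "subgroup L G" and P: "subgroup P G" "P \<subseteq> L" "card P = p ^ a"
    and Q: "subgroup Q G" "Q \<subseteq> L" "card Q = p ^ a" and p: "prime p" "card L = p ^ a * m" "\<not> p dvd m"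
  obtains x where "x \<in> L" "\<And>q. q \<in> Q \<Longrightarrow> x \<otimes> q \<otimes> inv x \<in> P"
proof -
  interpret L: subgroup L G by fact
  interpret P: subgroup P G by fact
  interpret Q: subgroup Q G by fact
  define E where "E = (\<lambda>x. P #> x) ` L"
  have "finite L" using L.subset finite_carrier by (rule finite_subset)
  then have fin: "finite E" by (simp add: E_def)
  have "card (rcosets\<^bsub>G\<lparr>carrier := L\<rparr>\<^esub> P) * card P = card L"
    using group.lagrange[OF subgroup_imp_group[OF L] subgroup_incl[OF P(1) L P(2)]]
    by (simp add: Coset.order_def)
  moreover have "rcosets\<^bsub>G\<lparr>carrier := L\<rparr>\<^esub> P = E"
    by (auto simp: E_def RCOSETS_def r_coset_def)
  ultimately have "card E * p ^ a = p ^ a * m" using P(3) p(2) by simp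
  then have card_E: "card E = m" using p(1) by (simp add: prime_gt_0_nat)
  \<comment> \<open>The inverse turns right translation into a left action.\<close>
  define act where "act q C = C #> inv q" for q C
  have C_sub: "C \<subseteq> carrier G" if "C \<in> E" for C
    using that r_coset_subset_G[OF P.subset] L.subset by (auto simp: E_def)
  have act_coset: "act q (P #> x) = P #> (x \<otimes> inv q)" if "q \<in> Q" "x \<in> L" for q x
    unfolding act_def using that L.mem_carrier Q.mem_carrier by (intro coset_mult_assoc P.subset) auto
  have "[card {C\<in>E. \<forall>q\<in>Q. act q C = C} = card E] (mod p)"
  proof (rule card_fixed_points_cong[OF Q(1,3) p(1) fin])
    fix q C assume q: "q \<in> Q" and C: "C \<in> E"
    then obtain x where x: "x \<in> L" "C = P #> x" by (auto simp: E_def)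
    have "inv q \<in> L" using q Q(2) by auto
    then show "act q C \<in> E" using act_coset[OF q x(1)] x by (auto simp: E_def)
  next
    fix C assume C: "C \<in> E"
    show "act \<one> C = C" using C_sub[OF C] by (simp add: act_def coset_mult_one)
  next
    fix q r C assume q: "q \<in> Q" and r: "r \<in> Q" and C: "C \<in> E"
    show "act (q \<otimes> r) C = act q (act r C)"
      using C_sub[OF C] q r by (simp add: act_def inv_mult_group coset_mult_assoc)
  qed
  then have "\<not> p dvd card {C\<in>E. \<forall>q\<in>Q. act q C = C}"
    using card_E p(3) by (simp add: cong_dvd_iff)
  then have "{C\<in>E. \<forall>q\<in>Q. act q C = C} \<noteq> {}" by (metis card.empty dvd_0_right)
  then obtain x where x: "x \<in> L" "\<And>q. q \<in> Q \<Longrightarrow> act q (P #> x) = P #> x"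
    by (auto simp: E_def)
  have "x \<otimes> q \<otimes> inv x \<in> P" if q: "q \<in> Q" for q
  proof -
    have carr: "x \<in> carrier G" "q \<in> carrier G" using x q by auto
    have "P #> (x \<otimes> q) = P #> x"
      using act_coset[of "inv q" x] x(2)[of "inv q"] x(1) q by simp
    then have "x \<otimes> q \<in> P #> x"
      using rcos_self[OF _ P(1), of "x \<otimes> q"] carr by simp
    then obtain y where y: "y \<in> P" "x \<otimes> q = y \<otimes> x" by (auto simp: r_coset_def)
    then show ?thesis using carr by (simp add: m_assoc)
  qed
  then show ?thesis using that x(1) by blast
qed

text \<open>The center is the fixed point set of \<open>P\<close> acting on itself by conjugation,
  so \<open>p\<close> divides its order.\<close>

lemma p_group_center_nontrivial:
  assumes P: "subgroup P G" "card P = p ^ a" "prime p" "a > 0"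
  obtains z where "z \<in> P" "z \<noteq> \<one>" "\<And>t. t \<in> P \<Longrightarrow> t \<otimes> z \<otimes> inv t = z"
proof -
  interpret P: subgroup P G by fact
  have fin: "finite P" using P.subset finite_carrier by (rule finite_subset)
  let ?Z = "{z\<in>P. \<forall>t\<in>P. t \<otimes> z \<otimes> inv t = z}"
  have "[card ?Z = card P] (mod p)"
    by (rule card_fixed_points_cong[OF P(1,2,3) fin]) (auto simp: m_assoc inv_mult_group)
  then have "p dvd card ?Z" using P by (simp add: cong_dvd_iff)
  moreover have "card {\<one>} = 1" by simp
  ultimately have "?Z \<noteq> {\<one>}" using P(3) by (metis not_prime_unit)
  moreover have "\<one> \<in> ?Z" by auto
  ultimately obtain z where "z \<in> ?Z" "z \<noteq> \<one>" by blast
  then show ?thesis using that by blast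
qed

end

section \<open>Conjugate complements and the factorization G = K H\<close>

context malnormal_subgroup
begin

lemma conjugate_set_subset: "x \<in> carrier G \<Longrightarrow> conjugate_set G x H \<subseteq> carrier G"
  using H_carrier by (auto simp: conjugate_set_def)

lemma card_conjugate_set: "x \<in> carrier G \<Longrightarrow> card (conjugate_set G x H) = card H"
  unfolding conjugate_set_def
proof (rule card_image, rule inj_onI)
  fix a b assume x: "x \<in> carrier G" "a \<in> H" "b \<in> H" "inv x \<otimes> a \<otimes> x = inv x \<otimes> b \<otimes> x"
  then show "a = b" using conj_cancel(2)[of x a] conj_cancel(2)[of x b] H_carrier by metis
qed

lemma subgroup_conjugate_set:
  assumes x: "x \<in> carrier G"
  shows "subgroup (conjugate_set G x H) G"
proof (rule subgroupI)
  note iff = in_conjugate_set_iff[OF x]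
  note sub = subsetD[OF conjugate_set_subset[OF x]]
  show "conjugate_set G x H \<subseteq> carrier G" by (rule conjugate_set_subset[OF x])
  show "conjugate_set G x H \<noteq> {}" using H_one by (auto simp: conjugate_set_def)
  fix a assume a: "a \<in> conjugate_set G x H"
  have "x \<otimes> inv a \<otimes> inv x = inv (x \<otimes> a \<otimes> inv x)"
    using x sub[OF a] by (simp add: inv_mult_group m_assoc)
  then show "inv a \<in> conjugate_set G x H"
    using a sub[OF a] H_inv by (simp add: iff)
  fix b assume b: "b \<in> conjugate_set G x H"
  have "x \<otimes> (a \<otimes> b) \<otimes> inv x = (x \<otimes> a \<otimes> inv x) \<otimes> (x \<otimes> b \<otimes> inv x)"
    using x sub[OF a] sub[OF b] by (simp add: m_assoc) (simp flip: m_assoc)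
  then show "a \<otimes> b \<in> conjugate_set G x H"
    using a b sub[OF a] sub[OF b] H_mult by (simp add: iff)
qed

lemma malnormal_conjugate_set:
  assumes x: "x \<in> carrier G"
  shows "malnormal_subgroup G (conjugate_set G x H)"
proof (intro malnormal_subgroup.intro malnormal_subgroup_axioms.intro)
  show "finite_group G" by (rule finite_group_axioms)
  show "subgroup (conjugate_set G x H) G" by (rule subgroup_conjugate_set[OF x])
next
  note iff = in_conjugate_set_iff[OF x]
  fix y h assume y: "y \<in> carrier G" and h: "h \<in> conjugate_set G x H" "h \<noteq> \<one>"
    and yh: "inv y \<otimes> h \<otimes> y \<in> conjugate_set G x H"
  have hc: "h \<in> carrier G" using h conjugate_set_subset[OF x] by blast
  have "x \<otimes> h \<otimes> inv x \<noteq> \<one>" using conj_cancel(1)[OF x hc] h x by auto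
  moreover have "inv (x \<otimes> y \<otimes> inv x) \<otimes> (x \<otimes> h \<otimes> inv x) \<otimes> (x \<otimes> y \<otimes> inv x)
      = x \<otimes> (inv y \<otimes> h \<otimes> y) \<otimes> inv x"
    using x y hc by (simp add: inv_mult_group m_assoc) (simp flip: m_assoc)
  ultimately have "x \<otimes> y \<otimes> inv x \<in> H"
    using malnormal[of "x \<otimes> y \<otimes> inv x" "x \<otimes> h \<otimes> inv x"] h yh x y hc by (simp add: iff)
  then show "y \<in> conjugate_set G x H" using iff y by simp
qed

lemma kernel_conjugate_set:
  assumes x: "x \<in> carrier G"
  shows "frobenius_kernel G (conjugate_set G x H) = K"
proof -
  interpret C: malnormal_subgroup G "conjugate_set G x H" by (rule malnormal_conjugate_set[OF x])
  have "g \<in> C.K \<longleftrightarrow> g \<in> K" if g: "g \<in> carrier G" for g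
  proof -
    have 1: "y \<otimes> g \<otimes> inv y \<in> conjugate_set G x H \<longleftrightarrow> (x \<otimes> y) \<otimes> g \<otimes> inv (x \<otimes> y) \<in> H"
      if "y \<in> carrier G" for y
      using in_conjugate_set_iff[OF x, of "y \<otimes> g \<otimes> inv y"] conj_conj[OF x that g] that g by simp
    have 2: "y = x \<otimes> (inv x \<otimes> y)" if "y \<in> carrier G" for y
      using that x by (simp flip: m_assoc)
    show ?thesis
      unfolding C.in_kernel_iff[OF g] in_kernel_iff[OF g] using 1 2 x by (metis inv_closed m_closed)
  qed
  then show ?thesis using kernel_subset C.kernel_subset by blast
qed

lemma kernel_subgroup: "subgroup K G"
  using kernel_normal by (rule normal_imp_subgroup)

text \<open>\<open>H\<close> meets the kernel trivially, so its elements lie in different cosets of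
  the kernel. The quotient on the left is the one that decides adjacency in the derangement
  graph.\<close>

lemma kernel_mult_inv_iff:
  assumes k: "k \<in> K" "k' \<in> K" and h: "h \<in> H" "h' \<in> H"
  shows "(k \<otimes> h) \<otimes> inv (k' \<otimes> h') \<in> K \<longleftrightarrow> h = h'"
proof
  note carr = subsetD[OF kernel_subset k(1)] subsetD[OF kernel_subset k(2)] H_carrier[OF h(1)] H_carrier[OF h(2)]
  assume x: "(k \<otimes> h) \<otimes> inv (k' \<otimes> h') \<in> K"
  have "inv k \<otimes> ((k \<otimes> h) \<otimes> inv (k' \<otimes> h')) \<otimes> k' = h \<otimes> inv h'"
    using carr by (simp add: inv_mult_group m_assoc) (simp flip: m_assoc)
  then have "h \<otimes> inv h' \<in> K"
    using kernel_mult[OF kernel_mult[OF kernel_inv[OF k(1)] x] k(2)] by simp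
  moreover have "h \<otimes> inv h' \<in> H" using h H_mult H_inv by blast
  ultimately have "h \<otimes> inv h' = \<one>" using H_kernel by blast
  then show "h = h'" using carr by (metis inv_closed inv_equality inv_inv)
next
  note carr = subsetD[OF kernel_subset k(1)] subsetD[OF kernel_subset k(2)] H_carrier[OF h(1)]
  assume "h = h'"
  then have "(k \<otimes> h) \<otimes> inv (k' \<otimes> h') = k \<otimes> inv k'"
    using carr by (simp add: inv_mult_group m_assoc) (simp flip: m_assoc)
  then show "(k \<otimes> h) \<otimes> inv (k' \<otimes> h') \<in> K" using k kernel_mult kernel_inv by simp
qed

text \<open>Injectivity comes from \<open>kernel_mult_inv_iff\<close>, surjectivity from |H| |K| =
  |G|.\<close>

lemma kernel_factorization_bij: "bij_betw (\<lambda>(k,h). k \<otimes> h) (K \<times> H) (carrier G)"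
proof -
  let ?f = "\<lambda>(k,h). k \<otimes> h"
  have inj: "inj_on ?f (K \<times> H)"
  proof (rule inj_onI, clarify)
    fix k h k' h' assume a: "k \<in> K" "h \<in> H" "k' \<in> K" "h' \<in> H" "k \<otimes> h = k' \<otimes> h'"
    note carr = subsetD[OF kernel_subset a(1)] subsetD[OF kernel_subset a(3)] H_carrier[OF a(2)] H_carrier[OF a(4)]
    have "(k \<otimes> h) \<otimes> inv (k' \<otimes> h') \<in> K" using a(5) carr one_in_kernel by simp
    then have "h = h'" using kernel_mult_inv_iff a(1-4) by blast
    then show "k = k' \<and> h = h'" using a(5) carr by simp
  qed
  then have "card (?f ` (K \<times> H)) = card (carrier G)"
    using card_kernel by (simp add: card_image card_cartesian_product mult.commute)
  moreover have "?f ` (K \<times> H) \<subseteq> carrier G" using kernel_subset H_carrier by auto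
  ultimately have "?f ` (K \<times> H) = carrier G" by (intro card_subset_eq) auto
  with inj show ?thesis by (simp add: bij_betw_def)
qed

lemma kernel_factorization:
  assumes "g \<in> carrier G"
  obtains k h where "k \<in> K" "h \<in> H" "g = k \<otimes> h"
proof -
  have "g \<in> (\<lambda>(k,h). k \<otimes> h) ` (K \<times> H)"
    using bij_betw_imp_surj_on[OF kernel_factorization_bij] assms by simp
  then show ?thesis using that by force
qed

text \<open>Conjugate \<open>g\<close> to a nontrivial element of \<open>H\<close>. Its centralizer
  lies in \<open>H\<close> by malnormality, and \<open>H\<close> meets the kernel trivially.
  Elements outside the kernel thus act on it by conjugation without nontrivial fixed points.\<close>

lemma kernel_centralizer:
  assumes g: "g \<in> carrier G" "g \<notin> K" and u: "u \<in> K" "u \<otimes> g = g \<otimes> u"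
  shows "u = \<one>"
proof -
  obtain x h where x: "x \<in> carrier G" "h \<in> H" "h \<noteq> \<one>" "h = x \<otimes> g \<otimes> inv x"
    using not_in_kernelE[OF g] .
  have uc: "u \<in> carrier G" using u kernel_subset by blast
  let ?u = "x \<otimes> u \<otimes> inv x"
  have "inv ?u \<otimes> h \<otimes> ?u = x \<otimes> (inv u \<otimes> (g \<otimes> u)) \<otimes> inv x"
    unfolding x(4) using x(1) uc g by (simp add: inv_mult_group m_assoc) (simp flip: m_assoc)
  also have "inv u \<otimes> (g \<otimes> u) = g" unfolding u(2)[symmetric] using uc g by (simp flip: m_assoc)
  finally have "?u \<in> H" using malnormal[of ?u h] x(1-3) x(4)[symmetric] uc by simp
  moreover have "?u \<in> K" using kernel_conj u x by blast
  ultimately have "?u = \<one>" by (rule H_kernel)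
  then show ?thesis using conj_cancel(1)[OF x(1) uc] x(1) by simp
qed

text \<open>For \<open>g\<close> in \<open>N\<close> outside the kernel, the commutator map of
  \<open>k\<close> with \<open>g\<close> is injective on the kernel by
  \<open>kernel_centralizer\<close>, hence onto it by finiteness. All these commutators lie in
  \<open>N\<close>.\<close>

lemma normal_subgroup_dichotomy:
  assumes N: "N \<lhd> G"
  shows "N \<subseteq> K \<or> K \<subseteq> N"
proof (rule disjCI)
  assume "\<not> K \<subseteq> N"
  interpret N: normal N G by fact
  show "N \<subseteq> K"
  proof (rule ccontr)
    assume "\<not> N \<subseteq> K"
    then obtain g where g: "g \<in> N" "g \<notin> K" by blast
    then have gc: "g \<in> carrier G" by simp
    let ?f = "\<lambda>k. k \<otimes> (g \<otimes> inv k \<otimes> inv g)"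
    have Kc: "k \<in> carrier G" if "k \<in> K" for k using that kernel_subset by blast
    have "inj_on ?f K"
    proof (rule inj_onI)
      fix k k' assume k: "k \<in> K" "k' \<in> K" "?f k = ?f k'"
      note c = Kc[OF k(1)] Kc[OF k(2)]
      have "inv k' \<otimes> ?f k \<otimes> g \<otimes> k = inv k' \<otimes> ?f k' \<otimes> g \<otimes> k" using k(3) by simp
      then have "(inv k' \<otimes> k) \<otimes> g = g \<otimes> (inv k' \<otimes> k)"
        using c gc by (simp add: m_assoc) (simp flip: m_assoc)
      moreover have "inv k' \<otimes> k \<in> K" using k kernel_inv kernel_mult by blast
      ultimately have "inv k' \<otimes> k = \<one>" using kernel_centralizer[OF gc g(2)] by blast
      then show "k = k'" using c by (metis inv_comm inv_equality inv_inv inv_closed)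
    qed
    moreover have "?f ` K \<subseteq> K"
      using kernel_mult kernel_conj kernel_inv gc by blast
    ultimately have surj: "?f ` K = K" using finite_kernel by (simp add: endo_inj_surj)
    have "?f k \<in> N" if "k \<in> K" for k
    proof -
      have "?f k = (k \<otimes> g \<otimes> inv k) \<otimes> inv g" using Kc[OF that] gc by (simp add: m_assoc)
      then show ?thesis using N.inv_op_closed2[OF Kc[OF that] g(1)] g(1) by simp
    qed
    then have "?f ` K \<subseteq> N" by (rule image_subsetI)
    then have "K \<subseteq> N" unfolding surj .
    then show False using \<open>\<not> K \<subseteq> N\<close> by contradiction
  qed
qed

text \<open>A subgroup of \<open>H\<close> of prime order \<open>p\<close> acts on the kernel by
  conjugation and fixes only the identity, so |K| is 1 modulo \<open>p\<close>.\<close>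

lemma coprime_card_kernel: "coprime (card H) (card K)"
proof (rule ccontr)
  assume "\<not> coprime (card H) (card K)"
  then obtain p where p: "prime p" "p dvd card H" "p dvd card K"
    by (metis coprime_iff_gcd_eq_1 gcd_nat.bounded_iff prime_factor_nat)
  obtain m where "card H = p ^ 1 * m" using p(2) by auto
  then obtain Q where Q: "subgroup Q HG" "card Q = p ^ 1"
    using sylow_thm[OF p(1) HG.is_group, of 1 m] finite_H by (auto simp: Coset.order_def)
  have QG: "subgroup Q G" using incl_subgroup[OF subgroup_H Q(1)] .
  have QH: "Q \<subseteq> H" using subgroup.subset[OF Q(1)] by simp
  have "[card {k\<in>K. \<forall>q\<in>Q. q \<otimes> k \<otimes> inv q = k} = card K] (mod p)"
    using QH H_carrier kernel_subset kernel_conj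
    by (intro card_fixed_points_cong[OF QG Q(2) p(1) finite_kernel])
      (auto simp: m_assoc inv_mult_group subset_iff)
  moreover have "{k\<in>K. \<forall>q\<in>Q. q \<otimes> k \<otimes> inv q = k} = {\<one>}"
  proof -
    have "Q \<noteq> {\<one>}" using Q(2) p(1) by auto
    moreover have "\<one> \<in> Q" using QG by (rule subgroup.one_closed)
    ultimately obtain q where q: "q \<in> Q" "q \<noteq> \<one>" by blast
    then have qc: "q \<in> carrier G" "q \<notin> K" using QH H_carrier H_kernel by auto
    have "k = \<one>" if k: "k \<in> K" "q \<otimes> k \<otimes> inv q = k" for k
    proof -
      have kc: "k \<in> carrier G" using k kernel_subset by blast
      have "k \<otimes> q = q \<otimes> k \<otimes> inv q \<otimes> q" using k(2) by simp
      then have "k \<otimes> q = q \<otimes> k" using kc qc by (simp add: m_assoc)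
      then show ?thesis using kernel_centralizer[OF qc k(1)] by blast
    qed
    then have "{k\<in>K. \<forall>q\<in>Q. q \<otimes> k \<otimes> inv q = k} \<subseteq> {\<one>}" using q(1) by blast
    moreover have "q \<otimes> \<one> \<otimes> inv q = \<one>" if "q \<in> Q" for q
      using that subgroup.mem_carrier[OF QG] by simp
    ultimately show ?thesis using one_in_kernel by blast
  qed
  ultimately have "[1 = card K] (mod p)" by simp
  then have "p dvd 1" using p(3) cong_dvd_iff by blast
  then show False using p(1) by simp
qed

section \<open>Intersections of the complement with other subgroups\<close>

lemma malnormal_Int:
  assumes N: "subgroup N G"
  shows "malnormal_subgroup (G\<lparr>carrier := N\<rparr>) (N \<inter> H)"
proof -
  have sub: "N \<subseteq> carrier G" using N by (rule subgroup.subset)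
  interpret NG: finite_group "G\<lparr>carrier := N\<rparr>"
    by (intro finite_group.intro finite_group_axioms.intro subgroup_imp_group[OF N])
      (use finite_subset[OF sub finite_carrier] in simp)
  show ?thesis
  proof (intro malnormal_subgroup.intro malnormal_subgroup_axioms.intro)
    show "finite_group (G\<lparr>carrier := N\<rparr>)" by (rule NG.finite_group_axioms)
    show "subgroup (N \<inter> H) (G\<lparr>carrier := N\<rparr>)"
      using subgroup_incl[OF subgroups_Inter_pair[OF N subgroup_H] N] by simp
  next
    fix x h assume "x \<in> carrier (G\<lparr>carrier := N\<rparr>)" "h \<in> N \<inter> H" "h \<noteq> \<one>\<^bsub>G\<lparr>carrier := N\<rparr>\<^esub>"
      "inv\<^bsub>G\<lparr>carrier := N\<rparr>\<^esub> x \<otimes>\<^bsub>G\<lparr>carrier := N\<rparr>\<^esub> h \<otimes>\<^bsub>G\<lparr>carrier := N\<rparr>\<^esub> x \<in> N \<inter> H"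
    then show "x \<in> N \<inter> H"
      using malnormal[of x h] sub m_inv_consistent[OF N, of x] by auto
  qed
qed

lemma kernel_Int:
  assumes N: "subgroup N G"
  shows "frobenius_kernel (G\<lparr>carrier := N\<rparr>) (N \<inter> H) =
    {g\<in>N. \<forall>n\<in>N. n \<otimes> g \<otimes> inv n \<in> H \<longrightarrow> g = \<one>}"
proof -
  interpret NG: malnormal_subgroup "G\<lparr>carrier := N\<rparr>" "N \<inter> H" by (rule malnormal_Int[OF N])
  have "n \<otimes> g \<otimes> inv n \<in> N" if "n \<in> N" "g \<in> N" for n g
    using N that by (simp add: subgroup.m_closed subgroup.m_inv_closed)
  then show ?thesis
    using NG.in_kernel_iff NG.kernel_subset m_inv_consistent[OF N] by auto
qed

text \<open>The nontrivial \<open>N\<close>-conjugates of two subgroups \<open>N \<inter> H\<^sup>x \<noteq> 1\<close> and \<open>N \<inter> H\<^sup>y \<noteq> 1\<close> each cover at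
  least half of \<open>N\<close>, so they overlap and all such subgroups are conjugate in \<open>N\<close>.  Hence the kernel
  of \<open>N \<inter> H\<^sup>x\<close> in \<open>N\<close> is \<open>N \<inter> K\<close>, and comparing orders gives \<open>N \<inter> H\<^sup>x = H\<^sup>x\<close>.\<close>

lemma supplement_contains_conjugate:
  assumes N: "subgroup N G" and KN: "\<And>g. g \<in> carrier G \<Longrightarrow> \<exists>k\<in>K. \<exists>n\<in>N. g = k \<otimes> n" and H: "H \<noteq> {\<one>}"
  obtains x where "x \<in> carrier G" "conjugate_set G x H \<subseteq> N"
proof -
  interpret N: subgroup N G by fact
  have finN: "finite N" using N.subset finite_carrier by (rule finite_subset)
  have "\<not> N \<subseteq> K"
  proof
    assume "N \<subseteq> K"
    then have "H \<subseteq> K" using KN H_carrier kernel_mult by blast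
    then show False using H H_kernel H_one by blast
  qed
  then obtain g where g: "g \<in> N" "g \<notin> K" by blast
  obtain x h where x: "x \<in> carrier G" "h \<in> H" "h \<noteq> \<one>" "h = x \<otimes> g \<otimes> inv x"
    using not_in_kernelE[OF N.mem_carrier[OF g(1)] g(2)] .
  define B where "B y = N \<inter> conjugate_set G y H" for y
  define KB where "KB y = frobenius_kernel (G\<lparr>carrier := N\<rparr>) (B y)" for y
  have KB: "KB y = {g\<in>N. \<forall>n\<in>N. (y \<otimes> n) \<otimes> g \<otimes> inv (y \<otimes> n) \<in> H \<longrightarrow> g = \<one>}" if y: "y \<in> carrier G" for y
  proof -
    interpret C: malnormal_subgroup G "conjugate_set G y H" by (rule malnormal_conjugate_set[OF y])
    have "n \<otimes> g \<otimes> inv n \<in> conjugate_set G y H \<longleftrightarrow> (y \<otimes> n) \<otimes> g \<otimes> inv (y \<otimes> n) \<in> H"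
      if "n \<in> N" "g \<in> N" for n g
      using in_conjugate_set_iff[OF y, of "n \<otimes> g \<otimes> inv n"] conj_conj[OF y, of n g] that by simp
    then show ?thesis unfolding KB_def B_def C.kernel_Int[OF N] by auto
  qed
  have card_KB: "card (B y) * card (KB y) = card N" if y: "y \<in> carrier G" for y
  proof -
    interpret C: malnormal_subgroup G "conjugate_set G y H" by (rule malnormal_conjugate_set[OF y])
    interpret NG: malnormal_subgroup "G\<lparr>carrier := N\<rparr>" "B y"
      unfolding B_def by (rule C.malnormal_Int[OF N])
    show ?thesis using NG.card_kernel by (simp add: KB_def)
  qed
  have small: "2 * card (KB y) \<le> card N" if y: "y \<in> carrier G" and u: "u \<in> B y" "u \<noteq> \<one>" for y u
  proof -
    have "finite (B y)" using finN by (simp add: B_def)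
    moreover have "\<one> \<in> B y"
      using subgroup.one_closed[OF subgroup_conjugate_set[OF y]] by (simp add: B_def)
    ultimately have "card {\<one>,u} \<le> card (B y)" using u by (intro card_mono) auto
    then have "2 * card (KB y) \<le> card (B y) * card (KB y)" using u by (intro mult_right_mono) auto
    then show ?thesis using card_KB[OF y] by simp
  qed
  have gB: "g \<in> B x" "g \<noteq> \<one>"
    using g x in_conjugate_set_iff[OF x(1), of g] one_in_kernel by (auto simp: B_def)
  have "KB x \<subseteq> K"
  proof
    fix g' assume g': "g' \<in> KB x"
    show "g' \<in> K"
    proof (rule ccontr)
      assume not: "g' \<notin> K"
      have g'N: "g' \<in> N" using g' KB[OF x(1)] by simp
      then have g'c: "g' \<in> carrier G" by simp
      obtain y h' where y: "y \<in> carrier G" "h' \<in> H" "h' = y \<otimes> g' \<otimes> inv y"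
        using not_in_kernelE[OF g'c not] .
      have g'1: "g' \<noteq> \<one>" using not one_in_kernel by auto
      have g'B: "g' \<in> B y" using in_conjugate_set_iff[OF y(1), of g'] y g'N by (auto simp: B_def)
      \<comment> \<open>By malnormality, the conjugators \<open>x \<otimes> n\<close> and
        \<open>y \<otimes> n'\<close> of a common element \<open>z\<close> differ by a factor from
        \<open>H\<close>. Hence an \<open>N\<close>-conjugate of g' lies in \<open>B x\<close>,
        against g' being in \<open>KB x\<close>.\<close>
      have "(N - KB x) \<inter> (N - KB y) = {}"
      proof (rule ccontr)
        assume "(N - KB x) \<inter> (N - KB y) \<noteq> {}"
        then obtain z where z: "z \<in> N" "z \<notin> KB x" "z \<notin> KB y" by blast
        then have zc: "z \<in> carrier G" by simp
        obtain n where n: "n \<in> N" "(x \<otimes> n) \<otimes> z \<otimes> inv (x \<otimes> n) \<in> H" "z \<noteq> \<one>"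
          using z KB[OF x(1)] by blast
        obtain n' where n': "n' \<in> N" "(y \<otimes> n') \<otimes> z \<otimes> inv (y \<otimes> n') \<in> H"
          using z KB[OF y(1)] by blast
        define s where "s = x \<otimes> n"
        define t where "t = y \<otimes> n'"
        have st: "s \<in> carrier G" "t \<in> carrier G" using x(1) y(1) n n' by (auto simp: s_def t_def)
        have szc: "s \<otimes> z \<otimes> inv s \<noteq> \<one>" using conj_cancel(1)[OF st(1) zc] n(3) st by auto
        have "inv (s \<otimes> inv t) \<otimes> (s \<otimes> z \<otimes> inv s) \<otimes> (s \<otimes> inv t) = t \<otimes> z \<otimes> inv t"
          using st zc by (simp add: inv_mult_group m_assoc) (simp flip: m_assoc)
        then have w: "s \<otimes> inv t \<in> H"
          using malnormal[of "s \<otimes> inv t" "s \<otimes> z \<otimes> inv s"] st n(2) n'(2) szc by (simp add: s_def t_def)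
        define n1 where "n1 = n \<otimes> inv n'"
        have n1: "n1 \<in> N" using n n' by (simp add: n1_def)
        have "x \<otimes> n1 = (s \<otimes> inv t) \<otimes> y"
          unfolding n1_def s_def t_def using x(1) y(1) n(1) n'(1)
          by (simp add: inv_mult_group m_assoc) 
        then have "(x \<otimes> n1) \<otimes> g' \<otimes> inv (x \<otimes> n1) = (s \<otimes> inv t) \<otimes> (y \<otimes> g' \<otimes> inv y) \<otimes> inv (s \<otimes> inv t)"
          using conj_conj[of "s \<otimes> inv t" y g'] st y(1) g'c by simp
        also have "\<dots> \<in> H" using w y(2) y(3)[symmetric] H_mult H_inv by simp
        finally show False using g' KB[OF x(1)] n1 g'1 by blast
      qed
      then have "card (N - KB x) + card (N - KB y) = card ((N - KB x) \<union> (N - KB y))"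
        using finN by (simp add: card_Un_disjoint)
      \<comment> \<open>Both sets miss the identity, so two sets of at least half the size of
        \<open>N\<close> have no room to be disjoint.\<close>
      also have "\<dots> \<le> card (N - {\<one>})"
        using finN KB[OF x(1)] KB[OF y(1)] by (intro card_mono) auto
      also have "\<dots> < card N"
        by (rule card_Diff1_less[OF finN N.one_closed])
      finally have "card (N - KB x) + card (N - KB y) < card N" .
      moreover have "card (N - KB x) = card N - card (KB x)" "card (N - KB y) = card N - card (KB y)"
        using KB[OF x(1)] KB[OF y(1)]
        by (intro card_Diff_subset finite_subset[OF _ finN]; blast)+
      ultimately show False using small[OF x(1) gB] small[OF y(1) g'B g'1] by linarith
    qed
  qed
  then have "KB x \<subseteq> N \<inter> K" using KB[OF x(1)] by auto
  then have "card (KB x) \<le> card (N \<inter> K)" using finN by (intro card_mono) auto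
  then have N_le: "card N \<le> card (B x) * card (N \<inter> K)"
    unfolding card_KB[OF x(1), symmetric] by simp
  \<comment> \<open>The elements \<nu> h of \<open>N\<close>, taken from the cosets
    \<open>K h\<close>, represent |H| different cosets of \<open>N \<inter> K\<close>. So |N
    \<inter> K| |H| \<le> |N|, and \<open>N_le\<close> then forces \<open>B x\<close> to be at least
    as large as \<open>H\<close>.\<close>
  have "\<forall>h\<in>H. \<exists>n. n \<in> N \<and> (\<exists>k\<in>K. h = k \<otimes> n)" using KN H_carrier by blast
  from bchoice[OF this] obtain \<nu> where \<nu>: "\<And>h. h \<in> H \<Longrightarrow> \<nu> h \<in> N" "\<And>h. h \<in> H \<Longrightarrow> \<exists>k\<in>K. h = k \<otimes> \<nu> h"
    by blast
  have "inj_on (\<lambda>(m,h). m \<otimes> \<nu> h) ((N \<inter> K) \<times> H)"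
  proof (rule inj_onI, clarify)
    fix m h m' h' assume a: "m \<in> N" "m \<in> K" "h \<in> H" "m' \<in> N" "m' \<in> K" "h' \<in> H" "m \<otimes> \<nu> h = m' \<otimes> \<nu> h'"
    obtain k k' where k: "k \<in> K" "h = k \<otimes> \<nu> h" "k' \<in> K" "h' = k' \<otimes> \<nu> h'" using \<nu>(2) a by blast
    have carr: "m \<in> carrier G" "m' \<in> carrier G" "k \<in> carrier G" "k' \<in> carrier G" "\<nu> h \<in> carrier G"
      "\<nu> h' \<in> carrier G"
      using a k \<nu>(1) kernel_subset by auto
    have "\<nu> h = inv m \<otimes> (m' \<otimes> \<nu> h')" unfolding a(7)[symmetric] using carr by (simp flip: m_assoc)
    then have eq: "k \<otimes> \<nu> h \<otimes> inv (k' \<otimes> \<nu> h') = k \<otimes> inv m \<otimes> m' \<otimes> inv k'"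
      using carr by (simp add: inv_mult_group m_assoc) (simp flip: m_assoc)
    have "k \<otimes> inv m \<otimes> m' \<otimes> inv k' \<in> K" using a k kernel_mult kernel_inv by simp
    then have "h \<otimes> inv h' \<in> K" using eq k(2)[symmetric] k(4)[symmetric] by simp
    moreover have "h \<otimes> inv h' \<in> H" using a H_mult H_inv by simp
    ultimately have "h \<otimes> inv h' = \<one>" using H_kernel by blast
    then have hh: "h = h'" using a H_carrier by (metis inv_closed inv_equality inv_inv)
    then show "m = m' \<and> h = h'" using a(7) carr by simp
  qed
  then have "card (N \<inter> K) * card H = card ((\<lambda>(m,h). m \<otimes> \<nu> h) ` ((N \<inter> K) \<times> H))"
    by (simp add: card_image card_cartesian_product)
  also have "\<dots> \<le> card N" using finN \<nu>(1) by (intro card_mono) auto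
  also note N_le
  finally have "card (N \<inter> K) * card H \<le> card (B x) * card (N \<inter> K)" .
  moreover have "card (N \<inter> K) > 0"
    using finN IntI[OF N.one_closed one_in_kernel] by (metis card_gt_0_iff empty_iff finite_Int)
  ultimately have "card (conjugate_set G x H) \<le> card (B x)"
    using card_conjugate_set[OF x(1)] by (simp add: mult.commute)
  then have "B x = conjugate_set G x H"
    using finite_subset[OF conjugate_set_subset[OF x(1)] finite_carrier]
    by (intro card_seteq) (auto simp: B_def)
  then show ?thesis using that x(1) by (auto simp: B_def)
qed

end

section \<open>Uniqueness of the Frobenius kernel\<close>

text \<open>\<open>Z\<close> is the center of a Sylow subgroup \<open>P\<close> of the kernel. The
  normalizer of \<open>P\<close> supplements the kernel, so
  \<open>supplement_contains_conjugate\<close> puts a conjugate of \<open>H\<close> into it, and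
  whatever normalizes \<open>P\<close> normalizes its center.\<close>

lemma (in malnormal_subgroup) normalized_abelian_subgroup:
  assumes H: "H \<noteq> {\<one>}" and K: "K \<noteq> {\<one>}"
  obtains y Z where "y \<in> carrier G" "subgroup Z G" "Z \<subseteq> K" "Z \<noteq> {\<one>}"
    "\<And>a b. a \<in> Z \<Longrightarrow> b \<in> Z \<Longrightarrow> a \<otimes> b = b \<otimes> a"
    "\<And>h z. h \<in> conjugate_set G y H \<Longrightarrow> z \<in> Z \<Longrightarrow> h \<otimes> z \<otimes> inv h \<in> Z"
proof -
  have "card K \<noteq> 1" using K one_in_kernel by (metis card_1_singletonE singletonD)
  then obtain p where p: "prime p" "p dvd card K" using prime_factor_nat by blast
  define a where "a = multiplicity p (card K)"
  have K0: "card K \<noteq> 0" using finite_kernel one_in_kernel by auto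
  then obtain m where m: "card K = p ^ a * m" "\<not> p dvd m"
    using multiplicity_decompose'[of "card K" p] p(1) by (metis a_def not_prime_unit)
  have a: "a > 0" using p m by (cases a) auto
  obtain P where "subgroup P (G\<lparr>carrier := K\<rparr>)" and cP: "card P = p ^ a"
    using sylow_thm[OF p(1) subgroup_imp_group[OF kernel_subgroup], of a m] m finite_kernel
    by (auto simp: Coset.order_def)
  then have P: "subgroup P G" and PK: "P \<subseteq> K"
    using incl_subgroup[OF kernel_subgroup] subgroup.subset by force+
  interpret P: subgroup P G by (rule P)
  have finP: "finite P" using P.subset finite_carrier by (rule finite_subset)
  \<comment> \<open>The inclusion describes the normalizer because \<open>P\<close> is finite;
    \<open>surj\<close> upgrades it to an equality.\<close>
  define N where "N = {g\<in>carrier G. \<forall>y\<in>P. g \<otimes> y \<otimes> inv g \<in> P}"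
  have surj: "(\<lambda>y. g \<otimes> y \<otimes> inv g) ` P = P" if g: "g \<in> N" for g
  proof (rule endo_inj_surj[OF finP])
    show "(\<lambda>y. g \<otimes> y \<otimes> inv g) ` P \<subseteq> P" using g by (auto simp: N_def)
    show "inj_on (\<lambda>y. g \<otimes> y \<otimes> inv g) P" using g by (auto simp: N_def inj_on_def)
  qed
  have N: "subgroup N G"
  proof (rule subgroupI)
    show "N \<subseteq> carrier G" by (auto simp: N_def)
    have "\<one> \<in> N" by (auto simp: N_def)
    then show "N \<noteq> {}" by blast
  next
    fix g assume g: "g \<in> N"
    then have gc: "g \<in> carrier G" by (simp add: N_def)
    have "inv g \<otimes> y \<otimes> inv (inv g) \<in> P" if y: "y \<in> P" for y
    proof -
      obtain t where t: "t \<in> P" "y = g \<otimes> t \<otimes> inv g" using surj[OF g] y by blast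
      then show ?thesis using conj_cancel(1)[OF gc, of t] gc by simp
    qed
    then show "inv g \<in> N" using gc by (simp add: N_def)
  next
    fix g h assume g: "g \<in> N" and h: "h \<in> N"
    then have "(g \<otimes> h) \<otimes> y \<otimes> inv (g \<otimes> h) \<in> P" if "y \<in> P" for y
      using that conj_conj[of g h y, symmetric] by (simp add: N_def)
    then show "g \<otimes> h \<in> N" using g h by (simp add: N_def)
  qed
  \<comment> \<open>Frattini argument: the conjugate of \<open>P\<close> by \<open>g\<close> is
    again a Sylow subgroup of the kernel, so some \<open>x\<close> in the kernel moves it back to
    \<open>P\<close>, and \<open>x \<otimes> g\<close> normalizes \<open>P\<close>.\<close>
  have "\<exists>k\<in>K. \<exists>n\<in>N. g = k \<otimes> n" if g: "g \<in> carrier G" for g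
  proof -
    let ?Q = "(\<lambda>y. g \<otimes> y \<otimes> inv g) ` P"
    have "subgroup ?Q G"
    proof (rule subgroupI)
      show "?Q \<subseteq> carrier G" using g by auto
      show "?Q \<noteq> {}" using P.one_closed by blast
    next
      fix q assume "q \<in> ?Q"
      then obtain y where y: "y \<in> P" "q = g \<otimes> y \<otimes> inv g" by blast
      then have "inv q = g \<otimes> inv y \<otimes> inv g" using g by (simp add: inv_mult_group m_assoc)
      then show "inv q \<in> ?Q" using y by blast
    next
      fix q r assume "q \<in> ?Q" "r \<in> ?Q"
      then obtain y z where y: "y \<in> P" "q = g \<otimes> y \<otimes> inv g" "z \<in> P" "r = g \<otimes> z \<otimes> inv g" by blast
      then have "q \<otimes> r = g \<otimes> (y \<otimes> z) \<otimes> inv g"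
        using g by (simp add: m_assoc) (simp flip: m_assoc)
      then show "q \<otimes> r \<in> ?Q" using y by blast
    qed
    moreover have "?Q \<subseteq> K" using PK kernel_conj g by blast
    moreover have "card ?Q = p ^ a"
      using g cP by (subst card_image) (auto simp: inj_on_def)
    ultimately obtain x where x: "x \<in> K" "\<And>q. q \<in> ?Q \<Longrightarrow> x \<otimes> q \<otimes> inv x \<in> P"
      using sylow_conjugate[OF kernel_subgroup P PK cP _ _ _ p(1) m] by metis
    have xc: "x \<in> carrier G" using x kernel_subset by blast
    have "x \<otimes> g \<in> N"
      using x(2)[OF imageI] conj_conj[OF xc g, symmetric] xc g by (simp add: N_def)
    moreover have "g = inv x \<otimes> (x \<otimes> g)" using xc g by (simp flip: m_assoc)
    ultimately show ?thesis using kernel_inv[OF x(1)] by blast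
  qed
  then obtain y where y: "y \<in> carrier G" "conjugate_set G y H \<subseteq> N"
    using supplement_contains_conjugate[OF N _ H] by blast
  define Z where "Z = {z\<in>P. \<forall>t\<in>P. t \<otimes> z \<otimes> inv t = z}"
  have commute: "t \<otimes> z = z \<otimes> t" if "z \<in> Z" "t \<in> P" for z t
  proof -
    have zc: "z \<in> carrier G" using that(1) by (simp add: Z_def)
    have "t \<otimes> z = t \<otimes> z \<otimes> inv t \<otimes> t" using that zc by (simp add: m_assoc)
    then show ?thesis using that by (simp add: Z_def)
  qed
  have ZI: "z \<in> Z" if z: "z \<in> P" and "\<And>t. t \<in> P \<Longrightarrow> t \<otimes> z = z \<otimes> t" for z
    unfolding Z_def using that by (auto simp: m_assoc)
  have ZP: "Z \<subseteq> P" by (auto simp: Z_def)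
  have "subgroup Z G"
  proof (rule subgroupI)
    show "Z \<subseteq> carrier G" using ZP P.subset by blast
    have "\<one> \<in> Z" by (rule ZI) auto
    then show "Z \<noteq> {}" by blast
  next
    fix z assume z: "z \<in> Z"
    then have zP: "z \<in> P" using ZP by blast
    show "inv z \<in> Z"
    proof (rule ZI)
      fix t assume t: "t \<in> P"
      have "inv (inv t \<otimes> z) = inv (z \<otimes> inv t)" using commute[OF z, of "inv t"] t by simp
      then show "t \<otimes> inv z = inv z \<otimes> t" using t zP by (simp add: inv_mult_group)
    qed (use zP in simp)
  next
    fix z w assume z: "z \<in> Z" and w: "w \<in> Z"
    then have P: "z \<in> P" "w \<in> P" using ZP by auto
    show "z \<otimes> w \<in> Z"
    proof (rule ZI)
      fix t assume t: "t \<in> P"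
      have "t \<otimes> (z \<otimes> w) = (z \<otimes> t) \<otimes> w" using commute[OF z t] t P by (simp flip: m_assoc)
      also have "\<dots> = z \<otimes> w \<otimes> t" using commute[OF w t] t P by (simp add: m_assoc)
      finally show "t \<otimes> (z \<otimes> w) = z \<otimes> w \<otimes> t" .
    qed (use P in simp)
  qed
  moreover obtain z where "z \<in> P" "z \<noteq> \<one>" "\<And>t. t \<in> P \<Longrightarrow> t \<otimes> z \<otimes> inv t = z"
    by (rule p_group_center_nontrivial[OF P cP p(1) a]) blast
  then have "z \<in> Z" "z \<noteq> \<one>" by (auto simp: Z_def)
  then have "Z \<noteq> {\<one>}" by blast
  moreover have "h \<otimes> z \<otimes> inv h \<in> Z" if h: "h \<in> conjugate_set G y H" and z: "z \<in> Z" for h z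
  proof (rule ZI)
    have hN: "h \<in> N" using h y by blast
    then have hc: "h \<in> carrier G" by (simp add: N_def)
    have zP: "z \<in> P" using z ZP by blast
    show "h \<otimes> z \<otimes> inv h \<in> P" using hN zP by (simp add: N_def)
    fix t assume t: "t \<in> P"
    obtain s where s: "s \<in> P" "t = h \<otimes> s \<otimes> inv h" using surj[OF hN] t by blast
    have "t \<otimes> (h \<otimes> z \<otimes> inv h) = h \<otimes> (s \<otimes> z) \<otimes> inv h"
      unfolding s(2) using hc s(1) zP by (simp add: m_assoc) (simp flip: m_assoc)
    also have "\<dots> = h \<otimes> (z \<otimes> s) \<otimes> inv h" using commute[OF z s(1)] by simp
    also have "\<dots> = (h \<otimes> z \<otimes> inv h) \<otimes> t"
      unfolding s(2) using hc s(1) zP by (simp add: m_assoc) (simp flip: m_assoc)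
    finally show "t \<otimes> (h \<otimes> z \<otimes> inv h) = (h \<otimes> z \<otimes> inv h) \<otimes> t" .
  qed
  ultimately show ?thesis using that[of y Z] y(1) ZP PK commute by blast
qed

text \<open>Suppose \<open>K\<^sub>H < K\<^sub>D\<close>.  Then \<open>H\<close> is the union of \<open>A = H \<inter> K\<^sub>D \<noteq> 1\<close> and the conjugates \<open>D\<^sup>a\<close>, which
  meet trivially.  For every nontrivial \<open>S \<le> H\<close> and \<open>v \<in> Z\<close>, the product of all \<open>S\<close>-conjugates of \<open>v\<close>
  is fixed by \<open>S\<close>, hence trivial.  Comparing the products over \<open>H\<close>, \<open>A\<close> and the \<open>D\<^sup>a\<close> yields
  \<open>v\<^bsup>|A|\<^esup> = 1\<close>, which is impossible for \<open>v \<noteq> 1\<close> as \<open>|A|\<close> is prime to \<open>|K\<^sub>H|\<close>.\<close>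

lemma kernel_subset_of_normalized_abelian:
  fixes G (structure)
  assumes H: "malnormal_subgroup G H" and D: "malnormal_subgroup G D" and DH: "D \<subseteq> H" and D1: "D \<noteq> {\<one>}"
    and KHD: "frobenius_kernel G H \<subseteq> frobenius_kernel G D"
    and Z: "subgroup Z G" "Z \<subseteq> frobenius_kernel G H" "Z \<noteq> {\<one>}"
    and Z_comm: "\<And>a b. a \<in> Z \<Longrightarrow> b \<in> Z \<Longrightarrow> a \<otimes> b = b \<otimes> a"
    and Z_norm: "\<And>h z. h \<in> H \<Longrightarrow> z \<in> Z \<Longrightarrow> h \<otimes> z \<otimes> inv h \<in> Z"
  shows "frobenius_kernel G D \<subseteq> frobenius_kernel G H"
proof (rule ccontr)
  interpret H: malnormal_subgroup G H by (rule H)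
  interpret D: malnormal_subgroup G D by (rule D)
  interpret Z: subgroup Z G by (rule Z(1))
  assume "\<not> D.K \<subseteq> H.K"
  then obtain g where g: "g \<in> D.K" "g \<notin> H.K" by blast
  define A where "A = H \<inter> D.K"
  have A: "subgroup A G"
    unfolding A_def by (rule H.subgroups_Inter_pair[OF H.subgroup_H D.kernel_subgroup])
  \<comment> \<open>A conjugate of \<open>g\<close> inside \<open>H\<close> stays in the normal
    subgroup \<open>D.K\<close>, so \<open>A\<close> is not trivial.\<close>
  obtain x t where xt: "x \<in> carrier G" "t \<in> H" "t \<noteq> \<one>" "t = x \<otimes> g \<otimes> inv x"
    using H.not_in_kernelE[OF subsetD[OF D.kernel_subset g(1)] g(2)] .
  have tA: "t \<in> A" "t \<noteq> \<one>" using xt D.kernel_conj[OF g(1) xt(1)] by (auto simp: A_def)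
  have AH: "A \<subseteq> H" by (simp add: A_def)
  have finA: "finite A" using H.finite_H AH finite_subset by blast
  define S where "S a = conjugate_set G a D" for a
  have aA: "a \<in> carrier G" "a \<in> H" "a \<in> D.K" if "a \<in> A" for a
    using that H.H_carrier by (auto simp: A_def)
  have S_sub: "subgroup (S a) G" if "a \<in> A" for a
    unfolding S_def using D.subgroup_conjugate_set[OF aA(1)[OF that]] .
  have S_H: "S a \<subseteq> H" if "a \<in> A" for a
    using aA[OF that] DH H.H_mult H.H_inv by (auto simp: S_def conjugate_set_def)
  have finS: "finite (S a)" if "a \<in> A" for a
    using S_H[OF that] H.finite_H finite_subset by blast
  have H_eq: "H = A \<union> (\<Union>a\<in>A. S a - {\<one>})"
  proof (intro equalityI subsetI)
    fix h assume h: "h \<in> H"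
    show "h \<in> A \<union> (\<Union>a\<in>A. S a - {\<one>})"
    proof (cases "h \<in> D.K")
      case True
      then show ?thesis using h by (simp add: A_def)
    next
      case False
      have hc: "h \<in> carrier G" using h by (rule H.H_carrier)
      obtain y d where y: "y \<in> carrier G" "d \<in> D" "d = y \<otimes> h \<otimes> inv y"
        using D.not_in_kernelE[OF hc False] .
      \<comment> \<open>Splitting off the \<open>D\<close>-part of the conjugator leaves an element
        \<open>k\<close> of \<open>D.K\<close> that still conjugates \<open>h\<close> into
        \<open>D\<close>. Malnormality of \<open>H\<close> places \<open>k\<close> in
        \<open>H\<close>, hence in \<open>A\<close>.\<close>
      obtain k e where ke: "k \<in> D.K" "e \<in> D" "inv y = k \<otimes> e"
        using D.kernel_factorization[of "inv y"] y by auto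
      have carr: "k \<in> carrier G" "e \<in> carrier G" using ke D.kernel_subset D.H_carrier by auto
      have y_eq: "y = inv e \<otimes> inv k"
        using arg_cong[OF ke(3), of "\<lambda>z. inv z"] y(1) carr by (simp add: H.inv_mult_group)
      have "inv k \<otimes> h \<otimes> k = e \<otimes> d \<otimes> inv e"
        unfolding y(3) y_eq using carr hc
        by (simp add: H.inv_mult_group H.m_assoc) (simp flip: H.m_assoc)
      moreover have "e \<otimes> d \<otimes> inv e \<in> D" using ke y D.H_mult D.H_inv by blast
      ultimately have kD: "inv k \<otimes> h \<otimes> k \<in> D" by simp
      have h1: "h \<noteq> \<one>" using False D.one_in_kernel by auto
      have "k \<in> H" using H.malnormal[OF carr(1) h h1] kD DH by blast
      then have kA: "inv k \<in> A"
        using ke H.H_inv D.kernel_inv by (simp add: A_def)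
      have "h \<in> S (inv k)"
        unfolding S_def using D.in_conjugate_set_iff[of "inv k" h] carr hc kD by simp
      then show ?thesis using kA h1 by blast
    qed
  next
    fix h assume "h \<in> A \<union> (\<Union>a\<in>A. S a - {\<one>})"
    then show "h \<in> H" using AH S_H by blast
  qed
  have A_disj: "A \<inter> (S a - {\<one>}) = {}" if "a \<in> A" for a
  proof -
    have "g = \<one>" if g: "g \<in> D.K" "g \<in> S a" for g
      using g D.in_kernel_iff[of g] D.in_conjugate_set_iff[OF aA(1)[OF \<open>a \<in> A\<close>], of g] D.kernel_subset
        aA(1)[OF \<open>a \<in> A\<close>] by (auto simp: S_def)
    then show ?thesis by (auto simp: A_def)
  qed
  \<comment> \<open>A common nontrivial element puts \<open>a \<otimes> inv b\<close> into
    \<open>D\<close> by malnormality, while it also lies in the kernel of \<open>D\<close>.\<close>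
  have S_disj: "(S a - {\<one>}) \<inter> (S b - {\<one>}) = {}" if a: "a \<in> A" and b: "b \<in> A" and ab: "a \<noteq> b" for a b
  proof (rule ccontr)
    note c = aA[OF a] aA[OF b]
    assume "(S a - {\<one>}) \<inter> (S b - {\<one>}) \<noteq> {}"
    then obtain s where s: "s \<in> S a" "s \<in> S b" "s \<noteq> \<one>" by blast
    have sc: "s \<in> carrier G" using s(1) S_H[OF a] H.H_carrier by blast
    have sD: "a \<otimes> s \<otimes> inv a \<in> D" "b \<otimes> s \<otimes> inv b \<in> D"
      using s D.in_conjugate_set_iff[OF c(1) sc] D.in_conjugate_set_iff[OF c(4) sc] by (auto simp: S_def)
    have "a \<otimes> s \<otimes> inv a \<noteq> \<one>" using H.conj_cancel(1)[OF c(1) sc] s(3) c by auto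
    moreover have "inv (a \<otimes> inv b) \<otimes> (a \<otimes> s \<otimes> inv a) \<otimes> (a \<otimes> inv b) = b \<otimes> s \<otimes> inv b"
      using c sc by (simp add: H.inv_mult_group H.m_assoc) (simp flip: H.m_assoc)
    ultimately have "a \<otimes> inv b \<in> D" using D.malnormal[of "a \<otimes> inv b"] sD c by simp
    moreover have "a \<otimes> inv b \<in> D.K" using c D.kernel_mult D.kernel_inv by blast
    ultimately have "a \<otimes> inv b = \<one>" by (rule D.H_kernel)
    then have "a = b" using c by (metis H.inv_closed H.inv_equality H.inv_inv)
    then show False using ab by contradiction
  qed
  let ?ZG = "G\<lparr>carrier := Z\<rparr>"
  interpret ZG: comm_group ?ZG
    using Z_comm by (intro group.group_comm_groupI[OF H.subgroup_imp_group[OF Z(1)]]) auto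
  have "v = \<one>" if v: "v \<in> Z" for v
  proof -
    define f where "f s = s \<otimes> v \<otimes> inv s" for s
    have f: "f s \<in> Z" if "s \<in> H" for s using Z_norm[OF that v] by (simp add: f_def)
    have prod1: "finprod ?ZG f T = \<one>" if T: "subgroup T G" "T \<subseteq> H" "t \<in> T" "t \<noteq> \<one>" for T t
    proof -
      interpret T: subgroup T G by (rule T(1))
      have tH: "t \<in> H" "t \<in> carrier G" using T by auto
      have finT: "finite T" using T(2) H.finite_H finite_subset by blast
      have fT: "f \<in> T \<rightarrow> Z" using f T(2) by auto
      let ?w = "finprod ?ZG f T"
      have wZ: "?w \<in> Z" using ZG.finprod_closed[of f T] fT by simp
      have conj: "t \<otimes> finprod ?ZG f U \<otimes> inv t = finprod ?ZG (\<lambda>s. t \<otimes> f s \<otimes> inv t) U"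
        if "finite U" "U \<subseteq> T" for U
        using that
      proof (induction U rule: finite_induct)
        case empty
        then show ?case using tH by simp
      next
        case (insert s U)
        have fU: "f \<in> U \<rightarrow> Z" "f s \<in> Z" using insert fT by auto
        have tfU: "(\<lambda>s. t \<otimes> f s \<otimes> inv t) \<in> U \<rightarrow> Z" "t \<otimes> f s \<otimes> inv t \<in> Z"
          using fU Z_norm[OF tH(1)] by auto
        have wU: "finprod ?ZG f U \<in> Z" using ZG.finprod_closed[of f U] fU by simp
        have "t \<otimes> finprod ?ZG f (insert s U) \<otimes> inv t = t \<otimes> (f s \<otimes> finprod ?ZG f U) \<otimes> inv t"
          using ZG.finprod_insert[of U s f] insert fU by simp
        also have "\<dots> = (t \<otimes> f s \<otimes> inv t) \<otimes> (t \<otimes> finprod ?ZG f U \<otimes> inv t)"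
          using tH(2) fU(2) wU by (simp add: H.m_assoc) (simp flip: H.m_assoc)
        also have "\<dots> = finprod ?ZG (\<lambda>s. t \<otimes> f s \<otimes> inv t) (insert s U)"
          using ZG.finprod_insert[of U s "\<lambda>s. t \<otimes> f s \<otimes> inv t"] insert tfU by simp
        finally show ?case .
      qed
      have "t \<otimes> ?w \<otimes> inv t = finprod ?ZG (\<lambda>s. t \<otimes> f s \<otimes> inv t) T"
        using conj[OF finT] by simp
      also have "\<dots> = finprod ?ZG (\<lambda>s. f (t \<otimes> s)) T"
      proof (rule ZG.finprod_cong')
        show "(\<lambda>s. f (t \<otimes> s)) \<in> T \<rightarrow> carrier ?ZG" using fT T(3) by auto
        fix s assume "s \<in> T"
        then show "t \<otimes> f s \<otimes> inv t = f (t \<otimes> s)"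
          using tH(2) v H.conj_conj[of t s v] by (simp add: f_def)
      qed simp
      also have "\<dots> = finprod ?ZG f ((\<lambda>s. t \<otimes> s) ` T)"
        using fT T(3) tH(2) by (intro ZG.finprod_reindex[symmetric]) (auto simp: inj_on_def)
      also have "(\<lambda>s. t \<otimes> s) ` T = T"
        using T(3) tH(2) by (intro endo_inj_surj[OF finT]) (auto simp: inj_on_def)
      finally have fixed: "t \<otimes> ?w \<otimes> inv t = ?w" .
      have wc: "?w \<in> carrier G" using wZ by simp
      have "?w \<otimes> t = t \<otimes> ?w \<otimes> inv t \<otimes> t" using fixed by simp
      then have "?w \<otimes> t = t \<otimes> ?w" using wc tH(2) by (simp add: H.m_assoc)
      moreover have "t \<notin> H.K" using H.H_kernel[OF tH(1)] T(4) by blast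
      ultimately show ?thesis using H.kernel_centralizer[OF tH(2)] wZ Z(2) by blast
    qed
    have fA: "f \<in> A \<rightarrow> carrier ?ZG" using f AH by auto
    have fS: "f \<in> S a \<rightarrow> carrier ?ZG" if "a \<in> A" for a using f S_H[OF that] by auto
    \<comment> \<open>The product over all of \<open>S a\<close> is trivial and its factor at the
      identity is \<open>v\<close>.\<close>
    have prodS: "finprod ?ZG f (S a - {\<one>}) = inv v" if a: "a \<in> A" for a
    proof -
      have one: "\<one> \<in> S a" using S_sub[OF a] by (rule subgroup.one_closed)
      obtain d where d: "d \<in> D" "d \<noteq> \<one>" using D1 D.H_one by blast
      have "inv a \<otimes> d \<otimes> a \<in> S a" using d by (auto simp: S_def conjugate_set_def)
      moreover have "inv a \<otimes> d \<otimes> a \<noteq> \<one>"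
        using D.conj_not_in_kernel[OF aA(1)[OF a] d] D.one_in_kernel by metis
      ultimately have "finprod ?ZG f (S a) = \<one>" using prod1[OF S_sub[OF a] S_H[OF a]] by blast
      moreover have "S a = insert \<one> (S a - {\<one>})" using one by blast
      moreover have "finprod ?ZG f (insert \<one> (S a - {\<one>})) = f \<one> \<otimes> finprod ?ZG f (S a - {\<one>})"
        using ZG.finprod_insert[of "S a - {\<one>}" \<one> f] fS[OF a] finS[OF a] one by (auto simp: Pi_iff)
      ultimately have eq: "v \<otimes> finprod ?ZG f (S a - {\<one>}) = \<one>" using v by (simp add: f_def)
      have "finprod ?ZG f (S a - {\<one>}) \<in> Z"
        using ZG.finprod_closed[of f "S a - {\<one>}"] fS[OF a] by (auto simp: Pi_iff)
      then have "finprod ?ZG f (S a - {\<one>}) \<in> carrier G" by simp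
      then show ?thesis using eq v by (metis H.inv_equality H.inv_inv H.inv_comm Z.mem_carrier)
    qed
    have "\<one> = finprod ?ZG f H"
      using prod1[OF H.subgroup_H order_refl] xt(2,3) by simp
    also have "\<dots> = finprod ?ZG f (A \<union> (\<Union>a\<in>A. S a - {\<one>}))" using H_eq by simp
    also have "\<dots> = finprod ?ZG f A \<otimes>\<^bsub>?ZG\<^esub> finprod ?ZG f (\<Union>a\<in>A. S a - {\<one>})"
    proof (rule ZG.finprod_Un_disjoint)
      show "A \<inter> (\<Union>a\<in>A. S a - {\<one>}) = {}" using A_disj by blast
    qed (use finA finS fA fS in \<open>auto simp: Pi_iff\<close>)
    also have "finprod ?ZG f A = \<one>" using prod1[OF A AH tA] .
    also have "finprod ?ZG f (\<Union>a\<in>A. S a - {\<one>}) = finprod ?ZG (\<lambda>a. finprod ?ZG f (S a - {\<one>})) A"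
      using finA finS fS S_disj by (intro ZG.finprod_UN_disjoint) (auto simp: Pi_iff pairwise_def disjnt_def)
    also have "\<dots> = finprod ?ZG (\<lambda>a. inv v) A"
      using v prodS by (intro ZG.finprod_cong') auto
    also have "\<dots> = inv v [^]\<^bsub>?ZG\<^esub> card A" using v by (intro ZG.finprod_const) simp
    also have "\<dots> = inv v [^] card A" by (simp flip: H.nat_pow_consistent)
    finally have "inv v [^] card A = \<one>" using v by simp
    moreover have "inv v [^] card H.K = \<one>"
    proof -
      have "inv v [^]\<^bsub>G\<lparr>carrier := H.K\<rparr>\<^esub> card H.K = \<one>"
        using group.pow_order_eq_1[OF H.subgroup_imp_group[OF H.kernel_subgroup], of "inv v"]
          v Z(2) H.kernel_inv by (auto simp: Coset.order_def)
      then show ?thesis by (simp flip: H.nat_pow_consistent)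
    qed
    ultimately have "H.ord (inv v) dvd card A" "H.ord (inv v) dvd card H.K"
      using v H.pow_eq_id by auto
    moreover have "card A dvd card H"
      using group.lagrange[OF H.subgroup_imp_group[OF H.subgroup_H] H.subgroup_incl[OF A H.subgroup_H AH]]
      by (simp add: Coset.order_def) (metis dvd_triv_right)
    ultimately have "H.ord (inv v) = 1"
      using H.coprime_card_kernel by (meson coprime_common_divisor_nat dvd_trans)
    then have "inv v = \<one>" using v H.ord_eq_1 by simp
    then show "v = \<one>" using v by (metis H.inv_inv H.inv_one Z.mem_carrier)
  qed
  then show False using Z(3) Z.one_closed by blast
qed

text \<open>Choose the conjugate of \<open>H1\<close> that normalizes \<open>Z\<close>. By the
  inclusion of kernels it supplements \<open>H2.K\<close>, hence contains a conjugate of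
  \<open>H2\<close>. Passing to these conjugates leaves both kernels unchanged, so
  \<open>kernel_subset_of_normalized_abelian\<close> gives the reverse inclusion.\<close>

lemma kernel_subset_imp_eq:
  fixes G (structure)
  assumes H1: "malnormal_subgroup G H1" "H1 \<noteq> {\<one>}" "frobenius_kernel G H1 \<noteq> {\<one>}"
    and H2: "malnormal_subgroup G H2" "H2 \<noteq> {\<one>}"
    and sub: "frobenius_kernel G H1 \<subseteq> frobenius_kernel G H2"
  shows "frobenius_kernel G H1 = frobenius_kernel G H2"
proof -
  interpret H1: malnormal_subgroup G H1 by (rule H1(1))
  interpret H2: malnormal_subgroup G H2 by (rule H2(1))
  obtain y Z where y: "y \<in> carrier G" and Z: "subgroup Z G" "Z \<subseteq> H1.K" "Z \<noteq> {\<one>}"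
    "\<And>a b. a \<in> Z \<Longrightarrow> b \<in> Z \<Longrightarrow> a \<otimes> b = b \<otimes> a"
    "\<And>h z. h \<in> conjugate_set G y H1 \<Longrightarrow> z \<in> Z \<Longrightarrow> h \<otimes> z \<otimes> inv h \<in> Z"
    using H1.normalized_abelian_subgroup[OF H1(2,3)] by blast
  interpret C1: malnormal_subgroup G "conjugate_set G y H1" by (rule H1.malnormal_conjugate_set[OF y])
  note C1K = H1.kernel_conjugate_set[OF y]
  have "\<exists>k\<in>H2.K. \<exists>n\<in>conjugate_set G y H1. g = k \<otimes> n" if g: "g \<in> carrier G" for g
  proof -
    obtain k n where k: "k \<in> C1.K" and n: "n \<in> conjugate_set G y H1" "g = k \<otimes> n"
      by (rule C1.kernel_factorization[OF g])
    have "k \<in> H2.K" using k sub unfolding C1K by (rule subsetD[rotated])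
    with n show ?thesis by blast
  qed
  then obtain x where x: "x \<in> carrier G" "conjugate_set G x H2 \<subseteq> conjugate_set G y H1"
    using H2.supplement_contains_conjugate[OF C1.subgroup_H _ H2(2)] by blast
  note C2K = H2.kernel_conjugate_set[OF x(1)]
  have "card H2 \<noteq> 1" using H2(2) H2.H_one by (metis card_1_singletonE singletonD)
  then have "conjugate_set G x H2 \<noteq> {\<one>}" using H2.card_conjugate_set[OF x(1)] by auto
  then have "frobenius_kernel G (conjugate_set G x H2) \<subseteq> frobenius_kernel G (conjugate_set G y H1)"
    using C1K C2K sub Z
    by (intro kernel_subset_of_normalized_abelian[OF C1.malnormal_subgroup_axioms
          H2.malnormal_conjugate_set[OF x(1)] x(2), of Z]) auto
  then show ?thesis unfolding C1K C2K using sub by (rule subset_antisym[rotated])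
qed

theorem frobenius_complements_same_card:
  fixes G (structure)
  assumes H1: "malnormal_subgroup G H1" "H1 \<noteq> {\<one>}" "H1 \<noteq> carrier G"
    and H2: "malnormal_subgroup G H2" "H2 \<noteq> {\<one>}" "H2 \<noteq> carrier G"
  shows "card H1 = card H2"
proof -
  interpret H1: malnormal_subgroup G H1 by (rule H1(1))
  interpret H2: malnormal_subgroup G H2 by (rule H2(1))
  have "H1.K \<noteq> {\<one>}"
    using H1.card_kernel H1(3) H1.H_subset card_subset_eq[OF H1.finite_carrier H1.H_subset] by auto
  moreover have "H2.K \<noteq> {\<one>}"
    using H2.card_kernel H2(3) H2.H_subset card_subset_eq[OF H1.finite_carrier H2.H_subset] by auto
  moreover have "H2.K \<subseteq> H1.K \<or> H1.K \<subseteq> H2.K"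
    by (rule H1.normal_subgroup_dichotomy[OF H2.kernel_normal])
  ultimately have "H1.K = H2.K"
    using kernel_subset_imp_eq[OF H1(1,2) _ H2(1,2)] kernel_subset_imp_eq[OF H2(1,2) _ H1(1,2)] by metis
  then have "card H1 * card H1.K = card H2 * card H1.K" using H1.card_kernel H2.card_kernel by simp
  moreover have "card H1.K > 0" using H1.finite_kernel H1.one_in_kernel by (auto simp: card_gt_0_iff)
  ultimately show ?thesis by simp
qed

section \<open>Frobenius permutation groups\<close>

lemma digraph_iso_of_bij_betw:
  assumes f: "bij_betw f (pverts X) (pverts Y)"
    and X: "parcs X \<subseteq> pverts X \<times> pverts X" and Y: "parcs Y \<subseteq> pverts Y \<times> pverts Y"
    and arcs: "\<And>u v. u \<in> pverts X \<Longrightarrow> v \<in> pverts X \<Longrightarrow> (u, v) \<in> parcs X \<longleftrightarrow> (f u, f v) \<in> parcs Y"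
  shows "digraph_iso (with_proj X) (with_proj Y)"
proof -
  define F where "F = \<lparr>iso_verts = f, iso_arcs = map_prod f f, iso_head = snd, iso_tail = fst\<rparr>"
  have inj: "inj_on f (pverts X)" and im: "f ` pverts X = pverts Y" using f by (auto simp: bij_betw_def)
  have "wf_digraph (with_proj X)"
    using X by (intro wf_digraph.intro) auto
  moreover have "inj_on (map_prod f f) (parcs X)"
    using map_prod_inj_on[OF inj inj] X by (rule inj_on_subset)
  ultimately have "pre_digraph.digraph_isomorphism (with_proj X) F"
    using inj by (auto simp: pre_digraph.digraph_isomorphism_def F_def)
  moreover have "map_prod f f ` parcs X = parcs Y"
  proof (intro equalityI subsetI)
    fix e assume "e \<in> map_prod f f ` parcs X"
    then show "e \<in> parcs Y" using X arcs by auto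
  next
    fix e assume e: "e \<in> parcs Y"
    then obtain u v where "e = (f u, f v)" "u \<in> pverts X" "v \<in> pverts X"
      using Y im by (cases e) blast
    then show "e \<in> map_prod f f ` parcs X" using arcs e by (force intro: rev_image_eqI[of "(u,v)"])
  qed
  then have "with_proj Y = app_iso F (with_proj X)"
    using im by (simp add: with_proj_def app_iso_def F_def)
  ultimately show ?thesis by (auto simp: digraph_iso_def)
qed

lemma frobenius_complement_malnormal:
  assumes "finite_group G" "frobenius_complement G H"
  shows "malnormal_subgroup G H"
proof -
  interpret finite_group G by fact
  show ?thesis
  proof (intro malnormal_subgroup.intro malnormal_subgroup_axioms.intro)
    show "finite_group G" by fact
    show H: "subgroup H G" using assms by (simp add: frobenius_complement_def)
    fix x h assume x: "x \<in> carrier G" and h: "h \<in> H" "h \<noteq> \<one>\<^bsub>G\<^esub>" "inv\<^bsub>G\<^esub> x \<otimes>\<^bsub>G\<^esub> h \<otimes>\<^bsub>G\<^esub> x \<in> H"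
    have hc: "h \<in> carrier G" using subgroup.mem_carrier[OF H h(1)] .
    show "x \<in> H"
    proof (rule ccontr)
      assume "x \<notin> H"
      then have "H \<inter> conjugate_set G x H = {\<one>\<^bsub>G\<^esub>}"
        using assms x by (simp add: frobenius_complement_def)
      moreover have "inv\<^bsub>G\<^esub> x \<otimes>\<^bsub>G\<^esub> h \<otimes>\<^bsub>G\<^esub> x \<in> conjugate_set G x H"
        using h(1) by (auto simp: conjugate_set_def)
      ultimately have "inv\<^bsub>G\<^esub> x \<otimes>\<^bsub>G\<^esub> h \<otimes>\<^bsub>G\<^esub> x = \<one>\<^bsub>G\<^esub>" using h(3) by blast
      then have "x \<otimes>\<^bsub>G\<^esub> (inv\<^bsub>G\<^esub> x \<otimes>\<^bsub>G\<^esub> h \<otimes>\<^bsub>G\<^esub> x) \<otimes>\<^bsub>G\<^esub> inv\<^bsub>G\<^esub> x = \<one>\<^bsub>G\<^esub>" using x by simp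
      then have "h = \<one>\<^bsub>G\<^esub>" using x hc by (simp add: m_assoc) (simp flip: m_assoc)
      then show False using h(2) by contradiction
    qed
  qed
qed

locale frobenius_perm_group =
  fixes n :: nat and G :: "(nat \<Rightarrow> nat) set"
  assumes frobenius: "frobenius_group n G"
begin

abbreviation PG where "PG \<equiv> perm_group n G"

lemma subgroup_G: "subgroup G (sym_group n)"
  and transitive: "x \<in> {1..n} \<Longrightarrow> y \<in> {1..n} \<Longrightarrow> \<exists>g\<in>G. g x = y"
  using frobenius by (auto simp: frobenius_group_def transitive_perm_group_def)

lemma permutes: "g \<in> G \<Longrightarrow> g permutes {1..n}"
  using subgroup.mem_carrier[OF subgroup_G] sym_group_carrier by blast

lemma finite_G: "finite G"
  by (rule finite_subset[OF _ finite_permutations[of "{1..n}"]]) (use permutes in auto)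

sublocale PG: finite_group PG
  by (intro finite_group.intro finite_group_axioms.intro group.subgroup_imp_group[OF sym_group_is_group subgroup_G])
    (simp add: finite_G)

lemma PG_simps [simp]: "carrier PG = G" "mult PG = (\<circ>)" "one PG = id"
  by (simp_all add: sym_group_mult sym_group_one)

lemma inv_apply: "g \<in> G \<Longrightarrow> (inv\<^bsub>PG\<^esub> g) (g x) = x" "g \<in> G \<Longrightarrow> g ((inv\<^bsub>PG\<^esub> g) x) = x"
  using PG.l_inv[of g] PG.r_inv[of g] by (auto dest: fun_cong)

lemma inv_closed: "g \<in> G \<Longrightarrow> inv\<^bsub>PG\<^esub> g \<in> G"
  using PG.inv_closed[of g] by simp

lemma comp_closed: "g \<in> G \<Longrightarrow> h \<in> G \<Longrightarrow> g \<circ> h \<in> G"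
  using PG.m_closed[of g h] by simp

lemma id_closed: "id \<in> G"
  using PG.one_closed by simp

lemma unique_fixed_point:
  assumes "g \<in> G" "x \<in> {1..n}" "y \<in> {1..n}" "g x = x" "g y = y" "x \<noteq> y"
  shows "g = id"
proof (rule ccontr)
  assume "g \<noteq> id"
  then have "card (fixed_points n g) \<le> 1" using frobenius assms by (auto simp: frobenius_group_def)
  moreover have "card {x,y} \<le> card (fixed_points n g)"
    using assms by (intro card_mono) (auto simp: fixed_points_def)
  ultimately show False using assms by simp
qed

text \<open>A point with a nontrivial stabilizer, so that the stabilizer \<open>S\<close> satisfies
  the nontriviality demanded of a complement.\<close>

definition point where
  "point = (SOME x. x \<in> {1..n} \<and> (\<exists>g\<in>G. g \<noteq> id \<and> g x = x))"

lemma point: "point \<in> {1..n}" and point_fixed: "\<exists>g\<in>G. g \<noteq> id \<and> g point = point"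
proof -
  have "\<exists>x. x \<in> {1..n} \<and> (\<exists>g\<in>G. g \<noteq> id \<and> g x = x)"
    using frobenius by (auto simp: frobenius_group_def fixed_points_def)
  from someI_ex[OF this] show "point \<in> {1..n}" "\<exists>g\<in>G. g \<noteq> id \<and> g point = point"
    by (auto simp: point_def)
qed

definition S where "S = {g\<in>G. g point = point}"

sublocale S: malnormal_subgroup PG S
proof (intro malnormal_subgroup.intro malnormal_subgroup_axioms.intro)
  show "finite_group PG" by (rule PG.finite_group_axioms)
  show "subgroup S PG"
  proof (rule PG.subgroupI)
    show "S \<noteq> {}" using id_closed by (auto simp: S_def intro!: exI[of _ id])
  next
    fix a assume "a \<in> S"
    then show "inv\<^bsub>PG\<^esub> a \<in> S" using inv_closed[of a] inv_apply(1)[of a point] by (auto simp: S_def)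
  qed (auto simp: S_def comp_closed)
  fix x h assume x: "x \<in> carrier PG" and h: "h \<in> S" "h \<noteq> \<one>\<^bsub>PG\<^esub>"
    "inv\<^bsub>PG\<^esub> x \<otimes>\<^bsub>PG\<^esub> h \<otimes>\<^bsub>PG\<^esub> x \<in> S"
  have xG: "x \<in> G" using x by simp
  have "(inv\<^bsub>PG\<^esub> x) (h (x point)) = point" using h(3) by (simp add: S_def)
  then have "h (x point) = x point" using inv_apply(2)[OF xG] by metis
  moreover have "x point \<in> {1..n}" using permutes_in_image[OF permutes[OF xG]] point by blast
  ultimately have "x point = point"
    using unique_fixed_point[of h "x point" point] h point by (auto simp: S_def)
  then show "x \<in> S" using xG by (simp add: S_def)
qed

lemma S_nontrivial: "S \<noteq> {\<one>\<^bsub>PG\<^esub>}"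
  using point_fixed by (auto simp: S_def)

text \<open>By transitivity a fixed point of \<open>g\<close> can be moved to \<open>point\<close>,
  which conjugates \<open>g\<close> into \<open>S\<close>. So the union of the conjugates of
  \<open>S\<close> consists of the elements with a fixed point.\<close>

lemma in_kernel_iff: "g \<in> S.K \<longleftrightarrow> g \<in> G \<and> (g = id \<or> fixed_points n g = {})"
proof (cases "g \<in> G")
  case g: True
  have "(\<exists>x\<in>G. x \<circ> g \<circ> inv\<^bsub>PG\<^esub> x \<in> S) \<longleftrightarrow> fixed_points n g \<noteq> {}"
  proof
    assume "\<exists>x\<in>G. x \<circ> g \<circ> inv\<^bsub>PG\<^esub> x \<in> S"
    then obtain x where x: "x \<in> G" "x (g ((inv\<^bsub>PG\<^esub> x) point)) = point" by (auto simp: S_def)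
    let ?y = "(inv\<^bsub>PG\<^esub> x) point"
    have "g ?y = ?y" using inv_apply(1)[OF x(1), of "g ?y"] x(2) by simp
    moreover have "?y \<in> {1..n}" using permutes_in_image[OF permutes[OF inv_closed[OF x(1)]]] point by blast
    ultimately show "fixed_points n g \<noteq> {}" by (auto simp: fixed_points_def)
  next
    assume "fixed_points n g \<noteq> {}"
    then obtain y where y: "y \<in> {1..n}" "g y = y" by (auto simp: fixed_points_def)
    obtain x where x: "x \<in> G" "x y = point" using transitive[OF y(1) point] by blast
    have "(inv\<^bsub>PG\<^esub> x) point = y" using inv_apply(1)[OF x(1), of y] x(2) by simp
    then have "x \<circ> g \<circ> inv\<^bsub>PG\<^esub> x \<in> S"
      using x y g by (simp add: S_def comp_closed inv_closed)
    then show "\<exists>x\<in>G. x \<circ> g \<circ> inv\<^bsub>PG\<^esub> x \<in> S" using x by blast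
  qed
  then show ?thesis using S.in_kernel_iff[of g] g by auto
next
  case False
  then show ?thesis using S.kernel_subset by auto
qed

text \<open>The kernel acts regularly: evaluation at \<open>point\<close> is injective since the
  kernel meets \<open>S\<close> trivially, and onto since G = K S and \<open>S\<close> fixes
  \<open>point\<close>.\<close>

lemma card_kernel_eq: "card S.K = n"
proof -
  have "bij_betw (\<lambda>k. k point) S.K {1..n}"
    unfolding bij_betw_def
  proof
    show "inj_on (\<lambda>k. k point) S.K"
    proof (rule inj_onI)
      fix k l assume k: "k \<in> S.K" "l \<in> S.K" "k point = l point"
      have kG: "k \<in> G" "l \<in> G" using k S.kernel_subset by auto
      have "inv\<^bsub>PG\<^esub> l \<circ> k \<in> S"
        using kG k(3) inv_apply(1)[OF kG(2), of point] by (simp add: S_def comp_closed inv_closed)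
      moreover have "inv\<^bsub>PG\<^esub> l \<circ> k \<in> S.K" using S.kernel_mult[OF S.kernel_inv[OF k(2)] k(1)] by simp
      ultimately have eq: "inv\<^bsub>PG\<^esub> l \<circ> k = id" using S.H_kernel by simp
      have "k x = l x" for x
        using inv_apply(2)[OF kG(2), of "k x"] fun_cong[OF eq, of x] by simp
      then show "k = l" by blast
    qed
    show "(\<lambda>k. k point) ` S.K = {1..n}"
    proof (intro equalityI subsetI)
      fix y assume "y \<in> (\<lambda>k. k point) ` S.K"
      then obtain k where "k \<in> G" "y = k point" using S.kernel_subset by auto
      then show "y \<in> {1..n}" using permutes_in_image[OF permutes] point by blast
    next
      fix y assume "y \<in> {1..n}"
      then obtain g where g: "g \<in> G" "g point = y" using transitive[OF point] by blast
      obtain k h where "k \<in> S.K" "h \<in> S" "g = k \<circ> h"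
        using S.kernel_factorization[of g] g(1) by auto
      then show "y \<in> (\<lambda>k. k point) ` S.K" using g(2) by (auto simp: S_def)
    qed
  qed
  then show ?thesis using bij_betw_same_card by fastforce
qed

text \<open>If \<open>S\<close> were everything, the kernel would have order 1, so n = 1 and
  \<open>G\<close> would contain only the identity.\<close>

lemma S_proper: "S \<noteq> carrier PG"
proof
  assume "S = carrier PG"
  then have "card S.K = 1"
    using S.card_kernel S.card_H_pos by simp
  then have n: "n = 1" using card_kernel_eq by simp
  obtain g where g: "g \<in> G" "g \<noteq> id" using point_fixed by blast
  have "g permutes {1}" using permutes[OF g(1)] n by simp
  then show False using g(2) by (simp add: permutes_sing)
qed

text \<open>In the factorization \<open>G = K S\<close> the \<open>S\<close>-part of a vertex names its clique and the \<open>K\<close>-part its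
  position inside the clique.\<close>

lemma derangement_graph_iso:
  "digraph_iso (with_proj (derangement_graph n G))
    (with_proj (disjoint_copies (card S) (complete_graph n)))"
proof -
  obtain eS where eS: "bij_betw eS S {..<card S}"
    using ex_bij_betw_finite_nat[OF S.finite_H] by (auto simp: lessThan_atLeast0)
  obtain eK where eK: "bij_betw eK S.K {..<n}"
    using ex_bij_betw_finite_nat[OF S.finite_kernel] by (auto simp: lessThan_atLeast0 card_kernel_eq)
  let ?m = "\<lambda>(k,s). k \<otimes>\<^bsub>PG\<^esub> s"
  have m: "bij_betw ?m (S.K \<times> S) G" using S.kernel_factorization_bij by simp
  define f where "f = (\<lambda>(k,s). (eS s, eK k)) \<circ> the_inv_into (S.K \<times> S) ?m"
  have f: "f (k \<otimes>\<^bsub>PG\<^esub> s) = (eS s, eK k)" if "k \<in> S.K" "s \<in> S" for k s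
    using the_inv_into_f_f[OF bij_betw_imp_inj_on[OF m], of "(k,s)"] that by (simp add: f_def)
  have e: "bij_betw (\<lambda>(k,s). (eS s, eK k)) (S.K \<times> S) ({..<card S} \<times> {..<n})"
  proof -
    have "bij_betw prod.swap (S.K \<times> S) (S \<times> S.K)" by (simp add: bij_betw_def product_swap)
    moreover have "bij_betw (map_prod eS eK) (S \<times> S.K) ({..<card S} \<times> {..<n})"
      unfolding bij_betw_def
      using map_prod_inj_on[OF bij_betw_imp_inj_on[OF eS] bij_betw_imp_inj_on[OF eK]]
        map_prod_surj_on[OF bij_betw_imp_surj_on[OF eS] bij_betw_imp_surj_on[OF eK]] by (rule conjI)
    ultimately have "bij_betw (map_prod eS eK \<circ> prod.swap) (S.K \<times> S) ({..<card S} \<times> {..<n})"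
      by (rule bij_betw_trans)
    moreover have "map_prod eS eK \<circ> prod.swap = (\<lambda>(k,s). (eS s, eK k))" by auto
    ultimately show ?thesis by simp
  qed
  show ?thesis
  proof (rule digraph_iso_of_bij_betw)
    have "bij_betw f G ({..<card S} \<times> {..<n})"
      unfolding f_def by (rule bij_betw_trans[OF bij_betw_the_inv_into[OF m] e])
    then show "bij_betw f (pverts (derangement_graph n G)) (pverts (disjoint_copies (card S) (complete_graph n)))"
      by (simp add: derangement_graph_def disjoint_copies_def complete_graph_def)
  next
    fix u v assume "u \<in> pverts (derangement_graph n G)" "v \<in> pverts (derangement_graph n G)"
    then have uv: "u \<in> G" "v \<in> G" by (auto simp: derangement_graph_def)
    obtain k s where u: "k \<in> S.K" "s \<in> S" "u = k \<otimes>\<^bsub>PG\<^esub> s"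
      using S.kernel_factorization[of u] uv by auto
    obtain k' s' where v: "k' \<in> S.K" "s' \<in> S" "v = k' \<otimes>\<^bsub>PG\<^esub> s'"
      using S.kernel_factorization[of v] uv by auto
    let ?x = "u \<otimes>\<^bsub>PG\<^esub> inv\<^bsub>PG\<^esub> v"
    have x: "?x \<in> G" using comp_closed[OF uv(1) inv_closed[OF uv(2)]] by simp
    \<comment> \<open>The identity belongs to the kernel without being a derangement, so adjacency
      means a quotient in the kernel different from \<open>id\<close>.\<close>
    have "fixed_points n id \<noteq> {}" using point by (auto simp: fixed_points_def)
    then have "(u, v) \<in> parcs (derangement_graph n G) \<longleftrightarrow> ?x \<in> S.K \<and> ?x \<noteq> id"
      using uv x in_kernel_iff[of ?x] by (auto simp: derangement_graph_def)
    also have "?x \<noteq> id \<longleftrightarrow> u \<noteq> v"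
    proof -
      have "?x = \<one>\<^bsub>PG\<^esub> \<longleftrightarrow> u = v"
        using uv PG.r_inv[of v] PG.inv_equality[of u "inv\<^bsub>PG\<^esub> v"] PG.inv_inv[of v]
          PG.inv_closed[of v] by (metis PG_simps(1))
      then show ?thesis by simp
    qed
    also have "?x \<in> S.K \<longleftrightarrow> s = s'" unfolding u(3) v(3) by (rule S.kernel_mult_inv_iff[OF u(1) v(1) u(2) v(2)])
    also have "u \<noteq> v \<longleftrightarrow> \<not> (k = k' \<and> s = s')"
      using inj_onD[OF bij_betw_imp_inj_on[OF m], of "(k,s)" "(k',s')"] u v by auto
    also have "s = s' \<and> \<not> (k = k' \<and> s = s') \<longleftrightarrow> eS s = eS s' \<and> eK k \<noteq> eK k'"
      using inj_onD[OF bij_betw_imp_inj_on[OF eS]] inj_onD[OF bij_betw_imp_inj_on[OF eK]] u v by metis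
    also have "\<dots> \<longleftrightarrow> (f u, f v) \<in> parcs (disjoint_copies (card S) (complete_graph n))"
      using bij_betwE[OF eS] bij_betwE[OF eK] u(1,2) v(1,2)
      unfolding u(3) v(3) f[OF u(1,2)] f[OF v(1,2)]
      by (auto simp: disjoint_copies_def complete_graph_def)
    finally show "(u, v) \<in> parcs (derangement_graph n G) \<longleftrightarrow>
      (f u, f v) \<in> parcs (disjoint_copies (card S) (complete_graph n))" .
  qed (auto simp: derangement_graph_def disjoint_copies_def complete_graph_def)
qed

end

theorem theorem5p10:
  fixes n :: nat and G H K :: "(nat \<Rightarrow> nat) set"
  assumes "frobenius_group n G"
    and "frobenius_complement (perm_group n G) H"
    and "K = frobenius_kernel (perm_group n G) H"
  shows "G = K <#>\<^bsub>perm_group n G\<^esub> H \<and>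
    digraph_iso (with_proj (derangement_graph n G))
      (with_proj (disjoint_copies (card H) (complete_graph n)))"
proof -
  interpret frobenius_perm_group n G by unfold_locales (rule assms(1))
  interpret H: malnormal_subgroup PG H
    by (rule frobenius_complement_malnormal[OF PG.finite_group_axioms assms(2)])
  have "card H = card S"
    using assms(2) S_nontrivial S_proper
    by (intro frobenius_complements_same_card[of PG] H.malnormal_subgroup_axioms S.malnormal_subgroup_axioms)
      (auto simp: frobenius_complement_def)
  moreover have "G = K <#>\<^bsub>PG\<^esub> H"
  proof (intro equalityI subsetI)
    fix g assume "g \<in> G"
    then obtain k h where "k \<in> K" "h \<in> H" "g = k \<otimes>\<^bsub>PG\<^esub> h"
      using H.kernel_factorization[of g] assms(3) by auto
    then show "g \<in> K <#>\<^bsub>PG\<^esub> H" by (auto simp: set_mult_def)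
  next
    fix g assume "g \<in> K <#>\<^bsub>PG\<^esub> H"
    then obtain k h where kh: "k \<in> K" "h \<in> H" "g = k \<otimes>\<^bsub>PG\<^esub> h" by (auto simp: set_mult_def)
    have "k \<in> carrier PG" using kh(1) H.kernel_subset assms(3) by blast
    then show "g \<in> G" using kh(3) PG.m_closed[OF _ H.H_carrier[OF kh(2)]] by simp
  qed
  ultimately show ?thesis using derangement_graph_iso by simp
qed

end
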